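(* Let $D\subset\mathbb{C}^n$ be a bounded domain and let $p\in\partial D$ be a $C^2$ boundary point of $D$. Suppose there are a sequence $z_j\in D$ ($j\ge 1$) converging to $p$ and a sequence of positive numbers $\epsilon_j$ ($j\ge 1$) converging to $0$ such that $e_D(z_j)>1-\epsilon_j\,\delta(z_j)$ for all $j$, where $\delta(z)$ denotes the Euclidean distance from $z$ to $\partial D$. Then $D$ is biholomorphic to the unit ball of $\mathbb{C}^n$.
   Context: $B^n$ denotes the open unit ball in $\mathbb{C}^n$. A point $p\in\partial D$ is a $C^2$ boundary point of $D$ if $\partial D$ is $C^2$-smooth near $p$, i.e. there are an open neighborhood $U$ of $p$ and a real-valued $C^2$ function $\rho$ on $U$ with $d\rho\ne 0$ on $U$ and $D\cap U=\{z\in U:\rho(z)<0\}$. The Kobayashi distance $d_D$ on $D$ is normalized so that on the unit disc $\Delta\subset\mathbb{C}$ one has $d_\Delta(0,\zeta)=\log\frac{1+|\zeta|}{1-|\zeta|}$. For $z\in D$ and $r>0$, $B^K_D(z,r)=\{w\in D: d_D(z,w)<r\}$. Fridman's invariant: for a bounded domain $D\subset\mathbb{C}^n$, $z\in D$, and an injective holomorphic map $f:B^n\to D$ with $f(0)=z$, let $q_{D,f}(z)\in(0,\infty]$ be the supremum of all $r>0$ such that $B^K_D(z,r)\subset f(B^n)$. Then $h_D(z)=\inf_f \frac{1}{q_{D,f}(z)}$ (with $1/\infty=0$), where the infimum is over all injective holomorphic maps $f:B^n\to D$ with $f(0)=z$. The function $e_D:D\to(0,1]$ is defined by $\frac{1}{h_D(z)}=\log\frac{1+e_D(z)}{1-e_D(z)}$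 if $h_D(z)>0$, and $e_D(z)=1$ if $h_D(z)=0$. *)

theory Defs
  imports "HOL-Complex_Analysis.Complex_Analysis" "HOL-Library.Extended_Real"
begin

text \<open>
  \<open>complex ^ 'n\<close> carries the Hermitian \<open>L2\<close> norm, so \<^term>\<open>ball (0 :: complex ^ 'n) 1\<close> is the
  Euclidean unit ball \<open>B\<^sup>n\<close> and \<^const>\<open>infdist\<close> the Euclidean distance.
\<close>

text \<open>
  Holomorphy is complex Frechet differentiability. \<^const>\<open>has_derivative\<close> only makes the
  derivative real linear, so homogeneity over the complex numbers is required separately.
  Intended for open \<open>S\<close>.
\<close>

definition holomorphic_map_on ::
    "(complex ^ 'm \<Rightarrow> complex ^ 'n) \<Rightarrow> (complex ^ 'm) set \<Rightarrow> bool" where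
  "holomorphic_map_on f S \<longleftrightarrow>
     (\<forall>z\<in>S. \<exists>f'. (f has_derivative f') (at z) \<and> (\<forall>c v. f' (c *s v) = c *s f' v))"

definition biholomorphic :: "(complex ^ 'm) set \<Rightarrow> (complex ^ 'n) set \<Rightarrow> bool" where
  "biholomorphic D E \<longleftrightarrow>
     (\<exists>f g. holomorphic_map_on f D \<and> f ` D = E \<and>
            holomorphic_map_on g E \<and> g ` E = D \<and>
            (\<forall>z\<in>D. g (f z) = z) \<and> (\<forall>w\<in>E. f (g w) = w))"

definition C2_on :: "('a::real_normed_vector \<Rightarrow> real) \<Rightarrow> 'a set \<Rightarrow> bool" where
  "C2_on \<rho> U \<longleftrightarrow>
     (\<exists>(\<rho>' :: 'a \<Rightarrow> 'a \<Rightarrow>\<^sub>L real) (\<rho>'' :: 'a \<Rightarrow> 'a \<Rightarrow>\<^sub>L 'a \<Rightarrow>\<^sub>L real).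
        (\<forall>x\<in>U. (\<rho> has_derivative blinfun_apply (\<rho>' x)) (at x)) \<and>
        (\<forall>x\<in>U. (\<rho>' has_derivative blinfun_apply (\<rho>'' x)) (at x)) \<and>
        continuous_on U \<rho>'')"

definition C2_boundary_point :: "(complex ^ 'n) set \<Rightarrow> complex ^ 'n \<Rightarrow> bool" where
  "C2_boundary_point D p \<longleftrightarrow>
     p \<in> frontier D \<and>
     (\<exists>U \<rho>. open U \<and> p \<in> U \<and> C2_on \<rho> U \<and>
        (\<forall>z\<in>U. frechet_derivative \<rho> (at z) \<noteq> (\<lambda>v. 0)) \<and>
        D \<inter> U = {z \<in> U. \<rho> z < 0})"

text \<open>The Poincare distance of the unit disc, without the factor \<open>1/2\<close> that is often used.\<close>

definition poincare_dist :: "complex \<Rightarrow> complex \<Rightarrow> real" where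
  "poincare_dist a b =
     (let m = cmod ((a - b) / (1 - cnj a * b)) in ln ((1 + m) / (1 - m)))"

lemma poincare_dist_0: "poincare_dist 0 \<zeta> = ln ((1 + cmod \<zeta>) / (1 - cmod \<zeta>))"
  by (simp add: poincare_dist_def Let_def)

definition holomorphic_disc_in :: "(complex \<Rightarrow> complex ^ 'n) \<Rightarrow> (complex ^ 'n) set \<Rightarrow> bool" where
  "holomorphic_disc_in \<phi> D \<longleftrightarrow>
     (\<forall>i. (\<lambda>\<zeta>. \<phi> \<zeta> $ i) holomorphic_on ball 0 1) \<and> \<phi> ` ball 0 1 \<subseteq> D"

text \<open>
  Infimum over chains of holomorphic discs \<open>\<phi> i\<close> joining \<open>x i\<close> to \<open>x (Suc i)\<close>. On a (connected)
  domain such chains exist between any two points, so the real infimum is over a nonempty set.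
\<close>

definition kobayashi_dist :: "(complex ^ 'n) set \<Rightarrow> complex ^ 'n \<Rightarrow> complex ^ 'n \<Rightarrow> real" where
  "kobayashi_dist D z w =
     Inf {(\<Sum>i<k. poincare_dist (a i) (b i)) |k \<phi> a b x.
            x 0 = z \<and> x k = w \<and>
            (\<forall>i<k. holomorphic_disc_in (\<phi> i) D \<and> a i \<in> ball 0 1 \<and> b i \<in> ball 0 1 \<and>
                   \<phi> i (a i) = x i \<and> \<phi> i (b i) = x (Suc i))}"

definition kobayashi_ball :: "(complex ^ 'n) set \<Rightarrow> complex ^ 'n \<Rightarrow> real \<Rightarrow> (complex ^ 'n) set" where
  "kobayashi_ball D z r = {w \<in> D. kobayashi_dist D z w < r}"

definition ball_embeddings ::
    "(complex ^ 'n) set \<Rightarrow> complex ^ 'n \<Rightarrow> (complex ^ 'n \<Rightarrow> complex ^ 'n) set" where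
  "ball_embeddings D z =
     {f. holomorphic_map_on f (ball 0 1) \<and> inj_on f (ball 0 1) \<and>
         f ` ball 0 1 \<subseteq> D \<and> f 0 = z}"

definition fridman_q ::
    "(complex ^ 'n) set \<Rightarrow> (complex ^ 'n \<Rightarrow> complex ^ 'n) \<Rightarrow> complex ^ 'n \<Rightarrow> ereal" where
  "fridman_q D f z = Sup {ereal r |r. r > 0 \<and> kobayashi_ball D z r \<subseteq> f ` ball 0 1}"

definition fridman_h :: "(complex ^ 'n) set \<Rightarrow> complex ^ 'n \<Rightarrow> ereal" where
  "fridman_h D z = (INF f\<in>ball_embeddings D z. 1 / fridman_q D f z)"

definition fridman_e :: "(complex ^ 'n) set \<Rightarrow> complex ^ 'n \<Rightarrow> real" where
  "fridman_e D z =
     (if fridman_h D z = 0 then 1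
      else (THE e. 0 < e \<and> e < 1 \<and> 1 / fridman_h D z = ereal (ln ((1 + e) / (1 - e)))))"

text \<open>The description in \<^const>\<open>fridman_e\<close> is proper whenever \<open>1 / h\<close> is a positive real.\<close>

lemma fridman_e_unique:
  fixes t :: real
  assumes "t > 0"
  shows "\<exists>!e. 0 < e \<and> e < 1 \<and> ereal t = ereal (ln ((1 + e) / (1 - e)))"
proof (rule ex1I[of _ "(exp t - 1) / (exp t + 1)"])
  have g: "exp t > 1" and s: "exp t + 1 \<noteq> 0" using assms by (simp, smt (verit) exp_gt_zero)
  have p: "0 < exp t + 1" using g by linarith
  have "1 + (exp t - 1) / (exp t + 1) = 2 * exp t / (exp t + 1)"
       "1 - (exp t - 1) / (exp t + 1) = 2 / (exp t + 1)"
    using s by (simp_all add: field_simps)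
  then have "(1 + (exp t - 1) / (exp t + 1)) / (1 - (exp t - 1) / (exp t + 1)) = exp t"
    using s by simp
  moreover have "0 < (exp t - 1) / (exp t + 1)" "(exp t - 1) / (exp t + 1) < 1"
    using g p by (simp_all add: pos_divide_less_eq)
  ultimately show "0 < (exp t - 1) / (exp t + 1) \<and> (exp t - 1) / (exp t + 1) < 1 \<and>
      ereal t = ereal (ln ((1 + (exp t - 1) / (exp t + 1)) / (1 - (exp t - 1) / (exp t + 1))))"
    by (simp only: ln_exp simp_thms)
next
  fix e assume e: "0 < e \<and> e < 1 \<and> ereal t = ereal (ln ((1 + e) / (1 - e)))"
  then have "exp t = (1 + e) / (1 - e)" by simp
  moreover have "exp t + 1 \<noteq> 0" by (smt (verit) exp_gt_zero)
  ultimately show "e = (exp t - 1) / (exp t + 1)"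
    using e by (simp add: field_simps)
qed

end

theory Submission imports Defs begin

text \<open>
  Fix a base point \<open>z0\<close> of \<open>D\<close>. The hypothesis yields injective holomorphic maps \<open>f\<close> from the ball into
  \<open>D\<close> with \<open>f 0 = z j\<close> whose images contain Kobayashi balls of radius \<open>- ln (\<epsilon> j) - ln \<delta>\<close> about \<open>z j\<close>,
  where \<open>\<delta>\<close> is the distance of \<open>z j\<close> to the boundary. Since the boundary is \<open>C\<^sup>2\<close> at \<open>p\<close>, the Kobayashi
  distance from \<open>z j\<close> to \<open>z0\<close> is at most \<open>C - ln \<delta>\<close>, so these images contain Kobayashi balls about
  \<open>z0\<close> of radius \<open>- ln (\<epsilon> j) - C\<close>, which tends to infinity. After composition with automorphisms of the
  ball the maps send \<open>0\<close> to \<open>z0\<close>, and limits of these maps and of their inverses are mutually inverse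
  biholomorphisms. That the inverse of an injective holomorphic map is holomorphic is deduced from
  Rado's theorem on complex lines.
\<close>

section \<open>Rado's theorem\<close>

text \<open>The factor \<open>\<delta>\<close> in the hypothesis cancels exactly:
  \<open>e > 1 - x\<close> gives an embedding radius beyond \<open>- ln x\<close>, and a disc
  attached at a C^2 point reaches depth \<open>\<delta>\<close> at the cost of
  \<open>- ln \<delta>\<close> plus a constant, both with coefficient 1. So an upper estimate of the
  distance suffices. The passage to the limit is shaped by the lack of control at the frontier: a
  limit of maps into \<open>D\<close> might touch it, and smoothness is known near one point only.
  The limit of the inverses is kept inside the ball by the maximum principle. The limit of the maps
  themselves is placed in \<open>D\<close> only at the very end, through surjectivity of the other
  limit. The classical fact that an injective holomorphic map has nonvanishing Jacobian rests on
  local analytic geometry. With Rado's theorem it is enough that the Jacobian vanishes on no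
  nonempty open set, which is a rank argument for real C^1 maps. As holomorphy is assumed only as
  pointwise differentiability, the theory in several variables is built from one-variable facts on
  complex lines.\<close>

locale rado =
  fixes h :: "complex \<Rightarrow> complex" and \<Omega> :: "complex set"
  assumes conth: "continuous_on (cball 0 1) h"
    and Omega: "\<Omega> = {t \<in> ball 0 1. h t \<noteq> 0}"
    and holh: "h holomorphic_on \<Omega>"
    and nonempty: "\<Omega> \<noteq> {}"
begin

lemma open_Omega: "open \<Omega>"
proof -
  have "continuous_on (ball 0 1) h"
    using conth by (rule continuous_on_subset) auto
  then have "open (ball 0 1 \<inter> h -` (- {0}))"
    by (intro continuous_open_preimage) auto
  moreover have "ball 0 1 \<inter> h -` (- {0}) = \<Omega>" by (auto simp: Omega)
  ultimately show ?thesis by simp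
qed

lemma closure_Omega: "closure \<Omega> \<subseteq> cball 0 1"
  by (rule closure_minimal) (auto simp: Omega)

lemma max_modulus_frontier:
  assumes "continuous_on (closure \<Omega>) v" "v holomorphic_on \<Omega>"
    and "\<And>s. s \<in> closure \<Omega> \<Longrightarrow> norm s = 1 \<or> h s = 0 \<Longrightarrow> norm (v s) \<le> B" "t \<in> \<Omega>"
  shows "norm (v t) \<le> B"
proof (rule maximum_modulus_frontier[of v \<Omega> B])
  show "v holomorphic_on interior \<Omega>" using assms(2) open_Omega by (simp add: interior_open)
  show "bounded \<Omega>" by (rule bounded_subset[OF bounded_cball[of 0 1]]) (auto simp: Omega)
  show "norm (v s) \<le> B" if "s \<in> frontier \<Omega>" for s
  proof -
    have s: "s \<in> closure \<Omega>" "s \<notin> \<Omega>" using that open_Omega by (auto simp: frontier_def interior_open)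
    then have "s \<in> cball 0 1" using closure_Omega by blast
    then have "norm s = 1 \<or> h s = 0" using s(2) by (auto simp: Omega)
    then show ?thesis using assms(3) s(1) by blast
  qed
qed (use assms in auto)

text \<open>The factor \<open>h\<close> kills the part of the frontier of \<open>\<Omega>\<close> inside the disc; high powers of \<open>u\<close>
  make its influence on the bound disappear.\<close>

lemma max_principle:
  assumes contu: "continuous_on (closure \<Omega>) u" and holu: "u holomorphic_on \<Omega>"
    and bound: "\<And>t. t \<in> closure \<Omega> \<Longrightarrow> norm t = 1 \<Longrightarrow> norm (u t) \<le> M"
    and M: "M > 0" and t: "t \<in> \<Omega>"
  shows "norm (u t) \<le> M"
proof (rule ccontr)
  assume "\<not> norm (u t) \<le> M"
  have ch: "continuous_on (closure \<Omega>) h"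
    using conth closure_Omega by (rule continuous_on_subset)
  have "bounded (h ` cball 0 1)"
    by (rule compact_imp_bounded[OF compact_continuous_image[OF conth compact_cball]])
  then obtain H where H: "H > 0" "\<And>s. s \<in> cball 0 1 \<Longrightarrow> norm (h s) \<le> H"
    unfolding bounded_pos by auto
  have le: "norm (u t) ^ N * norm (h t) \<le> M ^ N * H" for N
  proof -
    have "norm (u t ^ N * h t) \<le> M ^ N * H"
    proof (rule max_modulus_frontier[OF _ _ _ t])
      show "continuous_on (closure \<Omega>) (\<lambda>t. u t ^ N * h t)"
        by (intro continuous_on_mult continuous_on_power contu ch)
      show "(\<lambda>t. u t ^ N * h t) holomorphic_on \<Omega>"
        by (intro holomorphic_on_mult holomorphic_on_power holu holh)
      show "norm (u s ^ N * h s) \<le> M ^ N * H" if "s \<in> closure \<Omega>" "norm s = 1 \<or> h s = 0" for s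
      proof (cases "h s = 0")
        case True then show ?thesis using M H by simp
      next
        case False
        with that have "norm (u s) \<le> M" "norm (h s) \<le> H" using bound H(2)[of s] by auto
        then show ?thesis using M unfolding norm_mult norm_power
          by (intro mult_mono power_mono) auto
      qed
    qed
    then show ?thesis by (simp add: norm_mult norm_power)
  qed
  have ht: "norm (h t) > 0" using t by (simp add: Omega)
  have "1 < norm (u t) / M" using M \<open>\<not> norm (u t) \<le> M\<close> by simp
  then obtain N where "H / norm (h t) < (norm (u t) / M) ^ N"
    using real_arch_pow by blast
  then have "M ^ N * H < norm (u t) ^ N * norm (h t)"
    using ht M by (simp add: field_simps)
  with le[of N] show False by simp
qed

text \<open>For \<open>b\<close> in the disc off the closure, \<open>max_principle\<close> applies
  to \<open>1 / (t - b)\<close> with the bound \<open>1 / (1 - norm b)\<close> from the circle, so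
  \<Omega> keeps distance at least \<open>1 - norm b\<close> from \<open>b\<close>. Such a
  \<open>b\<close> cannot be close to a point of the closure, which makes the closure clopen in the
  disc.\<close>

lemma dense: "ball 0 1 \<subseteq> closure \<Omega>"
proof -
  have dist: "1 - norm b \<le> dist t b" if "b \<in> ball 0 1" "b \<notin> closure \<Omega>" "t \<in> \<Omega>" for t b
  proof -
    have b: "norm b < 1" using that by simp
    have "norm (1 / (t - b)) \<le> 1 / (1 - norm b)"
    proof (rule max_principle[OF _ _ _ _ that(3)])
      show "0 < 1 / (1 - norm b)" using b by simp
      show "continuous_on (closure \<Omega>) (\<lambda>t. 1 / (t - b))" using that by (auto intro!: continuous_intros)
      show "(\<lambda>t. 1 / (t - b)) holomorphic_on \<Omega>"
        using that closure_subset[of \<Omega>] by (intro holomorphic_intros) auto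
      show "norm (1 / (t - b)) \<le> 1 / (1 - norm b)" if "norm t = 1" for t
        using b norm_triangle_ineq2[of t b] that by (auto simp: norm_divide intro!: divide_left_mono mult_pos_pos)
    qed
    moreover have "t \<noteq> b" using that closure_subset by auto
    ultimately show ?thesis using b by (simp add: norm_divide dist_norm field_simps)
  qed
  have "openin (top_of_set (ball 0 1)) (ball (0::complex) 1 \<inter> closure \<Omega>)"
  proof -
    have "open (ball 0 1 \<inter> closure \<Omega>)" unfolding open_contains_ball
    proof
      fix t assume t: "t \<in> ball 0 1 \<inter> closure \<Omega>"
      \<comment> \<open>A point \<open>b\<close> within \<open>r\<close> of \<open>t\<close> has
        \<open>1 - norm b > 3 * r\<close>, whereas \<Omega> would have a point at distance less than
        \<open>2 * r\<close> from \<open>b\<close>.\<close>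
      define r where "r = (1 - norm t) / 4"
      have r: "r > 0" "norm t = 1 - 4 * r" using t by (auto simp: r_def field_simps)
      have "b \<in> ball 0 1 \<inter> closure \<Omega>" if b: "b \<in> ball t r" for b
      proof (rule ccontr)
        assume nb: "b \<notin> ball 0 1 \<inter> closure \<Omega>"
        have "norm b \<le> norm t + dist t b" using norm_triangle_ineq[of t "b - t"] by (simp add: dist_norm norm_minus_commute)
        with b r have nb1: "norm b < 1 - 3 * r" by simp
        then have b1: "b \<in> ball 0 1" using r by simp
        then have b2: "b \<notin> closure \<Omega>" using nb by simp
        obtain s where s: "s \<in> \<Omega>" "dist s t < r"
          using t r(1) unfolding Int_iff closure_approachable by blast
        have "dist s b \<le> dist s t + dist t b" by (rule dist_triangle)
        with s b dist[OF b1 b2 s(1)] nb1 r(1) show False by (simp add: dist_commute)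
      qed
      then show "\<exists>e>0. ball t e \<subseteq> ball 0 1 \<inter> closure \<Omega>" using r by blast
    qed
    then show ?thesis by (simp add: openin_open_Int openin_open_eq)
  qed
  moreover have "closedin (top_of_set (ball 0 1)) (ball (0::complex) 1 \<inter> closure \<Omega>)"
    by (simp add: closedin_closed_Int)
  moreover have "\<Omega> \<subseteq> ball 0 1" by (auto simp: Omega)
  then have "ball 0 1 \<inter> closure \<Omega> \<noteq> {}" using nonempty closure_subset[of \<Omega>] by blast
  ultimately have "ball 0 1 \<inter> closure \<Omega> = ball 0 1"
    using connected_clopen[THEN iffD1, OF connected_ball, rule_format, of 0 1 "ball 0 1 \<inter> closure \<Omega>"] by simp
  then show ?thesis by auto
qed

lemma closure_eq: "closure \<Omega> = cball 0 1"
proof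
  show "cball 0 1 \<subseteq> closure \<Omega>"
    using closure_mono[OF dense] by simp
qed (rule closure_Omega)

end

section \<open>Laurent polynomials and real parts of entire functions on the unit circle\<close>

lemma real_polynomial_on_circle:
  assumes "real_polynomial_function p"
  shows "\<exists>P N. \<forall>z\<in>sphere (0::complex) 1. complex_of_real (p z) = poly P z / z ^ N"
  using assms
proof (induction rule: real_polynomial_function.induct)
  case (linear f)
  interpret bounded_linear f by fact
  \<comment> \<open>\<open>c\<close> and \<open>d\<close> are the coefficients in
    \<open>f z = c * z + d * cnj z\<close>. On the circle \<open>cnj z\<close> is
    \<open>1 / z\<close>, which is where the denominators come from.\<close>
  define c where "c = (f 1 - \<i> * f \<i>) / 2"
  define d where "d = (f 1 + \<i> * f \<i>) / 2"
  have "complex_of_real (f z) = poly [:d, 0, c:] z / z ^ 1" if "z \<in> sphere 0 1" for z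
  proof -
    have z: "z * cnj z = 1" using that by (simp add: complex_norm_square[symmetric])
    have "z = Re z *\<^sub>R 1 + Im z *\<^sub>R \<i>" by (simp add: complex_eq_iff)
    then have "f z = Re z * f 1 + Im z * f \<i>" by (metis add scale real_scaleR_def)
    then have "complex_of_real (f z) = c * z + d * cnj z"
      by (simp add: c_def d_def complex_eq_iff field_simps)
    moreover have "z \<noteq> 0" using that by auto
    moreover from this have "cnj z = 1 / z" using z by (simp add: nonzero_eq_divide_eq mult.commute)
    ultimately show ?thesis by (simp add: field_simps power2_eq_square)
  qed
  then show ?case by blast
next
  case (const c)
  have "\<forall>z\<in>sphere (0::complex) 1. complex_of_real c = poly [:of_real c:] z / z ^ 0" by simp
  then show ?case by blast
next
  case (add f g)
  then obtain P N Q K where "\<forall>z\<in>sphere (0::complex) 1. complex_of_real (f z) = poly P z / z ^ N"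
    "\<forall>z\<in>sphere (0::complex) 1. complex_of_real (g z) = poly Q z / z ^ K" by blast
  then have "\<forall>z\<in>sphere (0::complex) 1. complex_of_real (f z + g z) =
      poly (P * monom 1 K + Q * monom 1 N) z / z ^ (N + K)"
    by (subgoal_tac "\<forall>z\<in>sphere (0::complex) 1. z \<noteq> 0") (auto simp: poly_monom field_simps power_add)
  then show ?case by blast
next
  case (mult f g)
  then obtain P N Q K where "\<forall>z\<in>sphere (0::complex) 1. complex_of_real (f z) = poly P z / z ^ N"
    "\<forall>z\<in>sphere (0::complex) 1. complex_of_real (g z) = poly Q z / z ^ K" by blast
  then have "\<forall>z\<in>sphere (0::complex) 1. complex_of_real (f z * g z) =
      poly (P * Q) z / z ^ (N + K)"
    by (auto simp: field_simps power_add)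
  then show ?case by blast
qed

text \<open>Conjugation leaves the real part alone and, on the circle, turns a negative power of
  \<open>z\<close> into a positive one.\<close>

lemma Re_laurent_monomial_on_circle:
  "\<exists>A. A holomorphic_on UNIV \<and> (\<forall>z\<in>sphere (0::complex) 1. Re (c * z ^ k / z ^ N) = Re (A z))"
proof (cases "N \<le> k")
  case True
  then have "Re (c * z ^ k / z ^ N) = Re (c * z ^ (k - N))" if "z \<in> sphere 0 1" for z
  proof -
    have "z \<noteq> 0" using that by auto
    then show ?thesis using True by (simp add: power_diff)
  qed
  then show ?thesis by (intro exI[of _ "\<lambda>z. c * z ^ (k - N)"]) (auto intro!: holomorphic_intros)
next
  case False
  have "Re (c * z ^ k / z ^ N) = Re (cnj c * z ^ (N - k))" if z: "z \<in> sphere 0 1" for z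
  proof -
    have "z \<noteq> 0" using z by auto
    then have "cnj z = 1 / z" using z complex_norm_square[of z] by (simp add: nonzero_eq_divide_eq mult.commute)
    then have "c * z ^ k / z ^ N = cnj (cnj c * z ^ (N - k))" using False \<open>z \<noteq> 0\<close>
      by (simp add: power_diff power_divide)
    then show ?thesis by (simp only: cnj.sel(1))
  qed
  then show ?thesis by (intro exI[of _ "\<lambda>z. cnj c * z ^ (N - k)"]) (auto intro!: holomorphic_intros)
qed

lemma Re_laurent_on_circle:
  "\<exists>A. A holomorphic_on UNIV \<and> (\<forall>z\<in>sphere (0::complex) 1. Re (poly P z / z ^ N) = Re (A z))"
proof -
  have "\<forall>k. \<exists>A. A holomorphic_on UNIV \<and> (\<forall>z\<in>sphere (0::complex) 1. Re (coeff P k * z ^ k / z ^ N) = Re (A z))"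
    using Re_laurent_monomial_on_circle by blast
  then obtain A where A: "\<And>k. A k holomorphic_on UNIV"
    "\<And>k z. z \<in> sphere (0::complex) 1 \<Longrightarrow> Re (coeff P k * z ^ k / z ^ N) = Re (A k z)"
    by metis
  have "Re (poly P z / z ^ N) = Re (\<Sum>k\<le>degree P. A k z)" if "z \<in> sphere 0 1" for z
    using A(2)[OF that] by (simp add: poly_altdef sum_divide_distrib)
  then show ?thesis
    by (intro exI[of _ "\<lambda>z. \<Sum>k\<le>degree P. A k z"]) (auto intro!: holomorphic_intros A(1))
qed

text \<open>Stands in for solving the Dirichlet problem: boundary data on the circle are matched, up
  to \<open>e\<close>, by the real part of a function for which the mean value property is
  known.\<close>

lemma Re_entire_approximation_on_circle:
  assumes "continuous_on (sphere (0::complex) 1) f" "e > (0::real)"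
  obtains A where "A holomorphic_on UNIV" "\<And>z. norm z = 1 \<Longrightarrow> \<bar>f z - Re (A z)\<bar> < e"
proof -
  obtain p where p: "real_polynomial_function p" "\<And>z. z \<in> sphere 0 1 \<Longrightarrow> \<bar>f z - p z\<bar> < e"
    using Stone_Weierstrass_real_polynomial_function[OF _ assms] by auto
  obtain P N where P: "\<And>z. z\<in>sphere (0::complex) 1 \<Longrightarrow> complex_of_real (p z) = poly P z / z ^ N"
    using real_polynomial_on_circle[OF p(1)] by blast
  obtain A where A: "A holomorphic_on UNIV" "\<And>z. z\<in>sphere (0::complex) 1 \<Longrightarrow> Re (poly P z / z ^ N) = Re (A z)"
    using Re_laurent_on_circle by blast
  have "p z = Re (A z)" if "z \<in> sphere 0 1" for z using P[OF that] A(2)[OF that] by (metis Re_complex_of_real)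
  with p that A(1) show ?thesis by auto
qed

section \<open>Mean value property, Cauchy formula and continuation across the zero set\<close>

context rado
begin

definition circle_mean :: "(complex \<Rightarrow> complex) \<Rightarrow> complex" where
  "circle_mean u = integral {0..1} (\<lambda>t. u (exp (2 * of_real pi * \<i> * of_real t)))"

text \<open>\<open>max_principle\<close> bounds moduli only; applied to the exponentials of
  \<open>u - A\<close> and of \<open>A - u\<close> it bounds \<open>Re (u - A)\<close> from both
  sides. Density of \<Omega> then carries the bound to the closed disc, zeros of \<open>h\<close>
  included.\<close>

lemma approx:
  assumes contu: "continuous_on (cball 0 1) u" and holu: "u holomorphic_on \<Omega>" and e: "e > 0"
  obtains A where "A holomorphic_on UNIV" "\<And>z. z \<in> cball 0 1 \<Longrightarrow> \<bar>Re (u z) - Re (A z)\<bar> \<le> e"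
proof -
  have "continuous_on (sphere 0 1) (\<lambda>z. Re (u z))"
    by (intro continuous_intros continuous_on_subset[OF contu]) auto
  then obtain A where A: "A holomorphic_on UNIV" "\<And>z. norm z = 1 \<Longrightarrow> \<bar>Re (u z) - Re (A z)\<bar> < e"
    using Re_entire_approximation_on_circle e by blast
  have cA: "continuous_on X A" for X
    using A(1) holomorphic_on_imp_continuous_on continuous_on_subset by blast
  have hA: "A holomorphic_on \<Omega>" using A(1) by (rule holomorphic_on_subset) simp
  have hex: "(\<lambda>z. exp (v z)) holomorphic_on \<Omega>" if "v holomorphic_on \<Omega>" for v
    using holomorphic_on_compose[OF that holomorphic_on_exp] by (simp add: o_def)
  have *: "\<bar>Re (u z) - Re (A z)\<bar> \<le> e" if z: "z \<in> \<Omega>" for z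
  proof -
    have "norm (exp (v z)) \<le> exp e" if v: "v = (\<lambda>z. u z - A z) \<or> v = (\<lambda>z. A z - u z)" for v
    proof (rule max_principle[OF _ _ _ _ z])
      show "continuous_on (closure \<Omega>) (\<lambda>z. exp (v z))" unfolding closure_eq using v
        by (elim disjE; simp only:; intro continuous_intros contu cA)
      show "(\<lambda>z. exp (v z)) holomorphic_on \<Omega>" using v
        by (elim disjE; simp only:; intro hex holomorphic_on_diff holu hA)
      show "0 < exp e" by simp
      show "norm (exp (v t)) \<le> exp e" if "norm t = 1" for t
        using A(2)[OF that] v by (auto simp: abs_less_iff)
    qed
    from this[of "\<lambda>z. u z - A z"] this[of "\<lambda>z. A z - u z"]
    have "norm (exp (u z - A z)) \<le> exp e" "norm (exp (A z - u z)) \<le> exp e" by simp_all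
    then show ?thesis by (simp add: abs_le_iff)
  qed
  have "\<bar>Re (u z) - Re (A z)\<bar> \<le> e" if z: "z \<in> cball 0 1" for z
  proof (rule continuous_le_on_closure[where S=\<Omega> and a=e and x=z and f="\<lambda>z. \<bar>Re (u z) - Re (A z)\<bar>"])
    show "continuous_on (closure \<Omega>) (\<lambda>z. \<bar>Re (u z) - Re (A z)\<bar>)"
      unfolding closure_eq by (intro continuous_intros contu cA)
  qed (use z closure_eq * in auto)
  with A that show ?thesis by blast
qed

lemma contour_integral_circle_mean:
  assumes "continuous_on (sphere 0 1) f"
  shows "(f has_contour_integral 2 * of_real pi * \<i> * circle_mean (\<lambda>z. z * f z)) (circlepath 0 1)"
proof -
  have "continuous_on {0..1} (\<lambda>t. exp (2 * of_real pi * \<i> * of_real t) * f (exp (2 * of_real pi * \<i> * of_real t)))"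
    by (intro continuous_intros continuous_on_compose2[OF assms]) auto
  then have "((\<lambda>t. exp (2 * of_real pi * \<i> * of_real t) * f (exp (2 * of_real pi * \<i> * of_real t)))
      has_integral circle_mean (\<lambda>z. z * f z)) {0..1}"
    unfolding circle_mean_def by (intro integrable_integral integrable_continuous_real)
  then have "((\<lambda>t. 2 * of_real pi * \<i> * (exp (2 * of_real pi * \<i> * of_real t) * f (exp (2 * of_real pi * \<i> * of_real t))))
      has_integral 2 * of_real pi * \<i> * circle_mean (\<lambda>z. z * f z)) {0..1}"
    by (rule has_integral_mult_right)
  then show ?thesis unfolding has_contour_integral
    by (rule has_integral_eq[rotated]) (simp_all only: vector_derivative_circlepath, simp add: circlepath)
qed

lemma circle_mean_entire:
  assumes A: "A holomorphic_on UNIV"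
  shows "circle_mean A = A 0"
proof -
  have cA: "continuous_on X A" for X
    using A holomorphic_on_imp_continuous_on continuous_on_subset by blast
  have "((\<lambda>u. A u / (u - 0)) has_contour_integral 2 * of_real pi * \<i> * A 0) (circlepath 0 1)"
    by (rule Cauchy_integral_circlepath_simple) (auto intro: holomorphic_on_subset[OF A])
  moreover have "((\<lambda>u. A u / (u - 0)) has_contour_integral
      2 * of_real pi * \<i> * circle_mean (\<lambda>z. z * (A z / (z - 0)))) (circlepath 0 1)"
    by (rule contour_integral_circle_mean) (auto intro!: continuous_intros cA)
  ultimately have "2 * of_real pi * \<i> * A 0 = 2 * of_real pi * \<i> * circle_mean (\<lambda>z. z * (A z / (z - 0)))"
    by (rule has_contour_integral_unique)
  then show ?thesis by (simp add: circle_mean_def)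
qed

lemma Re_circle_mean_bound:
  assumes "continuous_on (sphere 0 1) u" "\<And>z. norm z = 1 \<Longrightarrow> \<bar>Re (u z)\<bar> \<le> e"
  shows "\<bar>Re (circle_mean u)\<bar> \<le> e"
proof -
  let ?f = "\<lambda>t. u (exp (2 * of_real pi * \<i> * of_real t))"
  have c: "continuous_on {0..1} ?f"
    by (intro continuous_intros continuous_on_compose2[OF assms(1)]) auto
  have "integral {0..1} (Re \<circ> ?f) = Re (circle_mean u)"
    unfolding circle_mean_def
    by (rule integral_linear[OF integrable_continuous_real[OF c] bounded_linear_Re])
  moreover have "norm (integral {0..1} (Re \<circ> ?f)) \<le> e * (1 - 0)"
    by (rule integral_bound) (auto intro!: continuous_intros c assms(2) simp: o_def)
  ultimately show ?thesis by simp
qed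

lemma circle_mean_diff:
  assumes "continuous_on (sphere 0 1) u" "continuous_on (sphere 0 1) v"
  shows "circle_mean (\<lambda>z. u z - v z) = circle_mean u - circle_mean v"
  unfolding circle_mean_def
proof (intro integral_diff integrable_continuous_real)
  have c: "continuous_on {0..1::real} (\<lambda>t. exp (2 * of_real pi * \<i> * of_real t) :: complex)"
    by (intro continuous_intros)
  show "continuous_on {0..1} (\<lambda>t. u (exp (2 * of_real pi * \<i> * of_real t)))"
    by (rule continuous_on_compose2[OF assms(1) c]) auto
  show "continuous_on {0..1} (\<lambda>t. v (exp (2 * of_real pi * \<i> * of_real t)))"
    by (rule continuous_on_compose2[OF assms(2) c]) auto
qed

text \<open>Circle mean and central value agree for an entire approximant \<open>A\<close>, and each
  changes by at most \<open>e / 2\<close> when \<open>Re u\<close> replaces \<open>Re A\<close>. The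
  centre 0 may be a zero of \<open>h\<close>.\<close>

lemma Re_mean_value:
  assumes contu: "continuous_on (cball 0 1) u" and holu: "u holomorphic_on \<Omega>"
  shows "Re (circle_mean u) = Re (u 0)"
proof -
  have "\<bar>Re (circle_mean u) - Re (u 0)\<bar> \<le> e" if e: "e > 0" for e
  proof -
    obtain A where A: "A holomorphic_on UNIV" "\<And>z. z \<in> cball 0 1 \<Longrightarrow> \<bar>Re (u z) - Re (A z)\<bar> \<le> e/2"
      by (rule approx[OF contu holu, of "e/2"]) (use e in auto)
    have cA: "continuous_on X A" for X
      using A(1) holomorphic_on_imp_continuous_on continuous_on_subset by blast
    have cu: "continuous_on (sphere 0 1) u" using contu by (rule continuous_on_subset) auto
    have "\<bar>Re (circle_mean (\<lambda>z. u z - A z))\<bar> \<le> e/2"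
      using A(2) by (intro Re_circle_mean_bound continuous_intros cu cA) auto
    then have "\<bar>Re (circle_mean u) - Re (A 0)\<bar> \<le> e/2"
      using circle_mean_entire[OF A(1)] by (simp add: circle_mean_diff[OF cu cA])
    moreover have "\<bar>Re (u 0) - Re (A 0)\<bar> \<le> e/2" using A(2)[of 0] by simp
    ultimately show ?thesis by linarith
  qed
  then have "\<bar>Re (circle_mean u) - Re (u 0)\<bar> \<le> 0" by (rule field_le_epsilon) simp
  then show ?thesis by simp
qed

lemma mean_value:
  assumes contu: "continuous_on (cball 0 1) u" and holu: "u holomorphic_on \<Omega>"
  shows "circle_mean u = u 0"
proof (rule complex_eqI)
  show "Re (circle_mean u) = Re (u 0)" using Re_mean_value assms .
  \<comment> \<open>The real part of \<open>- \<i> * u\<close> is the imaginary part of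
    \<open>u\<close>.\<close>
  have "circle_mean (\<lambda>z. - \<i> * u z) = - \<i> * circle_mean u"
    unfolding circle_mean_def by (rule integral_mult_right)
  moreover have "Re (circle_mean (\<lambda>z. - \<i> * u z)) = Re (- \<i> * u 0)"
    by (rule Re_mean_value) (intro continuous_intros holomorphic_intros assms)+
  ultimately show "Im (circle_mean u) = Im (u 0)" by simp
qed

text \<open>The difference quotient \<open>q\<close> of \<open>u\<close> at \<open>c\<close> is
  again continuous on the closed disc and holomorphic on \<Omega>, so the mean value property
  applies to \<open>z * q z\<close>. This function vanishes at 0, and its circle mean is the contour
  integral of \<open>q\<close> up to the factor \<open>2 * pi * \<i>\<close>; hence that integral is
  0.\<close>

lemma Cauchy_formula:
  assumes contu: "continuous_on (cball 0 1) u" and holu: "u holomorphic_on \<Omega>" and c: "c \<in> \<Omega>"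
  shows "((\<lambda>z. u z / (z - c)) has_contour_integral 2 * of_real pi * \<i> * u c) (circlepath 0 1)"
proof -
  define q where "q z = (if z = c then deriv u c else (u z - u c) / (z - c))" for z
  have c1: "norm c < 1" using c by (simp add: Omega)
  have holq: "q holomorphic_on \<Omega>" unfolding q_def
    by (rule pole_lemma[OF holu]) (use c open_Omega in \<open>auto simp: interior_open\<close>)
  have U: "\<Omega> \<union> (cball 0 1 - {c}) = cball 0 1" using c by (auto simp: Omega)
  have "continuous_on (\<Omega> \<union> (cball 0 1 - {c})) q"
  proof (rule continuous_on_Un_local_open)
    show "openin (top_of_set (\<Omega> \<union> (cball 0 1 - {c}))) \<Omega>"
      unfolding U using U by (intro open_subset open_Omega) blast
    show "openin (top_of_set (\<Omega> \<union> (cball 0 1 - {c}))) (cball 0 1 - {c})"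
      unfolding U by (auto simp: openin_open intro!: exI[of _ "- {c}"])
    show "continuous_on \<Omega> q" using holq by (rule holomorphic_on_imp_continuous_on)
    have "continuous_on (cball 0 1 - {c}) (\<lambda>z. (u z - u c) / (z - c))"
      by (intro continuous_intros continuous_on_subset[OF contu]) auto
    then show "continuous_on (cball 0 1 - {c}) q"
      by (rule continuous_on_eq) (auto simp: q_def)
  qed
  then have contq: "continuous_on (cball 0 1) q" unfolding U .
  have "circle_mean (\<lambda>z. z * q z) = 0 * q 0"
    by (rule mean_value) (intro continuous_intros holomorphic_intros contq holq)+
  moreover have "(q has_contour_integral 2 * of_real pi * \<i> * circle_mean (\<lambda>z. z * q z)) (circlepath 0 1)"
    by (rule contour_integral_circle_mean) (rule continuous_on_subset[OF contq], auto)
  ultimately have "(q has_contour_integral 0) (circlepath 0 1)" by simp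
  moreover have "((\<lambda>z. u c / (z - c)) has_contour_integral 2 * of_real pi * \<i> * u c) (circlepath 0 1)"
    by (rule Cauchy_integral_circlepath_simple) (use c1 in \<open>auto intro!: holomorphic_intros\<close>)
  ultimately have "((\<lambda>z. q z + u c / (z - c)) has_contour_integral 0 + 2 * of_real pi * \<i> * u c) (circlepath 0 1)"
    by (rule has_contour_integral_add)
  then have "((\<lambda>z. q z + u c / (z - c)) has_contour_integral 2 * of_real pi * \<i> * u c) (circlepath 0 1)" by simp
  then show ?thesis
  proof (rule has_contour_integral_eq)
    fix z assume "z \<in> path_image (circlepath 0 1)"
    then have "z \<noteq> c" using c1 by auto
    then show "q z + u c / (z - c) = u z / (z - c)" by (simp add: q_def diff_divide_distrib)
  qed
qed

text \<open>The Cauchy integral \<open>G\<close> of the boundary values is holomorphic on the whole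
  disc and agrees with \<open>u\<close> on the dense set \<Omega>, hence everywhere by continuity.
  The zero set belongs to \<open>h\<close> while \<open>u\<close> is a second function;
  \<open>u = h\<close> is the classical case.\<close>

theorem rado:
  assumes contu: "continuous_on (cball 0 1) u" and holu: "u holomorphic_on \<Omega>"
  shows "u holomorphic_on ball 0 1"
proof -
  define G where "G c = contour_integral (circlepath 0 1) (\<lambda>z. u z / (z - c)) / (2 * of_real pi * \<i>)" for c
  have cu: "continuous_on (sphere 0 1) u" using contu by (rule continuous_on_subset) auto
  have int: "(\<lambda>z. u z / (z - w) ^ 1) contour_integrable_on circlepath 0 1" if "w \<in> ball 0 1" for w
    by (rule contour_integrable_continuous_circlepath) (use that in \<open>auto intro!: continuous_intros cu\<close>)
  have "\<exists>f'. ((\<lambda>w. contour_integral (circlepath 0 1) (\<lambda>z. u z / (z - w) ^ 1)) has_field_derivative f') (at c)"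
    if "c \<in> ball 0 1" for c
    using Cauchy_next_derivative_circlepath(2)[of 0 1 u 1 "\<lambda>w. contour_integral (circlepath 0 1) (\<lambda>z. u z / (z - w) ^ 1)" c]
      cu has_contour_integral_integral[OF int] that by auto
  then have "(\<lambda>w. contour_integral (circlepath 0 1) (\<lambda>z. u z / (z - w) ^ 1)) holomorphic_on ball 0 1"
    unfolding holomorphic_on_open[OF open_ball] by blast
  then have holG: "G holomorphic_on ball 0 1" unfolding G_def by (auto intro!: holomorphic_intros)
  have eq: "u c - G c = 0" if "c \<in> \<Omega>" for c
    using Cauchy_formula[OF contu holu that] by (simp add: G_def contour_integral_unique)
  have "u c = G c" if "c \<in> ball 0 1" for c
  proof -
    obtain x where x: "\<And>n. x n \<in> \<Omega>" "x \<longlonglongrightarrow> c"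
      using dense[THEN subsetD, OF \<open>c \<in> ball 0 1\<close>] unfolding closure_sequential by blast
    have "isCont u c" using that contu
      by (intro continuous_on_interior[of "cball 0 1"]) auto
    moreover have "isCont G c" using that holG
      by (intro continuous_on_interior[of "ball 0 1"] holomorphic_on_imp_continuous_on) auto
    ultimately have "(\<lambda>n. u (x n) - G (x n)) \<longlonglongrightarrow> u c - G c"
      by (intro tendsto_diff isCont_tendsto_compose[OF _ x(2)])
    then have "u c - G c = 0" using eq[OF x(1)] by (simp add: LIMSEQ_const_iff)
    then show ?thesis by simp
  qed
  with holG show ?thesis by (intro holomorphic_transform[OF holG]) simp
qed

end

section \<open>Holomorphic maps in several variables\<close>

lemma norm_smult: "norm (c *s v) = cmod c * norm (v :: complex ^ 'n)"
  by (simp add: norm_vec_def norm_mult L2_set_right_distrib)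

lemma scaleR_eq_smult: "r *\<^sub>R v = complex_of_real r *s (v :: complex ^ 'n)"
  by (simp add: vec_eq_iff) (simp add: scaleR_conv_of_real)

lemma bounded_linear_smult_left: "bounded_linear (\<lambda>t. t *s (v :: complex ^ 'n))"
  by (rule bounded_linear_intro[where K = "norm v"])
    (simp_all add: norm_smult vector_sadd_rdistrib scaleR_eq_smult scaleR_conv_of_real vec_eq_iff algebra_simps)

lemma continuous_on_smult [continuous_intros]:
  fixes v :: "complex ^ 'n"
  assumes "continuous_on S f"
  shows "continuous_on S (\<lambda>x. f x *s v)"
  using bounded_linear.continuous_on[OF bounded_linear_smult_left assms] .

section \<open>Taylor bounds on complex lines and Osgood's lemma\<close>

lemma taylor_bound:
  assumes hol: "\<phi> holomorphic_on ball 0 1" and M: "\<And>t. t \<in> ball 0 1 \<Longrightarrow> cmod (\<phi> t) \<le> M"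
    and t: "cmod t < 1/2"
  shows "cmod (\<phi> t - \<phi> 0 - deriv \<phi> 0 * t) \<le> 32 * M * cmod t ^ 2"
    and "cmod (\<phi> t - \<phi> 0) \<le> 20 * M * cmod t"
proof -
  have M0: "0 \<le> M" using M[of 0] norm_ge_zero[of "\<phi> 0"] by (simp del: norm_ge_zero)
  \<comment> \<open>Circles of radius 1/4 about points of \<open>ball 0 (1/2)\<close> stay in the
    unit disc. This gives \<open>2 * 16 * M = 32 * M\<close> for the second derivative and
    \<open>4 * M\<close> for the first; with \<open>cmod t < 1/2\<close> the linear bound becomes
    \<open>(16 + 4) * M\<close>.\<close>
  have cau: "cmod ((deriv ^^ n) \<phi> x) \<le> fact n * M / (1/4) ^ n" if x: "x \<in> ball 0 (1/2)" for x n
  proof (rule Cauchy_inequality)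
    have sub: "cball x (1/4) \<subseteq> ball 0 1"
    proof
      fix y assume "y \<in> cball x (1/4)"
      then show "y \<in> ball 0 1" using x norm_triangle_ineq[of x "y - x"] by (simp add: dist_norm norm_minus_commute)
    qed
    then show "\<phi> holomorphic_on ball x (1/4)"
      using hol holomorphic_on_subset ball_subset_cball by (metis subset_trans)
    show "continuous_on (cball x (1/4)) \<phi>"
      using holomorphic_on_imp_continuous_on[OF holomorphic_on_subset[OF hol sub]] .
    show "cmod (\<phi> y) \<le> M" if "cmod (x - y) = 1/4" for y
      using subsetD[OF sub, of y] that by (intro M) (simp add: dist_norm)
  qed simp
  have "cmod ((deriv ^^ 0) \<phi> t - (\<Sum>i\<le>1. (deriv ^^ i) \<phi> 0 * (t - 0) ^ i / fact i))
      \<le> (32 * M) * cmod (t - 0) ^ Suc 1 / fact 1"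
  proof (rule complex_Taylor[where S = "ball 0 (1/2)"])
    show "((deriv ^^ i) \<phi> has_field_derivative (deriv ^^ Suc i) \<phi> x) (at x within ball 0 (1/2))"
      if "x \<in> ball 0 (1/2)" for i x
    proof -
      have "(deriv ^^ i) \<phi> holomorphic_on ball 0 1" by (intro holomorphic_higher_deriv hol) auto
      moreover have "x \<in> ball 0 1" using that by simp
      ultimately show ?thesis
        using holomorphic_derivI[OF _ open_ball] has_field_derivative_at_within by fastforce
    qed
    show "cmod ((deriv ^^ Suc 1) \<phi> x) \<le> 32 * M" if "x \<in> ball 0 (1/2)" for x
      using cau[OF that, of 2] by (simp add: numeral_2_eq_2)
  qed (use t in auto)
  then show *: "cmod (\<phi> t - \<phi> 0 - deriv \<phi> 0 * t) \<le> 32 * M * cmod t ^ 2"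
    by (simp add: power2_eq_square mult.assoc diff_diff_eq)
  have "cmod (deriv \<phi> 0) \<le> 4 * M" using cau[of 0 1] by simp
  then have "cmod (deriv \<phi> 0 * t) \<le> 4 * M * cmod t" by (simp add: norm_mult mult_right_mono)
  moreover have "32 * M * cmod t ^ 2 \<le> 16 * M * cmod t"
    using t M0 mult_mono[of "cmod t" "1/2" "32 * M * cmod t" "32 * M * cmod t"]
    by (simp add: power2_eq_square mult_ac)
  moreover have "cmod (\<phi> t - \<phi> 0) \<le> cmod (\<phi> t - \<phi> 0 - deriv \<phi> 0 * t) + cmod (deriv \<phi> 0 * t)"
    using norm_triangle_ineq[of "\<phi> t - \<phi> 0 - deriv \<phi> 0 * t" "deriv \<phi> 0 * t"] by simp
  ultimately show "cmod (\<phi> t - \<phi> 0) \<le> 20 * M * cmod t" using * by linarith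
qed

text \<open>Osgood's form of holomorphy: continuity, and one-variable holomorphy on small discs in
  all complex directions. In this form locally uniform limits and Rado's theorem become one-variable
  matters.\<close>

definition slice_hol :: "(complex ^ 'n \<Rightarrow> complex) \<Rightarrow> (complex ^ 'n) set \<Rightarrow> bool" where
  "slice_hol u S \<longleftrightarrow> continuous_on S u \<and>
     (\<forall>w\<in>S. \<exists>r>0. \<forall>v. norm v < r \<longrightarrow> (\<lambda>t. u (w + t *s v)) holomorphic_on ball 0 1)"

definition dir_deriv :: "(complex ^ 'n \<Rightarrow> complex) \<Rightarrow> complex ^ 'n \<Rightarrow> complex ^ 'n \<Rightarrow> complex" where
  "dir_deriv u w v = deriv (\<lambda>t. u (w + t *s v)) 0"

lemma slice_hol_differentiable:
  assumes u: "slice_hol u S" and w: "w \<in> S"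
  shows "\<exists>D. ((\<lambda>t. u (w + t *s v)) has_field_derivative D) (at 0)"
proof -
  obtain r where r: "r > 0" "\<And>v. norm v < r \<Longrightarrow> (\<lambda>t. u (w + t *s v)) holomorphic_on ball 0 1"
    using u w unfolding slice_hol_def by blast
  \<comment> \<open>\<open>k\<close> shortens \<open>v\<close> below the radius \<open>r\<close>;
    the summand 1 covers \<open>v = 0\<close>.\<close>
  define k where "k = r / (norm v + 1)"
  have k: "k > 0" using r by (auto simp: k_def intro!: divide_pos_pos add_nonneg_pos)
  have "norm v + 1 > 0" by (simp add: add_nonneg_pos)
  then have "k * (norm v + 1) = r" by (simp add: k_def)
  then have "k * norm v < r" using k by (simp add: algebra_simps)
  then have "norm (of_real k *s v) < r"
    unfolding norm_smult norm_of_real using k by simp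
  from r(2)[OF this] have "(\<lambda>t. u (w + t *s (of_real k *s v))) holomorphic_on ball 0 1" .
  then obtain D where "((\<lambda>t. u (w + t *s (of_real k *s v))) has_field_derivative D) (at (0 / of_real k))"
    unfolding holomorphic_on_open[OF open_ball] by (metis centre_in_ball div_0 zero_less_one)
  moreover have "((\<lambda>t. t / of_real k) has_field_derivative 1 / of_real k) (at 0)"
    using k by (auto intro!: derivative_eq_intros)
  ultimately have "((\<lambda>t. u (w + t *s (of_real k *s v))) \<circ> (\<lambda>t. t / of_real k) has_field_derivative D * (1 / of_real k)) (at 0)"
    by (rule DERIV_chain)
  moreover have "(\<lambda>t. u (w + t *s (of_real k *s v))) \<circ> (\<lambda>t. t / of_real k) = (\<lambda>t. u (w + t *s v))"
    using k by (auto simp: fun_eq_iff)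
  ultimately show ?thesis by auto
qed

lemma dir_deriv:
  assumes "slice_hol u S" "w \<in> S"
  shows "((\<lambda>t. u (w + t *s v)) has_field_derivative dir_deriv u w v) (at 0)"
  using slice_hol_differentiable[OF assms, of v] DERIV_imp_deriv unfolding dir_deriv_def by blast

lemma dir_deriv_smult:
  assumes "slice_hol u S" "w \<in> S"
  shows "dir_deriv u w (c *s v) = c * dir_deriv u w v"
proof -
  have "((\<lambda>t. u (w + t *s v)) has_field_derivative dir_deriv u w v) (at (0 * c))"
    using dir_deriv[OF assms] by simp
  moreover have "((\<lambda>t. t * c) has_field_derivative c) (at 0)" by (auto intro!: derivative_eq_intros)
  ultimately have "((\<lambda>t. u (w + t *s v)) \<circ> (\<lambda>t. t * c) has_field_derivative dir_deriv u w v * c) (at 0)"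
    by (rule DERIV_chain)
  moreover have "(\<lambda>t. u (w + t *s v)) \<circ> (\<lambda>t. t * c) = (\<lambda>t. u (w + t *s (c *s v)))"
    by (auto simp: fun_eq_iff)
  ultimately show ?thesis unfolding dir_deriv_def by (simp add: DERIV_imp_deriv mult.commute)
qed

text \<open>\<open>slice_hol\<close> speaks only of small discs about the base point; re-centring at
  each point of the line gives holomorphy over any open set of parameters whose points stay in
  \<open>S\<close>.\<close>

lemma slice_hol_line:
  assumes u: "slice_hol u S" and A: "open A" and S: "\<And>t. t \<in> A \<Longrightarrow> w + t *s v \<in> S"
  shows "(\<lambda>t. u (w + t *s v)) holomorphic_on A"
  unfolding holomorphic_on_open[OF A]
proof
  fix t assume t: "t \<in> A"
  from slice_hol_differentiable[OF u S[OF t], of v] obtain D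
    where "((\<lambda>s. u (w + t *s v + s *s v)) has_field_derivative D) (at (t - t))" by auto
  moreover have "((\<lambda>s. s - t) has_field_derivative 1) (at t)" by (auto intro!: derivative_eq_intros)
  ultimately have "((\<lambda>s. u (w + t *s v + s *s v)) \<circ> (\<lambda>s. s - t) has_field_derivative D * 1) (at t)"
    by (rule DERIV_chain)
  moreover have "(\<lambda>s. u (w + t *s v + s *s v)) \<circ> (\<lambda>s. s - t) = (\<lambda>s. u (w + s *s v))"
    by (auto simp: fun_eq_iff vector_sub_rdistrib algebra_simps)
  ultimately show "\<exists>D. ((\<lambda>s. u (w + s *s v)) has_field_derivative D) (at t)" by auto
qed

lemma slice_taylor:
  assumes u: "slice_hol u S" and r: "r > 0" "ball w r \<subseteq> S"
    and M: "\<And>x. x \<in> ball w r \<Longrightarrow> cmod (u x) \<le> M" and v: "norm v < r / 4"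
  shows "cmod (u (w + v) - u w - dir_deriv u w v) \<le> 128 * M / r^2 * norm v ^ 2"
    and "cmod (u (w + v) - u w) \<le> 40 * M / r * norm v"
proof -
  have wS: "w \<in> S" using r by auto
  have *: "cmod (u (w + v) - u w - dir_deriv u w v) \<le> 128 * M / r^2 * norm v ^ 2 \<and>
     cmod (u (w + v) - u w) \<le> 40 * M / r * norm v"
  proof (cases "v = 0")
    case True
    then show ?thesis using dir_deriv_smult[OF u wS, of 0 v] by simp
  next
    case False
    \<comment> \<open>\<open>v\<close> is rescaled to a vector \<open>v0\<close> of norm
      \<open>r / 2\<close>, so that its unit disc stays in \<open>ball w r\<close>. With this
      \<open>t\<close> the constants 32 and 20 of \<open>taylor_bound\<close> turn into
      \<open>128 / r^2\<close> and \<open>40 / r\<close>.\<close>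
    define t where "t = 2 * norm v / r"
    define v0 where "v0 = of_real (1 / t) *s v"
    have t0: "t > 0" using False r by (simp add: t_def)
    have nv0: "norm v0 = r / 2"
      unfolding v0_def norm_smult norm_of_real using t0 False r by (simp add: t_def)
    have v: "v = of_real t *s v0" using t0 by (simp add: v0_def)
    have tl: "cmod (of_real t) < 1/2"
      unfolding norm_of_real using assms(5) r t0 by (simp add: t_def field_simps)
    define \<phi> where "\<phi> s = u (w + s *s v0)" for s
    have inb: "w + s *s v0 \<in> ball w r" if "s \<in> ball 0 1" for s
    proof -
      have "cmod s * (r / 2) < 1 * r" by (rule mult_less_le_imp_less) (use that r in auto)
      then show ?thesis by (simp add: dist_norm norm_smult nv0)
    qed
    have hol: "\<phi> holomorphic_on ball 0 1" unfolding \<phi>_def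
      by (rule slice_hol_line[OF u open_ball]) (use inb r(2) in blast)
    have bd: "cmod (\<phi> s) \<le> M" if "s \<in> ball 0 1" for s unfolding \<phi>_def using M inb that by blast
    have d: "deriv \<phi> 0 * of_real t = dir_deriv u w v"
      unfolding \<phi>_def v dir_deriv_smult[OF u wS] by (simp add: dir_deriv_def)
    have "cmod (\<phi> (of_real t) - \<phi> 0 - deriv \<phi> 0 * of_real t) \<le> 32 * M * cmod (of_real t) ^ 2"
      "cmod (\<phi> (of_real t) - \<phi> 0) \<le> 20 * M * cmod (of_real t)"
      using taylor_bound[OF hol bd tl] by simp_all
    then show ?thesis unfolding d using t0 r
      by (simp add: \<phi>_def v[symmetric]) (simp add: t_def power_divide power_mult_distrib)
  qed
  then show "cmod (u (w + v) - u w - dir_deriv u w v) \<le> 128 * M / r^2 * norm v ^ 2"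
    and "cmod (u (w + v) - u w) \<le> 40 * M / r * norm v" by blast+
qed

lemma slice_hol_locally_bounded:
  assumes u: "slice_hol u S" and S: "open S" "z \<in> S"
  obtains r M where "r > 0" "ball z (2 * r) \<subseteq> S" "M > 0" "\<And>x. x \<in> ball z (2 * r) \<Longrightarrow> cmod (u x) \<le> M"
proof -
  obtain e where e: "e > 0" "cball z e \<subseteq> S" using S open_contains_cball by blast
  have "bounded (u ` cball z e)" using u e unfolding slice_hol_def
    by (intro compact_imp_bounded compact_continuous_image) (auto intro: continuous_on_subset)
  then obtain M where "M > 0" "\<And>x. x \<in> cball z e \<Longrightarrow> cmod (u x) \<le> M" unfolding bounded_pos by auto
  then show ?thesis using e by (intro that[of "e/2" M]) (use ball_subset_cball[of z e] in auto)
qed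

text \<open>After division by the step, the remainder in \<open>slice_taylor\<close> is
  \<open>128 * M / r^2 * norm v ^ 2\<close> times the step. The constants do not depend on
  \<open>w\<close>, because balls of radius \<open>r\<close> about points of \<open>ball z r\<close>
  stay in \<open>ball z (2 * r)\<close>.\<close>

lemma dir_deriv_uniform_limit:
  assumes u: "slice_hol u S" and r: "r > 0" "ball z (2 * r) \<subseteq> S"
    and M: "M > 0" "\<And>x. x \<in> ball z (2 * r) \<Longrightarrow> cmod (u x) \<le> M"
  shows "uniform_limit (ball z r) (\<lambda>n w. (u (w + of_real (1 / real (Suc n)) *s v) - u w) * of_nat (Suc n))
     (\<lambda>w. dir_deriv u w v) sequentially"
proof (rule uniform_limitI)
  fix e :: real assume e: "e > 0"
  have lim: "(\<lambda>n. C * (1 / real (Suc n))) \<longlonglongrightarrow> 0" for C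
    using tendsto_mult_left[OF LIMSEQ_inverse_real_of_nat, of C] by (simp add: divide_inverse)
  have "\<forall>\<^sub>F n in sequentially. norm v * (1 / real (Suc n)) < r / 4"
    by (rule order_tendstoD(2)[OF lim]) (use r in simp)
  moreover have "\<forall>\<^sub>F n in sequentially. (128 * M / r^2 * norm v ^ 2) * (1 / real (Suc n)) < e"
    by (rule order_tendstoD(2)[OF lim e])
  ultimately show "\<forall>\<^sub>F n in sequentially. \<forall>w\<in>ball z r.
      dist ((u (w + of_real (1 / real (Suc n)) *s v) - u w) * of_nat (Suc n)) (dir_deriv u w v) < e"
  proof eventually_elim
    case (elim n)
    show ?case
    proof
      fix w assume w: "w \<in> ball z r"
      define s where "s = 1 / real (Suc n)"
      have s: "s > 0" by (simp add: s_def)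
      have sub: "ball w r \<subseteq> ball z (2 * r)"
      proof
        fix y assume "y \<in> ball w r"
        then show "y \<in> ball z (2 * r)" using w dist_triangle[of z y w] by simp
      qed
      have wS: "w \<in> S" using w r sub by (meson centre_in_ball subsetD)
      have "cmod (u (w + of_real s *s v) - u w - dir_deriv u w (of_real s *s v)) \<le> 128 * M / r^2 * norm (of_real s *s v) ^ 2"
      proof (rule slice_taylor(1)[OF u r(1)])
        show "norm (of_real s *s v) < r / 4"
          unfolding norm_smult norm_of_real using elim(1) s by (simp add: s_def)
      qed (use sub r M in auto)
      then have *: "cmod (u (w + of_real s *s v) - u w - of_real s * dir_deriv u w v) \<le> (128 * M / r^2 * norm v ^ 2 * s) * s"
        using s by (simp add: dir_deriv_smult[OF u wS] norm_smult power2_eq_square mult_ac)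
      have "dist ((u (w + of_real s *s v) - u w) * of_nat (Suc n)) (dir_deriv u w v)
          = cmod ((u (w + of_real s *s v) - u w - of_real s * dir_deriv u w v) / of_real s)"
        unfolding dist_norm by (rule arg_cong[of _ _ cmod]) (simp add: s_def diff_divide_distrib algebra_simps del: of_nat_Suc)
      also have "\<dots> \<le> 128 * M / r^2 * norm v ^ 2 * s" using * s by (simp add: norm_divide pos_divide_le_eq)
      also have "\<dots> < e" using elim(2) by (simp add: s_def)
      finally show "dist ((u (w + of_real (1 / real (Suc n)) *s v) - u w) * of_nat (Suc n)) (dir_deriv u w v) < e"
        by (simp add: s_def)
    qed
  qed
qed

lemma eventually_translate_in_ball:
  fixes v :: "complex ^ 'n"
  assumes "r > 0"
  shows "\<forall>\<^sub>F n in sequentially. \<forall>w\<in>ball z r. w + of_real (1 / real (Suc n)) *s v \<in> ball z (2 * r)"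
proof -
  have "(\<lambda>n. norm v * (1 / real (Suc n))) \<longlonglongrightarrow> 0"
    using tendsto_mult_left[OF LIMSEQ_inverse_real_of_nat, of "norm v"] by (simp add: divide_inverse)
  then have "\<forall>\<^sub>F n in sequentially. norm v * (1 / real (Suc n)) < r"
    by (rule order_tendstoD(2)) (use assms in simp)
  then show ?thesis
  proof eventually_elim
    case (elim n)
    show ?case
    proof
      fix w assume "w \<in> ball z r"
      then show "w + of_real (1 / real (Suc n)) *s v \<in> ball z (2 * r)"
        using elim norm_triangle_ineq4[of "z - w" "of_real (1 / real (Suc n)) *s v"]
        by (simp add: dist_norm norm_smult diff_diff_eq norm_divide del: of_nat_Suc)
    qed
  qed
qed

text \<open>Difference quotients of \<open>u\<close> are holomorphic along lines and converge
  locally uniformly, so their limit inherits both continuity and holomorphy along lines.\<close>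

lemma slice_hol_dir_deriv:
  assumes u: "slice_hol u S" and S: "open S"
  shows "slice_hol (\<lambda>w. dir_deriv u w v) S"
proof -
  let ?q = "\<lambda>n w. (u (w + of_real (1 / real (Suc n)) *s v) - u w) * of_nat (Suc n)"
  have cu: "continuous_on S u" using u by (simp add: slice_hol_def)
  have cont: "\<exists>r>0. continuous_on (ball z r) (\<lambda>w. dir_deriv u w v) \<and>
     (\<forall>y. norm y < r \<longrightarrow> (\<lambda>t. dir_deriv u (z + t *s y) v) holomorphic_on ball 0 1)" if z: "z \<in> S" for z
  proof -
    obtain r M where r: "r > 0" "ball z (2 * r) \<subseteq> S" "M > 0" "\<And>x. x \<in> ball z (2 * r) \<Longrightarrow> cmod (u x) \<le> M"
      using slice_hol_locally_bounded[OF u S z] by blast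
    have sub: "ball z r \<subseteq> S" using r(1,2) by force
    have lim: "uniform_limit (ball z r) ?q (\<lambda>w. dir_deriv u w v) sequentially"
      by (rule dir_deriv_uniform_limit[OF u r])
    have "continuous_on (ball z r) (\<lambda>w. dir_deriv u w v)"
    proof (rule uniform_limit_theorem[OF _ lim])
      show "\<forall>\<^sub>F n in sequentially. continuous_on (ball z r) (?q n)"
        using eventually_translate_in_ball[OF r(1), of z v]
        by eventually_elim (use r(2) sub in \<open>auto intro!: continuous_intros continuous_on_compose2[OF cu]
            continuous_on_subset[OF cu]\<close>)
    qed simp
    moreover
    define P where "P n \<longleftrightarrow> (\<forall>w\<in>ball z r. w + of_real (1 / real (Suc n)) *s v \<in> ball z (2 * r))" for n
    have evP: "\<forall>\<^sub>F n in sequentially. P n" unfolding P_def by (rule eventually_translate_in_ball[OF r(1)])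
    have "(\<lambda>t. dir_deriv u (z + t *s y) v) holomorphic_on ball 0 1" if y: "norm y < r" for y
    \<comment> \<open>The quotient with index \<open>n\<close> is known to stay inside
      \<open>S\<close> only when \<open>P n\<close> holds. The value 0 otherwise makes every member
      of the sequence holomorphic, as the convergence theorem demands.\<close>
    proof (rule holomorphic_uniform_sequence[OF open_ball, where f = "\<lambda>n t. if P n then ?q n (z + t *s y) else 0"])
      have inb: "z + t *s y \<in> ball z r" if "t \<in> ball 0 1" for t
        using y that mult_strict_mono[of "cmod t" 1 "norm y" r]  mult_less_le_imp_less[of "cmod t" 1 "norm y" r]
        by (cases "y = 0") (auto simp: dist_norm norm_smult)
      have *: "?q n (z + t *s y) = (u (z + of_real (1 / real (Suc n)) *s v + t *s y) - u (z + t *s y)) * of_nat (Suc n)" for n t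
        by (simp add: algebra_simps)
      show "(\<lambda>t. if P n then ?q n (z + t *s y) else 0) holomorphic_on ball 0 1" for n
      proof (cases "P n")
        case True
        have "(\<lambda>t. (u (z + of_real (1 / real (Suc n)) *s v + t *s y) - u (z + t *s y)) * of_nat (Suc n)) holomorphic_on ball 0 1"
        proof (intro holomorphic_intros slice_hol_line[OF u open_ball])
          fix t :: complex assume t: "t \<in> ball 0 1"
          from True inb[OF t] have "z + t *s y + of_real (1 / real (Suc n)) *s v \<in> ball z (2 * r)"
            unfolding P_def by blast
          moreover have "z + t *s y + of_real (1 / real (Suc n)) *s v = z + of_real (1 / real (Suc n)) *s v + t *s y"
            by (simp add: algebra_simps)
          ultimately show "z + of_real (1 / real (Suc n)) *s v + t *s y \<in> S"
            using r(2) by (metis subsetD)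
          show "z + t *s y \<in> S" using inb[OF t] sub by blast
        qed
        then show ?thesis unfolding if_P[OF True] by (simp only: *)
      next
        case False
        show ?thesis unfolding if_not_P[OF False] by simp
      qed
      fix t :: complex assume t: "t \<in> ball 0 1"
      then obtain d where d: "d > 0" "cball t d \<subseteq> ball 0 1" using open_contains_cball by blast
      have "uniform_limit (cball t d) (\<lambda>n t. if P n then ?q n (z + t *s y) else 0)
          (\<lambda>t. dir_deriv u (z + t *s y) v) sequentially"
      proof (rule uniform_limitI)
        fix e :: real assume "e > 0"
        with lim have "\<forall>\<^sub>F n in sequentially. \<forall>w\<in>ball z r. dist (?q n w) (dir_deriv u w v) < e"
          by (simp add: uniform_limit_iff)
        with evP show "\<forall>\<^sub>F n in sequentially. \<forall>t\<in>cball t d.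
            dist (if P n then ?q n (z + t *s y) else 0) (dir_deriv u (z + t *s y) v) < e"
        proof eventually_elim
          case (elim n)
          show ?case unfolding if_P[OF elim(1)] using elim(2) inb d(2) by blast
        qed
      qed
      then show "\<exists>d>0. cball t d \<subseteq> ball 0 1 \<and> uniform_limit (cball t d) (\<lambda>n t. if P n then ?q n (z + t *s y) else 0)
          (\<lambda>t. dir_deriv u (z + t *s y) v) sequentially" using d by blast
    qed
    ultimately show ?thesis using r(1) by blast
  qed
  have "continuous_on S (\<lambda>w. dir_deriv u w v)"
    unfolding continuous_on_eq_continuous_at[OF S]
  proof
    fix z assume "z \<in> S"
    from cont[OF this] obtain r where "r > 0" "continuous_on (ball z r) (\<lambda>w. dir_deriv u w v)" by blast
    then show "isCont (\<lambda>w. dir_deriv u w v) z"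
      using continuous_on_eq_continuous_at[OF open_ball] centre_in_ball by blast
  qed
  then show ?thesis unfolding slice_hol_def using cont by blast
qed

lemma dir_deriv_LIMSEQ:
  assumes u: "slice_hol u S" and w: "w \<in> S"
  shows "(\<lambda>n. (u (w + of_real (1 / real (Suc n)) *s v) - u w) * of_nat (Suc n)) \<longlonglongrightarrow> dir_deriv u w v"
proof -
  have "((\<lambda>h. (u (w + h *s v) - u w) / h) \<longlongrightarrow> dir_deriv u w v) (at 0)"
    using dir_deriv[OF assms, of v] by (simp add: DERIV_def)
  moreover have "filterlim (\<lambda>n. complex_of_real (1 / real (Suc n))) (at 0) sequentially"
  proof -
    have "(\<lambda>n. complex_of_real (1 / real (Suc n))) \<longlonglongrightarrow> of_real 0"
      using LIMSEQ_inverse_real_of_nat by (intro tendsto_of_real) (simp add: divide_inverse)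
    then show ?thesis
      by (intro filterlim_atI) (simp_all del: of_nat_Suc of_real_divide)
  qed
  ultimately have "(\<lambda>n. (u (w + complex_of_real (1 / real (Suc n)) *s v) - u w) / complex_of_real (1 / real (Suc n))) \<longlonglongrightarrow> dir_deriv u w v"
    by (rule filterlim_compose)
  then show ?thesis by (simp add: divide_inverse)
qed

text \<open>Additivity: compare the increment along \<open>v + v'\<close> with the increments along \<open>v\<close> at \<open>w\<close> and
  along \<open>v'\<close> at the moving base point \<open>w + s v\<close>, where the error is uniform.\<close>

lemma dir_deriv_add:
  assumes u: "slice_hol u S" and S: "open S" and w: "w \<in> S"
  shows "dir_deriv u w (v + v') = dir_deriv u w v + dir_deriv u w v'"
proof -
  let ?s = "\<lambda>n. complex_of_real (1 / real (Suc n))"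
  let ?q = "\<lambda>v n w. (u (w + ?s n *s v) - u w) * of_nat (Suc n)"
  obtain r M where r: "r > 0" "ball w (2 * r) \<subseteq> S" "M > 0" "\<And>x. x \<in> ball w (2 * r) \<Longrightarrow> cmod (u x) \<le> M"
    using slice_hol_locally_bounded[OF u S w] by blast
  have lim: "uniform_limit (ball w r) (?q v') (\<lambda>w. dir_deriv u w v') sequentially"
    by (rule dir_deriv_uniform_limit[OF u r])
  have "?s \<longlonglongrightarrow> of_real 0"
    using LIMSEQ_inverse_real_of_nat by (intro tendsto_of_real) (simp add: divide_inverse)
  then have "(\<lambda>n. w + ?s n *s v) \<longlonglongrightarrow> w + of_real 0 *s v"
    by (rule tendsto_add[OF tendsto_const bounded_linear.tendsto[OF bounded_linear_smult_left]])
  then have sv: "(\<lambda>n. w + ?s n *s v) \<longlonglongrightarrow> w" by simp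
  have "(\<lambda>n. ?q v' n (w + ?s n *s v) - dir_deriv u (w + ?s n *s v) v') \<longlonglongrightarrow> 0"
  proof (rule tendstoI)
    fix e :: real assume "e > 0"
    with lim have "\<forall>\<^sub>F n in sequentially. \<forall>w\<in>ball w r. dist (?q v' n w) (dir_deriv u w v') < e"
      by (simp add: uniform_limit_iff)
    moreover have "\<forall>\<^sub>F n in sequentially. w + ?s n *s v \<in> ball w r"
      by (rule topological_tendstoD[OF sv]) (use r in auto)
    ultimately show "\<forall>\<^sub>F n in sequentially. dist (?q v' n (w + ?s n *s v) - dir_deriv u (w + ?s n *s v) v') 0 < e"
    proof eventually_elim
      case (elim n)
      then have "dist (?q v' n (w + ?s n *s v)) (dir_deriv u (w + ?s n *s v) v') < e" by blast
      then show ?case by (simp only: dist_norm diff_zero)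
    qed
  qed
  moreover have "(\<lambda>n. dir_deriv u (w + ?s n *s v) v') \<longlonglongrightarrow> dir_deriv u w v'"
  proof -
    have "continuous_on S (\<lambda>w. dir_deriv u w v')" using slice_hol_dir_deriv[OF u S] by (simp add: slice_hol_def)
    then have "isCont (\<lambda>w. dir_deriv u w v') w" using S w continuous_on_eq_continuous_at by blast
    then show ?thesis using sv by (rule isCont_tendsto_compose)
  qed
  ultimately have "(\<lambda>n. (?q v' n (w + ?s n *s v) - dir_deriv u (w + ?s n *s v) v') + dir_deriv u (w + ?s n *s v) v' + ?q v n w)
      \<longlonglongrightarrow> 0 + dir_deriv u w v' + dir_deriv u w v"
    by (intro tendsto_add dir_deriv_LIMSEQ[OF u w])
  moreover have "(\<lambda>n. (?q v' n (w + ?s n *s v) - dir_deriv u (w + ?s n *s v) v') + dir_deriv u (w + ?s n *s v) v' + ?q v n w)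
      = (\<lambda>n. ?q (v + v') n w)"
    by (rule ext) (simp add: vector_add_ldistrib algebra_simps del: of_nat_Suc)
  ultimately have "(\<lambda>n. ?q (v + v') n w) \<longlonglongrightarrow> dir_deriv u w v' + dir_deriv u w v" by simp
  from LIMSEQ_unique[OF this dir_deriv_LIMSEQ[OF u w]] show ?thesis by (simp only: add.commute)
qed

text \<open>The remainder in \<open>slice_taylor\<close> is quadratic uniformly over all directions;
  together with additivity this upgrades directional derivatives to a Frechet derivative.\<close>

lemma slice_hol_has_derivative:
  assumes u: "slice_hol u S" and S: "open S" and w: "w \<in> S"
  shows "(u has_derivative dir_deriv u w) (at w)"
  unfolding has_derivative_at
proof
  have "linear (dir_deriv u w)"
    by (rule linearI) (simp_all add: dir_deriv_add[OF assms] dir_deriv_smult[OF u w] scaleR_eq_smult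
        scaleR_conv_of_real)
  then show "bounded_linear (dir_deriv u w)" by (simp add: linear_conv_bounded_linear)
  obtain r M where r: "r > 0" "ball w (2 * r) \<subseteq> S" "M > 0" "\<And>x. x \<in> ball w (2 * r) \<Longrightarrow> cmod (u x) \<le> M"
    using slice_hol_locally_bounded[OF u S w] by blast
  show "(\<lambda>h. norm (u (w + h) - u w - dir_deriv u w h) / norm h) \<midarrow>0\<rightarrow> 0"
  proof (rule Lim_null_comparison)
    show "((\<lambda>h. 128 * M / r\<^sup>2 * norm h) \<longlongrightarrow> 0) (at 0)"
      by (intro tendsto_eq_intros) auto
    have "\<forall>\<^sub>F h in at (0 :: complex ^ 'a). h \<in> ball 0 (r/4)"
      by (rule eventually_at_topological[THEN iffD2]) (use r in \<open>intro exI[of _ "ball 0 (r/4)"], auto\<close>)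
    then show "\<forall>\<^sub>F h in at 0. norm (norm (u (w + h) - u w - dir_deriv u w h) / norm h) \<le> 128 * M / r\<^sup>2 * norm h"
    proof eventually_elim
      case (elim h)
      have "ball w r \<subseteq> ball w (2 * r)" using r by auto
      then have "norm (u (w + h) - u w - dir_deriv u w h) \<le> 128 * M / r\<^sup>2 * norm h ^ 2"
        by (intro slice_taylor(1)[OF u r(1)]) (use r elim in auto)
      then show ?case by (cases "h = 0") (auto simp: pos_divide_le_eq power2_eq_square mult.assoc)
    qed
  qed
qed

lemma slice_holI:
  assumes S: "open S"
    and d: "\<And>z. z \<in> S \<Longrightarrow> \<exists>u'. (u has_derivative u') (at z) \<and> (\<forall>c v. u' (c *s v) = c * u' v)"
  shows "slice_hol u S"
  unfolding slice_hol_def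
proof (intro conjI ballI)
  show "continuous_on S u"
    using d has_derivative_continuous by (metis continuous_at_imp_continuous_on)
  fix w assume w: "w \<in> S"
  then obtain r where r: "r > 0" "ball w r \<subseteq> S" using S open_contains_ball by blast
  have "(\<lambda>t. u (w + t *s v)) holomorphic_on ball 0 1" if v: "norm v < r" for v
    unfolding holomorphic_on_open[OF open_ball]
  proof
    fix t :: complex assume t: "t \<in> ball 0 1"
    have "cmod t * norm v \<le> 1 * norm v" using t by (intro mult_right_mono) auto
    then have "w + t *s v \<in> ball w r" using v by (simp add: dist_norm norm_smult)
    then have "w + t *s v \<in> S" using r(2) by blast
    from d[OF this] obtain u' where u': "(u has_derivative u') (at (w + t *s v))" "\<And>c v. u' (c *s v) = c * u' v"
      by blast
    have "((\<lambda>t. w + t *s v) has_derivative (\<lambda>s. s *s v)) (at t)"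
      using has_derivative_add[OF has_derivative_const bounded_linear_imp_has_derivative[OF bounded_linear_smult_left]]
      by simp
    from diff_chain_at[OF this u'(1)]
    have "((\<lambda>t. u (w + t *s v)) has_derivative (\<lambda>s. s * u' v)) (at t)" by (simp add: o_def u'(2))
    moreover have "(\<lambda>s. s * u' v) = (*) (u' v)" by (auto simp: mult.commute)
    ultimately show "\<exists>D. ((\<lambda>t. u (w + t *s v)) has_field_derivative D) (at t)"
      unfolding has_field_derivative_def by auto
  qed
  with r(1) show "\<exists>r>0. \<forall>v. norm v < r \<longrightarrow> (\<lambda>t. u (w + t *s v)) holomorphic_on ball 0 1"
    by (intro exI[of _ r]) simp
qed

lemma bounded_linear_axis: "bounded_linear (axis i :: complex \<Rightarrow> complex ^ 'n)"
  unfolding linear_conv_bounded_linear[symmetric]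
  by (rule linearI) (auto simp: vec_eq_iff axis_def)

lemma has_derivative_vec:
  fixes f :: "'a::real_normed_vector \<Rightarrow> complex ^ 'n"
  assumes "\<And>i. ((\<lambda>z. f z $ i) has_derivative (\<lambda>v. f' v $ i)) F"
  shows "(f has_derivative f') F"
proof -
  have *: "x = (\<Sum>i\<in>UNIV. axis i (x $ i))" for x :: "complex ^ 'n"
    by (simp add: vec_eq_iff axis_def if_distrib cong: if_cong)
  have "((\<lambda>z. \<Sum>i\<in>UNIV. axis i (f z $ i)) has_derivative (\<lambda>v. \<Sum>i\<in>UNIV. axis i (f' v $ i))) F"
    by (intro has_derivative_sum bounded_linear.has_derivative[OF bounded_linear_axis] assms)
  then show ?thesis by (simp only: *[symmetric])
qed

text \<open>The bridge to one variable: left to right is the chain rule, right to left is Osgood's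
  lemma. Weierstrass' theorem and the theorem on inverses are both proved on the right-hand
  side.\<close>

lemma holomorphic_map_on_iff_slice_hol:
  assumes "open S"
  shows "holomorphic_map_on f S \<longleftrightarrow> (\<forall>i. slice_hol (\<lambda>z. f z $ i) S)"
proof
  assume f: "holomorphic_map_on f S"
  show "\<forall>i. slice_hol (\<lambda>z. f z $ i) S"
  proof
    fix i show "slice_hol (\<lambda>z. f z $ i) S"
    proof (rule slice_holI[OF assms])
      fix z assume "z \<in> S"
      then obtain f' where "(f has_derivative f') (at z)" "\<forall>c v. f' (c *s v) = c *s f' v"
        using f unfolding holomorphic_map_on_def by blast
      then show "\<exists>u'. ((\<lambda>z. f z $ i) has_derivative u') (at z) \<and> (\<forall>c v. u' (c *s v) = c * u' v)"
        by (intro exI[of _ "\<lambda>v. f' v $ i"]) (simp add: bounded_linear.has_derivative[OF bounded_linear_vec_nth])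
    qed
  qed
next
  assume f: "\<forall>i. slice_hol (\<lambda>z. f z $ i) S"
  show "holomorphic_map_on f S" unfolding holomorphic_map_on_def
  proof
    fix z assume z: "z \<in> S"
    have "(f has_derivative (\<lambda>v. \<chi> i. dir_deriv (\<lambda>z. f z $ i) z v)) (at z)"
      by (rule has_derivative_vec) (simp add: slice_hol_has_derivative[OF spec[OF f] assms z])
    moreover have "(\<chi> i. dir_deriv (\<lambda>z. f z $ i) z (c *s v)) = c *s (\<chi> i. dir_deriv (\<lambda>z. f z $ i) z v)" for c v
      by (simp add: vec_eq_iff dir_deriv_smult[OF spec[OF f] z])
    ultimately show "\<exists>f'. (f has_derivative f') (at z) \<and> (\<forall>c v. f' (c *s v) = c *s f' v)" by blast
  qed
qed

lemma holomorphic_map_on_subset: "holomorphic_map_on f S \<Longrightarrow> T \<subseteq> S \<Longrightarrow> holomorphic_map_on f T"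
  unfolding holomorphic_map_on_def by blast

lemma holomorphic_map_on_cong:
  assumes "open S" "\<And>z. z \<in> S \<Longrightarrow> f z = g z" "holomorphic_map_on f S"
  shows "holomorphic_map_on g S"
  unfolding holomorphic_map_on_def
proof
  fix z assume z: "z \<in> S"
  obtain f' where f': "(f has_derivative f') (at z)" "\<forall>c v. f' (c *s v) = c *s f' v"
    using assms(3) z unfolding holomorphic_map_on_def by blast
  have "(g has_derivative f') (at z)"
    by (rule has_derivative_transform_within_open[OF f'(1) assms(1) z assms(2)])
  with f'(2) show "\<exists>g'. (g has_derivative g') (at z) \<and> (\<forall>c v. g' (c *s v) = c *s g' v)" by blast
qed

lemma holomorphic_map_on_continuous: "holomorphic_map_on f S \<Longrightarrow> continuous_on S f"
  unfolding holomorphic_map_on_def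
  by (metis continuous_at_imp_continuous_on has_derivative_continuous)

lemma holomorphic_map_on_compose:
  assumes "holomorphic_map_on f S" "holomorphic_map_on g T" "f ` S \<subseteq> T"
  shows "holomorphic_map_on (\<lambda>z. g (f z)) S"
  unfolding holomorphic_map_on_def
proof
  fix z assume z: "z \<in> S"
  obtain f' where f': "(f has_derivative f') (at z)" "\<forall>c v. f' (c *s v) = c *s f' v"
    using assms(1) z unfolding holomorphic_map_on_def by blast
  obtain g' where g': "(g has_derivative g') (at (f z))" "\<forall>c v. g' (c *s v) = c *s g' v"
    using assms z unfolding holomorphic_map_on_def by blast
  show "\<exists>h. ((\<lambda>z. g (f z)) has_derivative h) (at z) \<and> (\<forall>c v. h (c *s v) = c *s h v)"
    using diff_chain_at[OF f'(1) g'(1)] f'(2) g'(2) by (intro exI[of _ "g' \<circ> f'"]) (simp add: o_def)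
qed

lemma holomorphic_map_locally:
  assumes "\<And>z. z \<in> S \<Longrightarrow> \<exists>r>0. holomorphic_map_on f (ball z r)"
  shows "holomorphic_map_on f S"
  unfolding holomorphic_map_on_def
proof
  fix z assume "z \<in> S"
  from assms[OF this] obtain r where "r > 0" "holomorphic_map_on f (ball z r)" by blast
  then show "\<exists>f'. (f has_derivative f') (at z) \<and> (\<forall>c v. f' (c *s v) = c *s f' v)"
    unfolding holomorphic_map_on_def using centre_in_ball[of z r] by blast
qed

text \<open>Weierstrass' theorem, reduced to discs in complex lines. Holomorphy of
  \<open>f n\<close> is asked only for large \<open>n\<close>, because the inverse maps to which
  this is applied have domains that vary with \<open>n\<close>.\<close>

lemma holomorphic_map_uniform_limit:
  fixes f :: "nat \<Rightarrow> complex ^ 'm \<Rightarrow> complex ^ 'n"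
  assumes ev: "\<forall>\<^sub>F n in sequentially. holomorphic_map_on (f n) (ball z r)"
    and lim: "uniform_limit (ball z r) f g sequentially"
  shows "holomorphic_map_on g (ball z r)"
proof -
  have cont: "continuous_on (ball z r) g"
    by (rule uniform_limit_theorem[OF _ lim])
      (use ev in \<open>auto elim!: eventually_mono intro: holomorphic_map_on_continuous\<close>)
  have "slice_hol (\<lambda>x. g x $ i) (ball z r)" for i
    unfolding slice_hol_def
  proof (intro conjI ballI)
    show "continuous_on (ball z r) (\<lambda>x. g x $ i)" by (intro continuous_intros cont)
    fix w assume "w \<in> ball z r"
    then obtain s where s: "s > 0" "ball w s \<subseteq> ball z r" using open_contains_ball[of "ball z r"] by (auto simp del: mem_ball)
    have "(\<lambda>t. g (w + t *s v) $ i) holomorphic_on ball 0 1" if v: "norm v < s" for v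
    proof (rule holomorphic_uniform_sequence[OF open_ball, where f = "\<lambda>n t. if holomorphic_map_on (f n) (ball z r) then f n (w + t *s v) $ i else 0"])
      have inb: "w + t *s v \<in> ball z r" if "t \<in> ball 0 1" for t
      proof -
        have "cmod t * norm v \<le> 1 * norm v" using that by (intro mult_right_mono) auto
        then have "w + t *s v \<in> ball w s" using v by (simp add: dist_norm norm_smult)
        then show ?thesis using s(2) by blast
      qed
      show "(\<lambda>t. if holomorphic_map_on (f n) (ball z r) then f n (w + t *s v) $ i else 0) holomorphic_on ball 0 1" for n
      proof (cases "holomorphic_map_on (f n) (ball z r)")
        case True
        then have "slice_hol (\<lambda>x. f n x $ i) (ball z r)" by (simp add: holomorphic_map_on_iff_slice_hol)
        from slice_hol_line[OF this open_ball[of 0 1] inb] True show ?thesis by simp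
      qed simp
      fix t :: complex assume "t \<in> ball 0 1"
      then obtain d where d: "d > 0" "cball t d \<subseteq> ball 0 1"
        using open_contains_cball[of "ball (0::complex) 1"] by blast
      have "uniform_limit (cball t d) (\<lambda>n t. if holomorphic_map_on (f n) (ball z r) then f n (w + t *s v) $ i else 0)
          (\<lambda>t. g (w + t *s v) $ i) sequentially"
      proof (rule uniform_limitI)
        fix e :: real assume "e > 0"
        with lim have "\<forall>\<^sub>F n in sequentially. \<forall>x\<in>ball z r. dist (f n x) (g x) < e" by (simp add: uniform_limit_iff)
        with ev show "\<forall>\<^sub>F n in sequentially. \<forall>t\<in>cball t d.
            dist (if holomorphic_map_on (f n) (ball z r) then f n (w + t *s v) $ i else 0) (g (w + t *s v) $ i) < e"
        proof eventually_elim
          case (elim n)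
          show ?case
          proof
            fix t' assume "t' \<in> cball t d"
            then have "dist (f n (w + t' *s v)) (g (w + t' *s v)) < e" using elim inb d(2) by blast
            then show "dist (if holomorphic_map_on (f n) (ball z r) then f n (w + t' *s v) $ i else 0) (g (w + t' *s v) $ i) < e"
              using elim(1) dist_vec_nth_le[of "f n (w + t' *s v)" i "g (w + t' *s v)"] by simp
          qed
        qed
      qed
      then show "\<exists>d>0. cball t d \<subseteq> ball 0 1 \<and> uniform_limit (cball t d) (\<lambda>n t. if holomorphic_map_on (f n) (ball z r) then f n (w + t *s v) $ i else 0)
          (\<lambda>t. g (w + t *s v) $ i) sequentially" using d by blast
    qed
    with s(1) show "\<exists>r>0. \<forall>v. norm v < r \<longrightarrow> (\<lambda>t. g (w + t *s v) $ i) holomorphic_on ball 0 1"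
      by (intro exI[of _ s]) simp
  qed
  then show ?thesis by (simp add: holomorphic_map_on_iff_slice_hol)
qed

section \<open>Algebraic closure properties of holomorphic functions\<close>

lemma slice_hol_mult:
  assumes "open S" "slice_hol u S" "slice_hol v S"
  shows "slice_hol (\<lambda>z. u z * v z) S"
proof (rule slice_holI[OF assms(1)])
  fix z assume z: "z \<in> S"
  show "\<exists>u'. ((\<lambda>z. u z * v z) has_derivative u') (at z) \<and> (\<forall>c x. u' (c *s x) = c * u' x)"
    using has_derivative_mult[OF slice_hol_has_derivative[OF assms(2,1) z] slice_hol_has_derivative[OF assms(3,1) z]]
    by (intro exI conjI) (assumption, simp add: dir_deriv_smult[OF assms(2) z] dir_deriv_smult[OF assms(3) z] algebra_simps)
qed

lemma slice_hol_add:
  assumes "open S" "slice_hol u S" "slice_hol v S"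
  shows "slice_hol (\<lambda>z. u z + v z) S"
proof (rule slice_holI[OF assms(1)])
  fix z assume z: "z \<in> S"
  show "\<exists>u'. ((\<lambda>z. u z + v z) has_derivative u') (at z) \<and> (\<forall>c x. u' (c *s x) = c * u' x)"
    using has_derivative_add[OF slice_hol_has_derivative[OF assms(2,1) z] slice_hol_has_derivative[OF assms(3,1) z]]
    by (intro exI conjI) (assumption, simp add: dir_deriv_smult[OF assms(2) z] dir_deriv_smult[OF assms(3) z] algebra_simps)
qed

lemma slice_hol_const: "slice_hol (\<lambda>z. c) S"
  unfolding slice_hol_def by (auto intro!: exI[of _ 1])

lemma slice_hol_sum:
  assumes "open S" "\<And>i. i \<in> I \<Longrightarrow> slice_hol (u i) S"
  shows "slice_hol (\<lambda>z. \<Sum>i\<in>I. u i z) S"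
  using assms(2)
  by (induction I rule: infinite_finite_induct) (auto simp: slice_hol_const intro!: slice_hol_add[OF assms(1)])

lemma slice_hol_prod:
  assumes "open S" "\<And>i. i \<in> I \<Longrightarrow> slice_hol (u i) S"
  shows "slice_hol (\<lambda>z. \<Prod>i\<in>I. u i z) S"
  using assms(2)
  by (induction I rule: infinite_finite_induct) (auto simp: slice_hol_const intro!: slice_hol_mult[OF assms(1)])

lemma slice_hol_inverse:
  assumes "open S" "slice_hol u S" "\<And>z. z \<in> S \<Longrightarrow> u z \<noteq> 0"
  shows "slice_hol (\<lambda>z. inverse (u z)) S"
proof (rule slice_holI[OF assms(1)])
  fix z assume z: "z \<in> S"
  show "\<exists>u'. ((\<lambda>z. inverse (u z)) has_derivative u') (at z) \<and> (\<forall>c x. u' (c *s x) = c * u' x)"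
    using Deriv.has_derivative_inverse[OF assms(3)[OF z] slice_hol_has_derivative[OF assms(2,1) z]]
    by (intro exI conjI) (assumption, simp add: dir_deriv_smult[OF assms(2) z])
qed

lemma holomorphic_map_on_ident: "holomorphic_map_on (\<lambda>z. z) S"
  unfolding holomorphic_map_on_def by (auto intro!: exI[of _ "\<lambda>z. z"])

lemma slice_hol_nth: "open S \<Longrightarrow> slice_hol (\<lambda>z. z $ i) S"
  using holomorphic_map_on_iff_slice_hol[of S "\<lambda>z. z"] holomorphic_map_on_ident by blast

section \<open>Montel's theorem\<close>

lemma norm_le_sum_norm_nth: "norm (x :: complex ^ 'n) \<le> (\<Sum>i\<in>UNIV. norm (x $ i))"
  unfolding norm_vec_def by (rule L2_set_le_sum) simp

text \<open>Two points of \<open>ball x (r / 16)\<close> are less than \<open>r / 8\<close> apart, a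
  quarter of \<open>r / 2\<close>, so \<open>slice_taylor\<close> on \<open>ball y' (r / 2)\<close>
  yields \<open>80 * M / r\<close> for each component; \<open>CARD('n)\<close> comes from summing
  components.\<close>

lemma holomorphic_map_lipschitz:
  fixes F :: "complex ^ 'm \<Rightarrow> complex ^ 'n"
  assumes F: "holomorphic_map_on F (ball x r)" and r: "r > 0"
    and M: "\<And>y. norm (F y) \<le> M" and y: "y \<in> ball x (r / 16)" "y' \<in> ball x (r / 16)"
  shows "norm (F y - F y') \<le> real CARD('n) * (80 * M / r) * norm (y - y')"
proof -
  have "norm ((F y - F y') $ i) \<le> 80 * M / r * norm (y - y')" for i
  proof -
    have u: "slice_hol (\<lambda>z. F z $ i) (ball x r)" using F by (simp add: holomorphic_map_on_iff_slice_hol)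
    have "dist y y' < r / 8" using dist_triangle2[of y y' x] y by (simp add: dist_commute)
    then have v: "norm (y - y') < (r / 2) / 4" by (simp add: dist_norm)
    have "cmod (F (y' + (y - y')) $ i - F y' $ i) \<le> 40 * M / (r / 2) * norm (y - y')"
    proof (rule slice_taylor(2)[OF u _ _ _ v])
      show "ball y' (r / 2) \<subseteq> ball x r"
      proof
        fix z assume "z \<in> ball y' (r / 2)"
        then show "z \<in> ball x r" using y(2) dist_triangle[of x z y'] r by simp
      qed
      show "cmod (F z $ i) \<le> M" for z using M[of z] Finite_Cartesian_Product.norm_nth_le[of "F z" i] by linarith
    qed (use r in auto)
    then show ?thesis by simp
  qed
  then have "(\<Sum>i\<in>UNIV. norm ((F y - F y') $ i)) \<le> (\<Sum>i\<in>(UNIV :: 'n set). 80 * M / r * norm (y - y'))"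
    by (intro sum_mono)
  also have "\<dots> = real CARD('n) * (80 * M / r) * norm (y - y')" by simp
  finally show ?thesis using norm_le_sum_norm_nth[of "F y - F y'"] by linarith
qed

text \<open>The form with eventual holomorphy near each point suits the inverse maps in
  \<open>exhaustion_biholomorphic\<close>, whose domains merely exhaust \<open>D\<close>. A
  subsequence converges on a countable dense set, and the common Lipschitz bound spreads this to
  uniform convergence near every point.\<close>

theorem montel:
  fixes f :: "nat \<Rightarrow> complex ^ 'm \<Rightarrow> complex ^ 'n"
  assumes S: "open S" and M: "\<And>n x. norm (f n x) \<le> M"
    and ev: "\<And>x. x \<in> S \<Longrightarrow> \<exists>r>0. \<forall>\<^sub>F n in sequentially. holomorphic_map_on (f n) (ball x r)"
  obtains k g where "strict_mono (k :: nat \<Rightarrow> nat)" "holomorphic_map_on g S"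
    "\<And>K. compact K \<Longrightarrow> K \<subseteq> S \<Longrightarrow> uniform_limit K (\<lambda>n. f (k n)) g sequentially"
proof -
  have M0: "M \<ge> 0" using M[of 0 0] norm_ge_zero[of "f 0 0"] by linarith
  obtain Q :: "(complex ^ 'm) set" where Q: "countable Q" "\<And>X. open X \<Longrightarrow> X \<noteq> {} \<Longrightarrow> \<exists>d\<in>Q. d \<in> X"
    using countable_dense_exists by blast
  obtain k where k: "strict_mono (k :: nat \<Rightarrow> nat)" "\<And>x. x \<in> Q \<Longrightarrow> \<exists>l. (\<lambda>n. f (k n) x) \<longlonglongrightarrow> l"
    using function_convergent_subsequence[OF Q(1), of f M] M by blast
  define g where "g x = lim (\<lambda>n. f (k n) x)" for x
  have loc: "\<exists>s>0. holomorphic_map_on g (ball x s) \<and> uniform_limit (ball x s) (\<lambda>n. f (k n)) g sequentially"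
    if x: "x \<in> S" for x
  proof -
    obtain r where r: "r > 0" "\<forall>\<^sub>F n in sequentially. holomorphic_map_on (f n) (ball x r)"
      using ev[OF x] by blast
    have evk: "\<forall>\<^sub>F n in sequentially. holomorphic_map_on (f (k n)) (ball x r)"
      by (rule eventually_compose_filterlim[OF r(2) filterlim_subseq[OF k(1)]])
    \<comment> \<open>\<open>2 * s\<close> is the radius \<open>r / 16\<close> of the Lipschitz
      bound, so the dense points covering \<open>cball x s\<close> may lie slightly outside
      it.\<close>
    define s where "s = r / 32"
    define L where "L = real CARD('n) * (80 * M / r) + 1"
    have L: "L > 0" using M0 r by (simp add: L_def add_nonneg_pos)
    have s: "s > 0" "s < r" using r by (auto simp: s_def)
    have lip: "norm (F y - F y') \<le> L * norm (y - y')"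
      if "holomorphic_map_on F (ball x r)" "\<And>y. norm (F y) \<le> M" "y \<in> ball x (2 * s)" "y' \<in> ball x (2 * s)"
      for F :: "complex ^ 'm \<Rightarrow> complex ^ 'n" and y y'

      using holomorphic_map_lipschitz[OF that(1) r(1) that(2), of y y'] that(3,4)
      by (simp add: s_def L_def distrib_right add_increasing2 add_increasing)
    have "uniformly_Cauchy_on (cball x s) (\<lambda>n. f (k n))"
    proof (rule uniformly_Cauchy_onI)
      fix e :: real assume e: "e > 0"
      \<comment> \<open>Two Lipschitz errors of at most \<open>L * d \<le> e / 4\<close> and one
        error \<open>e / 4\<close> at a dense point stay below \<open>e\<close>.\<close>
      define d where "d = min s (e / (4 * L))"
      have d: "d > 0" "d \<le> s" using s e L by (simp_all add: d_def)
      have "L * d \<le> L * (e / (4 * L))" using L by (intro mult_left_mono) (simp_all add: d_def)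
      then have dL: "L * d \<le> e / 4" using L by simp
      have "cball x s \<subseteq> (\<Union>q\<in>Q \<inter> ball x (2 * s). ball q d)"
      proof
        fix y assume y: "y \<in> cball x s"
        obtain q where "q \<in> Q" "q \<in> ball y d" using Q(2)[of "ball y d"] d(1) by auto
        moreover from this have "q \<in> ball x (2 * s)" using y d(2) dist_triangle[of x q y] by simp
        ultimately show "y \<in> (\<Union>q\<in>Q \<inter> ball x (2 * s). ball q d)" by (auto simp: dist_commute)
      qed
      then obtain T where T: "T \<subseteq> Q \<inter> ball x (2 * s)" "finite T" "cball x s \<subseteq> (\<Union>q\<in>T. ball q d)"
        using compactE_image[OF compact_cball, of "Q \<inter> ball x (2 * s)" "\<lambda>q. ball q d" x s] by blast
      have "\<forall>q\<in>T. \<exists>N. \<forall>m\<ge>N. \<forall>n\<ge>N. dist (f (k m) q) (f (k n) q) < e / 4"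
      proof
        fix q assume "q \<in> T"
        then have "Cauchy (\<lambda>n. f (k n) q)" using T(1) k(2) LIMSEQ_imp_Cauchy by blast
        from this[unfolded Cauchy_def, rule_format, of "e / 4"] e
        show "\<exists>N. \<forall>m\<ge>N. \<forall>n\<ge>N. dist (f (k m) q) (f (k n) q) < e / 4" by simp
      qed
      from bchoice[OF this]
      obtain N where N: "\<And>q m n. q \<in> T \<Longrightarrow> m \<ge> N q \<Longrightarrow> n \<ge> N q \<Longrightarrow> dist (f (k m) q) (f (k n) q) < e / 4"
        by blast
      obtain N0 where N0: "\<And>n. n \<ge> N0 \<Longrightarrow> holomorphic_map_on (f (k n)) (ball x r)"
        using evk unfolding eventually_sequentially by blast
      define N1 where "N1 = Max (insert N0 (N ` T))"
      have N1: "N1 \<ge> N0" "\<And>q. q \<in> T \<Longrightarrow> N1 \<ge> N q" using T(2) by (auto simp: N1_def)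
      show "\<exists>N. \<forall>y\<in>cball x s. \<forall>m\<ge>N. \<forall>n\<ge>N. dist (f (k m) y) (f (k n) y) < e"
      proof (intro exI[of _ N1] ballI allI impI)
        fix y m n assume y: "y \<in> cball x s" and mn: "N1 \<le> m" "N1 \<le> n"
        from y T(3) obtain q where q: "q \<in> T" "y \<in> ball q d" by blast
        have y2: "y \<in> ball x (2 * s)" using y s by simp
        have q2: "q \<in> ball x (2 * s)" using q(1) T(1) by blast
        have le: "dist (f (k j) y) (f (k j) q) \<le> e / 4" if "N1 \<le> j" for j
        proof -
          have "holomorphic_map_on (f (k j)) (ball x r)" using N0 N1(1) that by simp
          from lip[OF this M y2 q2] have "dist (f (k j) y) (f (k j) q) \<le> L * dist y q" by (simp add: dist_norm)
          also have "\<dots> \<le> L * d" using q(2) L by (simp add: dist_commute)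
          finally show ?thesis using dL by linarith
        qed
        have "dist (f (k m) q) (f (k n) q) < e / 4" using N[OF q(1)] N1(2)[OF q(1)] mn by simp
        moreover have "dist (f (k m) y) (f (k n) y) \<le> dist (f (k m) y) (f (k m) q) + dist (f (k m) q) (f (k n) q) + dist (f (k n) y) (f (k n) q)"
          using dist_triangle[of "f (k m) y" "f (k n) y" "f (k m) q"] dist_triangle[of "f (k m) q" "f (k n) y" "f (k n) q"]
          by (simp add: dist_commute)
        ultimately show "dist (f (k m) y) (f (k n) y) < e" using le[OF mn(1)] le[OF mn(2)] e by linarith
      qed
    qed
    then have "uniformly_convergent_on (cball x s) (\<lambda>n. f (k n))" by (rule Cauchy_uniformly_convergent)
    then have "uniform_limit (cball x s) (\<lambda>n. f (k n)) g sequentially"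
      unfolding g_def uniformly_convergent_uniform_limit_iff .
    then have lim: "uniform_limit (ball x s) (\<lambda>n. f (k n)) g sequentially"
      by (rule uniform_limit_on_subset) auto
    moreover have "holomorphic_map_on g (ball x s)"
    proof (rule holomorphic_map_uniform_limit[OF _ lim])
      show "\<forall>\<^sub>F n in sequentially. holomorphic_map_on (f (k n)) (ball x s)"
        using evk by (rule eventually_mono) (erule holomorphic_map_on_subset, use s in auto)
    qed
    ultimately show ?thesis using s by blast
  qed
  have "holomorphic_map_on g S" using loc by (intro holomorphic_map_locally) blast
  moreover have "uniform_limit K (\<lambda>n. f (k n)) g sequentially" if K: "compact K" "K \<subseteq> S" for K
  proof -
    have "\<forall>x\<in>S. \<exists>s. s > 0 \<and> uniform_limit (ball x s) (\<lambda>n. f (k n)) g sequentially"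
      using loc by blast
    from bchoice[OF this]
    obtain s where s: "\<And>x. x \<in> S \<Longrightarrow> s x > 0 \<and> uniform_limit (ball x (s x)) (\<lambda>n. f (k n)) g sequentially"
      by blast
    have "K \<subseteq> (\<Union>x\<in>K. ball x (s x))"
    proof
      fix x assume "x \<in> K"
      then show "x \<in> (\<Union>x\<in>K. ball x (s x))" using s K(2) by (intro UN_I[of x]) auto
    qed
    then obtain T where T: "T \<subseteq> K" "finite T" "K \<subseteq> (\<Union>x\<in>T. ball x (s x))"
      using compactE_image[OF K(1), of K "\<lambda>x. ball x (s x)"] by auto
    have "uniform_limit (\<Union>x\<in>T. ball x (s x)) (\<lambda>n. f (k n)) g sequentially"
      by (rule uniform_limit_on_UNION) (use T K s in blast)+
    then show ?thesis using T(3) by (rule uniform_limit_on_subset)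
  qed
  ultimately show ?thesis using k(1) that by blast
qed

text \<open>Continuous convergence: needed for expressions such as
  \<open>F' (s n) (G (s n) w)\<close>, in which the map and its argument both vary with
  \<open>n\<close>.\<close>

lemma uniform_limit_tendsto_compose:
  fixes f :: "nat \<Rightarrow> 'a::euclidean_space \<Rightarrow> 'b::metric_space"
  assumes S: "open S" and lim: "\<And>K. compact K \<Longrightarrow> K \<subseteq> S \<Longrightarrow> uniform_limit K f g sequentially"
    and g: "continuous_on S g" and x: "x \<longlonglongrightarrow> a" "a \<in> S"
  shows "(\<lambda>n. f n (x n)) \<longlonglongrightarrow> g a"
proof (rule tendstoI)
  fix e :: real assume e: "e > 0"
  obtain d where d: "d > 0" "cball a d \<subseteq> S" using S x(2) open_contains_cball by blast
  have "\<forall>\<^sub>F n in sequentially. \<forall>y\<in>cball a d. dist (f n y) (g y) < e / 2"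
    using lim[OF compact_cball d(2)] e unfolding uniform_limit_iff by (meson half_gt_zero)
  moreover have "isCont g a" using g S x(2) continuous_on_eq_continuous_at by blast
  then have "\<forall>\<^sub>F n in sequentially. dist (g (x n)) (g a) < e / 2"
    using e by (intro tendstoD[OF isCont_tendsto_compose[OF _ x(1)]]) auto
  moreover have "\<forall>\<^sub>F n in sequentially. dist (x n) a < d" using x(1) d(1) by (rule tendstoD)
  ultimately show "\<forall>\<^sub>F n in sequentially. dist (f n (x n)) (g a) < e"
  proof eventually_elim
    case (elim n)
    then have "dist (f n (x n)) (g (x n)) < e / 2" by (simp add: dist_commute)
    with elim(2) dist_triangle[of "f n (x n)" "g a" "g (x n)"] show ?case by linarith
  qed
qed

section \<open>Inverses of injective holomorphic maps\<close>

lemma inj_on_subspace_if_dim_le: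
  fixes h :: "'a::euclidean_space \<Rightarrow> 'b::euclidean_space"
  assumes h: "linear h" and S: "subspace S" and d: "dim S \<le> dim (h ` S)"
  shows "inj_on h S"
proof -
  obtain B where B: "B \<subseteq> S" "independent B" "S \<subseteq> span B" "card B = dim S"
    using basis_exists[of S] by blast
  have fB: "finite B" using B(2) by (rule independent_imp_finite)
  have sp: "S = span B" using B S by (metis span_subspace)
  have "h ` S = span (h ` B)" unfolding sp using linear_span_image[OF h] by blast
  then have dd: "dim (h ` S) = dim (h ` B)" by simp
  have "dim (h ` B) \<le> card (h ` B)" using fB by (intro dim_le_card') auto
  moreover have "card (h ` B) \<le> card B" using fB by (rule card_image_le)
  ultimately have c: "card (h ` B) = card B" "card (h ` B) = dim (h ` B)" using d dd B(4) by linarith+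
  have "inj_on h B" using c(1) fB by (metis eq_card_imp_inj_on)
  moreover have "independent (h ` B)"
    by (rule card_le_dim_spanning[of "h ` B" "h ` B"]) (use fB c span_superset[of "h ` B"] in auto)
  ultimately show ?thesis unfolding sp using linear_inj_on_span_independent_image[OF h] by blast
qed

lemma linear_blinfun: "linear (blinfun_apply f)"
  by (rule bounded_linear.linear[OF blinfun.bounded_linear_right])

text \<open>At a point \<open>x0\<close> of maximal rank with \<open>A = f' x0\<close> and \<open>A L A = A\<close>, the map
  \<open>\<Psi> x = x - L A x + L (f x)\<close> is a local diffeomorphism with \<open>A (\<Psi>' x) = A L (f' x)\<close>; hence \<open>f\<close> is
  constant along the preimages under \<open>\<Psi>\<close> of segments in the kernel of \<open>A\<close>.\<close>

lemma C1_injective_regular_point: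
  fixes f :: "'a::euclidean_space \<Rightarrow> 'b::euclidean_space"
  assumes V: "open V" "V \<noteq> {}"
    and der: "\<And>x. x \<in> V \<Longrightarrow> (f has_derivative blinfun_apply (f' x)) (at x)"
    and cont: "continuous_on V f'" and inj: "inj_on f V"
  obtains x where "x \<in> V" "inj (blinfun_apply (f' x))"
proof -
  define rk where "rk x = dim (range (blinfun_apply (f' x)))" for x
  obtain x1 where "x1 \<in> V" using V by blast
  then have "\<exists>x. x \<in> V \<and> (\<forall>y. y \<in> V \<longrightarrow> rk y \<le> rk x)"
    by (rule Lattices_Big.ex_has_greatest_nat[of _ _ _ "Suc DIM('b)"]) (auto simp: rk_def le_imp_less_Suc dim_subset_UNIV)
  then obtain x0 where x0: "x0 \<in> V" "\<And>y. y \<in> V \<Longrightarrow> rk y \<le> rk x0" by blast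
  define A where "A = blinfun_apply (f' x0)"
  have linA: "linear A" unfolding A_def by (rule linear_blinfun)
  obtain L0 where L0: "linear L0" "\<forall>v\<in>range A. A (L0 v) = v"
    using linear_exists_right_inverse_on[OF linA subspace_UNIV] by blast
  define L where "L = Blinfun L0"
  have L: "blinfun_apply L = L0" unfolding L_def
    using L0(1) by (simp add: bounded_linear_Blinfun_apply linear_conv_bounded_linear)
  have ALA: "A (L (A x)) = A x" for x unfolding L using L0(2) by blast
  define \<Psi> where "\<Psi> x = x - L (A x) + L (f x)" for x
  define \<Psi>' where "\<Psi>' x = id_blinfun - (L o\<^sub>L f' x0) + (L o\<^sub>L f' x)" for x
  have \<Psi>'_apply: "blinfun_apply (\<Psi>' x) u = u - L (A u) + L (f' x u)" for x u
    by (simp add: \<Psi>'_def A_def blinfun.add_left blinfun.diff_left)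
  have A\<Psi>': "A (\<Psi>' x u) = A (L (f' x u))" for x u
    unfolding \<Psi>'_apply using ALA by (simp add: linear_add[OF linA] linear_diff[OF linA])
  have d\<Psi>: "(\<Psi> has_derivative blinfun_apply (\<Psi>' x)) (at x)" if "x \<in> V" for x
  proof -
    have "(A has_derivative A) (at x)"
      unfolding A_def by (rule bounded_linear_imp_has_derivative) (rule blinfun.bounded_linear_right)
    then have "((\<lambda>x. x - L (A x) + L (f x)) has_derivative (\<lambda>u. u - L (A u) + L (f' x u))) (at x)"
      by (intro has_derivative_add has_derivative_diff has_derivative_ident
          bounded_linear.has_derivative[OF blinfun.bounded_linear_right] der that)
    then show ?thesis by (simp add: \<Psi>_def[abs_def] \<Psi>'_apply[abs_def])
  qed
  have c\<Psi>: "continuous_on V \<Psi>'" unfolding \<Psi>'_def by (intro continuous_intros cont)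
  have "id_blinfun o\<^sub>L \<Psi>' x0 = id_blinfun"
    by (rule blinfun_eqI) (simp add: \<Psi>'_def)
  from inverse_function_theorem[OF V(1) d\<Psi> c\<Psi> x0(1) this]
  obtain U W g g' where U: "open U" "U \<subseteq> V" "x0 \<in> U" "open W" "\<Psi> x0 \<in> W" "homeomorphism U W \<Psi> g"
    and g: "\<And>y. y \<in> W \<Longrightarrow> (g has_derivative (g' y)) (at y)"
      "\<And>y. y \<in> W \<Longrightarrow> g' y = inv (blinfun_apply (\<Psi>' (g y)))" "\<And>y. y \<in> W \<Longrightarrow> bij (blinfun_apply (\<Psi>' (g y)))"
    by metis
  have gU: "g y \<in> U" "\<Psi> (g y) = y" if "y \<in> W" for y using U(6) that unfolding homeomorphism_def by auto
  have "inj A"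
  proof (rule ccontr)
    assume "\<not> inj A"
    then obtain v where v: "v \<noteq> 0" "A v = 0" using linear_injective_0[OF linA] by blast
    have fg: "((\<lambda>y. f (g y)) has_derivative (\<lambda>h. f' (g y) (g' y h))) (at y)"
      and fg0: "f' (g y) (g' y v) = 0" if y: "y \<in> W" for y
    proof -
      define x where "x = g y"
      have xV: "x \<in> V" using gU(1)[OF y] U(2) by (auto simp: x_def)
      show "((\<lambda>y. f (g y)) has_derivative (\<lambda>h. f' (g y) (g' y h))) (at y)"
        using diff_chain_at[OF g(1)[OF y] der[OF xV, unfolded x_def]] by (simp add: o_def)
      define u where "u = g' y v"
      have sj: "surj (blinfun_apply (\<Psi>' x))" using g(3)[OF y] bij_is_surj by (auto simp: x_def)
      have "\<Psi>' x u = v" unfolding u_def g(2)[OF y] x_def using sj[unfolded x_def] by (rule surj_f_inv_f)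
      then have ker: "A (L (f' x u)) = 0" using A\<Psi>'[of x u] v(2) by simp
      let ?h = "\<lambda>w. A (L w)" let ?R = "range (blinfun_apply (f' x))"
      have linh: "linear ?h" using linear_compose[OF linear_blinfun[of L] linA] by (simp add: o_def)
      have sR: "subspace ?R" by (intro linear_subspace_image linear_blinfun subspace_UNIV)
      \<comment> \<open>Maximality of the rank enters here. As \<open>\<Psi>' x\<close> is onto,
        \<open>A \<circ> L\<close> maps the range of \<open>f' x\<close> onto the range of
        \<open>A\<close>, whose dimension is the maximal rank. So \<open>A \<circ> L\<close> is
        injective on the range of \<open>f' x\<close>; since it kills \<open>f' x u\<close>, this
        vector is 0.\<close>
      have "?h ` ?R = range (\<lambda>u. A (\<Psi>' x u))" unfolding A\<Psi>' by auto
      also have "\<dots> = A ` range (blinfun_apply (\<Psi>' x))" by auto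
      also have "\<dots> = range A" using sj by simp
      finally have "dim (?h ` ?R) = rk x0" by (simp add: rk_def A_def)
      moreover have "dim ?R \<le> rk x0" using x0(2)[OF xV] by (simp add: rk_def)
      ultimately have injh: "inj_on ?h ?R" by (intro inj_on_subspace_if_dim_le linh sR) simp
      have "?h (f' x u) = ?h 0" unfolding ker linear_0[OF linh] ..
      then have "f' x u = 0" by (rule inj_onD[OF injh]) (rule rangeI, rule subspace_0[OF sR])
      then show "f' (g y) (g' y v) = 0" by (simp add: x_def u_def)
    qed
    obtain e where e: "e > 0" "ball (\<Psi> x0) e \<subseteq> W" using U open_contains_ball by blast
    define d where "d = e / norm v"
    have d: "d > 0" using e v by (simp add: d_def)
    have inW: "\<Psi> x0 + t *\<^sub>R v \<in> W" if "t \<in> ball 0 d" for t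
    proof -
      have "\<bar>t\<bar> * norm v < e" using that v(1) by (simp add: d_def pos_less_divide_eq)
      then show ?thesis using e(2) by (auto simp: dist_norm)
    qed
    have "\<exists>c. \<forall>t\<in>ball 0 d. f (g (\<Psi> x0 + t *\<^sub>R v)) = c"
    proof (rule has_derivative_zero_constant)
      fix t :: real assume t: "t \<in> ball 0 d"
      have l: "((\<lambda>t. \<Psi> x0 + t *\<^sub>R v) has_derivative (\<lambda>s. s *\<^sub>R v)) (at t)"
        by (auto intro!: derivative_eq_intros)
      have lin: "linear (g' (\<Psi> x0 + t *\<^sub>R v))" using g(1)[OF inW[OF t]] has_derivative_linear by blast
      have "((\<lambda>t. f (g (\<Psi> x0 + t *\<^sub>R v))) has_derivative
         (\<lambda>s. f' (g (\<Psi> x0 + t *\<^sub>R v)) (g' (\<Psi> x0 + t *\<^sub>R v) (s *\<^sub>R v)))) (at t)"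
        using diff_chain_at[OF l fg[OF inW[OF t]]] by (simp add: o_def)
      moreover have "f' (g (\<Psi> x0 + t *\<^sub>R v)) (g' (\<Psi> x0 + t *\<^sub>R v) (s *\<^sub>R v)) = 0" for s
        using fg0[OF inW[OF t]] by (simp add: linear_scale[OF lin] blinfun.scaleR_right)
      ultimately show "((\<lambda>t. f (g (\<Psi> x0 + t *\<^sub>R v))) has_derivative (\<lambda>h. 0)) (at t within ball 0 d)"
        by (simp add: has_derivative_at_withinI)
    qed simp
    then obtain c where c: "\<And>t. t \<in> ball 0 d \<Longrightarrow> f (g (\<Psi> x0 + t *\<^sub>R v)) = c" by blast
    have in2: "0 \<in> ball 0 d" "d/2 \<in> ball 0 d" using d by auto
    have inV: "g (\<Psi> x0 + t *\<^sub>R v) \<in> V" if "t \<in> ball 0 d" for t using gU(1)[OF inW[OF that]] U(2) by blast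
    from c[OF in2(1)] c[OF in2(2)] have "f (g (\<Psi> x0 + 0 *\<^sub>R v)) = f (g (\<Psi> x0 + (d/2) *\<^sub>R v))" by simp
    then have "g (\<Psi> x0 + 0 *\<^sub>R v) = g (\<Psi> x0 + (d/2) *\<^sub>R v)"
      by (rule inj_onD[OF inj _ inV[OF in2(1)] inV[OF in2(2)]])
    then have "\<Psi> x0 + 0 *\<^sub>R v = \<Psi> x0 + (d/2) *\<^sub>R v" using gU(2)[OF inW[OF in2(1)]] gU(2)[OF inW[OF in2(2)]] by metis
    then show False using d v(1) by simp
  qed
  then show ?thesis using that[OF x0(1)] by (simp add: A_def)
qed

section \<open>The complex Jacobian determinant and the inverse map\<close>

definition hderiv :: "(complex ^ 'm \<Rightarrow> complex ^ 'n) \<Rightarrow> complex ^ 'm \<Rightarrow> complex ^ 'm \<Rightarrow> complex ^ 'n" where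
  "hderiv f x v = (\<chi> i. dir_deriv (\<lambda>z. f z $ i) x v)"

definition jacobian :: "(complex ^ 'n \<Rightarrow> complex ^ 'n) \<Rightarrow> complex ^ 'n \<Rightarrow> complex" where
  "jacobian f x = det (matrix (hderiv f x))"

lemma has_derivative_hderiv:
  assumes "holomorphic_map_on f S" "open S" "x \<in> S"
  shows "(f has_derivative hderiv f x) (at x)"
  using assms by (intro has_derivative_vec)
    (auto simp: hderiv_def holomorphic_map_on_iff_slice_hol intro!: slice_hol_has_derivative[of _ S])

lemma hderiv_smult:
  assumes "holomorphic_map_on f S" "open S" "x \<in> S"
  shows "hderiv f x (c *s v) = c *s hderiv f x v"
  using assms by (auto simp: vec_eq_iff hderiv_def holomorphic_map_on_iff_slice_hol intro!: dir_deriv_smult)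

lemma hderiv_matrix:
  assumes "holomorphic_map_on f S" "open S" "x \<in> S"
  shows "matrix (hderiv f x) *v v = hderiv f x v"
proof (rule matrix_works)
  have "linear (hderiv f x)" using has_derivative_linear[OF has_derivative_hderiv[OF assms]] .
  then show "Vector_Spaces.linear (*s) (*s) (hderiv f x)"
    by (simp add: Vector_Spaces.linear_iff linear_add hderiv_smult[OF assms] vec.vector_space_axioms)
qed

lemma slice_hol_hderiv:
  assumes "holomorphic_map_on f S" "open S"
  shows "slice_hol (\<lambda>x. hderiv f x v $ i) S"
  using assms by (simp add: hderiv_def holomorphic_map_on_iff_slice_hol slice_hol_dir_deriv)

lemma slice_hol_jacobian:
  assumes "holomorphic_map_on f S" "open S"
  shows "slice_hol (jacobian f) S"
  unfolding jacobian_def[abs_def] det_def matrix_def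
  using assms by (simp, intro slice_hol_sum slice_hol_mult slice_hol_const slice_hol_prod slice_hol_hderiv)

lemma jacobian_nonzero_iff:
  assumes "holomorphic_map_on f S" "open S" "x \<in> S"
  shows "jacobian f x \<noteq> 0 \<longleftrightarrow> inj (hderiv f x)"
proof -
  have "((*v) (matrix (hderiv f x))) = hderiv f x" using hderiv_matrix[OF assms] by auto
  then show ?thesis
    using matrix_left_invertible_injective[of "matrix (hderiv f x)"] invertible_left_inverse[of "matrix (hderiv f x)"]
      invertible_det_nz[of "matrix (hderiv f x)"] by (simp add: jacobian_def)
qed

text \<open>Directional derivatives are continuous, so the real rank argument for C^1 maps applies,
  and a real-injective complex linear derivative has nonzero complex determinant. Used on small open
  sets, this says that the zero set of the Jacobian has empty interior.\<close>

lemma injective_holomorphic_regular_point: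
  assumes f: "holomorphic_map_on f S" and S: "open S" "S \<noteq> {}" and inj: "inj_on f S"
  obtains x where "x \<in> S" "jacobian f x \<noteq> 0"
proof -
  define f' where "f' x = Blinfun (hderiv f x)" for x
  have f': "blinfun_apply (f' x) = hderiv f x" if "x \<in> S" for x
    unfolding f'_def using has_derivative_hderiv[OF f S(1) that]
    by (simp add: bounded_linear_Blinfun_apply has_derivative_bounded_linear)
  have "continuous_on S (\<lambda>x. hderiv f x v)" for v
  proof -
    have "continuous_on S (\<lambda>x. \<chi> i. hderiv f x v $ i)"
      using slice_hol_hderiv[OF f S(1)] by (intro continuous_on_vec_lambda) (simp add: slice_hol_def)
    then show ?thesis by simp
  qed
  then have "continuous_on S (\<lambda>x. f' x v)" for v
    by (rule continuous_on_eq) (simp add: f')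
  then have "continuous_on S f'" by (rule continuous_on_blinfun_componentwise)
  moreover have "(f has_derivative blinfun_apply (f' x)) (at x)" if "x \<in> S" for x
    using has_derivative_hderiv[OF f S(1) that] f'[OF that] by simp
  ultimately obtain x where "x \<in> S" "inj (blinfun_apply (f' x))"
    using C1_injective_regular_point[OF S, of f f'] inj by blast
  then show ?thesis using that jacobian_nonzero_iff[OF f S(1)] f' by metis
qed

lemma has_derivative_complex_inverse:
  assumes f: "holomorphic_map_on f S" and S: "open S" and T: "open T" "y \<in> T" and gy: "g y \<in> S"
    and fg: "\<And>z. z \<in> T \<Longrightarrow> f (g z) = z" and cg: "continuous (at y) g" and J: "jacobian f (g y) \<noteq> 0"
  shows "\<exists>g'. (g has_derivative g') (at y) \<and> (\<forall>c v. g' (c *s v) = c *s g' v)"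
proof -
  define A where "A = matrix (hderiv f (g y))"
  have A: "A *v v = hderiv f (g y) v" for v unfolding A_def by (rule hderiv_matrix[OF f S gy])
  obtain B where B: "B ** A = mat 1"
    using J invertible_det_nz[of A] invertible_left_inverse[of A] by (auto simp: jacobian_def A_def)
  have "linear ((*v) B)" by (rule matrix_vector_mul_linear)
  then have bl: "bounded_linear ((*v) B)" by (simp add: linear_conv_bounded_linear)
  have "(g has_derivative (*v) B) (at y)"
  proof (rule has_derivative_inverse_basic[OF has_derivative_hderiv[OF f S gy] bl _ cg T fg])
    show "(*v) B \<circ> hderiv f (g y) = id"
      by (rule ext) (simp add: A[symmetric] matrix_vector_mul_assoc B)
  qed
  moreover have "B *v (c *s v) = c *s (B *v v)" for c v
    by (simp add: vector_scalar_commute)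
  ultimately show ?thesis by blast
qed

text \<open>The inverse is continuous by invariance of domain and holomorphic off the zero set of the
  continuous function \<open>jacobian f \<circ> g\<close>, so Rado's theorem applies on every complex line that is not
  contained in this zero set; the remaining lines are limits of such lines.\<close>

theorem holomorphic_inverse:
  fixes f :: "complex ^ 'n \<Rightarrow> complex ^ 'n"
  assumes f: "holomorphic_map_on f S" and S: "open S" and gf: "\<And>x. x \<in> S \<Longrightarrow> g (f x) = x"
  shows "open (f ` S)" "holomorphic_map_on g (f ` S)"
proof -
  have cf: "continuous_on S f" using f by (rule holomorphic_map_on_continuous)
  have inj: "inj_on f S" using gf by (rule inj_on_inverseI)
  define T where "T = f ` S"
  have T: "open T" unfolding T_def by (rule invariance_of_domain[OF cf S inj])
  then show "open (f ` S)" by (simp add: T_def)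
  have cg: "continuous_on T g" unfolding T_def
    by (rule continuous_on_inverse_open[OF S cf]) (use gf in auto)
  have gS: "g y \<in> S" and fg: "f (g y) = y" if "y \<in> T" for y using that gf by (auto simp: T_def)
  define h where "h y = jacobian f (g y)" for y
  define T0 where "T0 = {y \<in> T. h y \<noteq> 0}"
  have J: "slice_hol (jacobian f) S" by (rule slice_hol_jacobian[OF f S])
  have ch: "continuous_on T h" unfolding h_def
    by (rule continuous_on_compose2[OF _ cg]) (use J gS in \<open>auto simp: slice_hol_def\<close>)
  have oT0: "open T0"
  proof -
    have "open (T \<inter> h -` (- {0}))" using ch T by (intro continuous_open_preimage) auto
    moreover have "T \<inter> h -` (- {0}) = T0" by (auto simp: T0_def)
    ultimately show ?thesis by simp
  qed
  have T0T: "T0 \<subseteq> T" by (auto simp: T0_def)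
  have dense: "\<exists>y\<in>W. y \<in> T0" if W: "open W" "y0 \<in> W" "y0 \<in> T" for W y0
  proof -
    have "open (S \<inter> f -` W)" using cf S W(1) by (intro continuous_open_preimage) auto
    moreover have "g y0 \<in> S \<inter> f -` W" using W gS fg by auto
    moreover have "inj_on f (S \<inter> f -` W)" using inj by (rule inj_on_subset) auto
    moreover have "holomorphic_map_on f (S \<inter> f -` W)" using f by (rule holomorphic_map_on_subset) auto
    ultimately obtain x where "x \<in> S \<inter> f -` W" "jacobian f x \<noteq> 0"
      using injective_holomorphic_regular_point[of f "S \<inter> f -` W"] by blast
    then show ?thesis by (intro bexI[of _ "f x"]) (auto simp: T0_def T_def h_def gf)
  qed
  have g': "\<exists>g'. (g has_derivative g') (at y) \<and> (\<forall>c v. g' (c *s v) = c *s g' v)" if y: "y \<in> T0" for y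
  proof (rule has_derivative_complex_inverse[OF f S T])
    show "continuous (at y) g" using cg T T0T y continuous_on_eq_continuous_at by blast
  qed (use y gS fg in \<open>auto simp: T0_def h_def\<close>)
  then have holg: "holomorphic_map_on g T0" unfolding holomorphic_map_on_def by blast
  then have sg: "slice_hol (\<lambda>y. g y $ i) T0" for i using holomorphic_map_on_iff_slice_hol[OF oT0] by blast
  have sh: "slice_hol h T0"
  proof (rule slice_holI[OF oT0])
    fix y assume y: "y \<in> T0"
    obtain g' where g1: "(g has_derivative g') (at y)" "\<forall>c v. g' (c *s v) = c *s g' v" using g'[OF y] by blast
    have gy: "g y \<in> S" using y T0T gS by blast
    have "(h has_derivative (dir_deriv (jacobian f) (g y) \<circ> g')) (at y)"
      using diff_chain_at[OF g1(1) slice_hol_has_derivative[OF J S gy]] by (simp add: h_def[abs_def] o_def)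
    then show "\<exists>u'. (h has_derivative u') (at y) \<and> (\<forall>c v. u' (c *s v) = c * u' v)"
      using g1(2) dir_deriv_smult[OF J gy] by (intro exI[of _ "dir_deriv (jacobian f) (g y) \<circ> g'"]) simp
  qed
  have disc: "(\<lambda>t. g (w + t *s v) $ i) holomorphic_on ball 0 1"
    if w: "w \<in> T0" and T: "\<And>t. t \<in> cball 0 1 \<Longrightarrow> w + t *s v \<in> T" for w v i
  proof -
    define \<Omega> where "\<Omega> = {t \<in> ball 0 1. h (w + t *s v) \<noteq> 0}"
    have cl: "continuous_on (cball 0 1) (\<lambda>t::complex. w + t *s v)" by (intro continuous_intros)
    have "open ({t \<in> ball 0 1. w + t *s v \<in> T0})"
    proof -
      have "continuous_on (ball 0 1) (\<lambda>t::complex. w + t *s v)" by (intro continuous_intros)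
      then have "open (ball 0 1 \<inter> (\<lambda>t::complex. w + t *s v) -` T0)" using oT0 by (intro continuous_open_preimage) auto
      then show ?thesis by (simp add: vimage_def Int_def)
    qed
    moreover have "{t \<in> ball 0 1. w + t *s v \<in> T0} = \<Omega>" using T by (auto simp: \<Omega>_def T0_def)
    ultimately have o: "open \<Omega>" and inT0: "\<And>t. t \<in> \<Omega> \<Longrightarrow> w + t *s v \<in> T0" by auto
    interpret rado "\<lambda>t. h (w + t *s v)" \<Omega>
    proof
      show "continuous_on (cball 0 1) (\<lambda>t. h (w + t *s v))"
        by (rule continuous_on_compose2[OF ch cl]) (use T in auto)
      show "(\<lambda>t. h (w + t *s v)) holomorphic_on \<Omega>" by (rule slice_hol_line[OF sh o inT0])
      have "0 \<in> \<Omega>" using w by (simp add: \<Omega>_def T0_def)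
      then show "\<Omega> \<noteq> {}" by blast
    qed (rule \<Omega>_def)
    show ?thesis
    proof (rule rado)
      have "continuous_on (cball 0 1) (\<lambda>t. g (w + t *s v))"
        by (rule continuous_on_compose2[OF cg cl]) (use T in auto)
      then show "continuous_on (cball 0 1) (\<lambda>t. g (w + t *s v) $ i)" by (rule continuous_on_component)
      show "(\<lambda>t. g (w + t *s v) $ i) holomorphic_on \<Omega>" by (rule slice_hol_line[OF sg o inT0])
    qed
  qed
  have "slice_hol (\<lambda>y. g y $ i) T" for i
    unfolding slice_hol_def
  proof (intro conjI ballI)
    show "continuous_on T (\<lambda>y. g y $ i)" using cg by (rule continuous_on_component)
    fix w assume w: "w \<in> T"
    obtain e where e: "e > 0" "cball w e \<subseteq> T" using T w open_contains_cball by blast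
    \<comment> \<open>One \<open>r\<close> is spent on moving the centre from \<open>w\<close> to
      \<open>x n\<close>, the other on the disc itself.\<close>
    define r where "r = e / 2"
    have r: "r > 0" "cball w (2 * r) \<subseteq> T" using e by (auto simp: r_def)
    have "\<forall>n. \<exists>y. y \<in> ball w (r / real (Suc n)) \<and> y \<in> T0"
      using dense[OF open_ball _ w] r(1) by (metis centre_in_ball divide_pos_pos of_nat_0_less_iff zero_less_Suc)
    from choice[OF this] obtain x where x: "\<And>n. x n \<in> ball w (r / real (Suc n))" "\<And>n. x n \<in> T0" by blast
    have xr: "dist w (x n) < r" for n
    proof -
      have "r / real (Suc n) \<le> r / 1" using r(1) by (intro divide_left_mono) auto
      then show ?thesis using x(1)[of n] by simp
    qed
    have xw: "x \<longlonglongrightarrow> w"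
    proof (rule metric_LIMSEQ_I)
      fix d :: real assume "d > 0"
      then obtain N where N: "r / d < real N" using reals_Archimedean2 by blast
      have "dist (x n) w < d" if "n \<ge> N" for n
      proof -
        have "r < d * real (Suc n)" using N that \<open>d > 0\<close> by (simp add: pos_divide_less_eq mult.commute)
            (smt (verit) mult_left_mono of_nat_mono)
        then have "r / real (Suc n) < d" by (simp add: pos_divide_less_eq)
        then show ?thesis using x(1)[of n] by (simp add: dist_commute)
      qed
      then show "\<exists>no. \<forall>n\<ge>no. dist (x n) w < d" by blast
    qed
    have "(\<lambda>t. g (w + t *s v) $ i) holomorphic_on ball 0 1" if v: "norm v < r" for v
    proof (rule holomorphic_uniform_sequence[OF open_ball])
      have tv: "norm (t *s v) \<le> norm v" if "t \<in> cball 0 1" for t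
        using that mult_right_mono[of "cmod t" 1 "norm v"] by (simp add: norm_smult)
      have in2: "y + t *s v \<in> cball w (2 * r)" if "dist w y < r" "t \<in> cball 0 1" for t y
        using tv[OF that(2)] v that(1) dist_triangle[of w "y + t *s v" y] by (simp add: dist_norm)
      show "(\<lambda>t. g (x n + t *s v) $ i) holomorphic_on ball 0 1" for n
        by (rule disc[OF x(2)]) (use in2[OF xr] r(2) in blast)
      have uc: "uniformly_continuous_on (cball w (2 * r)) g"
        by (rule compact_uniformly_continuous[OF continuous_on_subset[OF cg r(2)] compact_cball])
      fix t :: complex assume "t \<in> ball 0 1"
      then obtain d where d: "d > 0" "cball t d \<subseteq> ball 0 1"
        using open_contains_cball[of "ball (0::complex) 1"] by blast
      have "uniform_limit (cball t d) (\<lambda>n t. g (x n + t *s v) $ i) (\<lambda>t. g (w + t *s v) $ i) sequentially"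
      proof (rule uniform_limitI)
        fix \<epsilon> :: real assume "\<epsilon> > 0"
        then obtain \<delta> where \<delta>: "\<delta> > 0" "\<And>y y'. y \<in> cball w (2 * r) \<Longrightarrow> y' \<in> cball w (2 * r) \<Longrightarrow> dist y y' < \<delta> \<Longrightarrow> dist (g y) (g y') < \<epsilon>"
          using uc unfolding uniformly_continuous_on_def by (metis dist_commute)
        from xw \<delta>(1) have "\<forall>\<^sub>F n in sequentially. dist (x n) w < \<delta>" by (rule tendstoD)
        then show "\<forall>\<^sub>F n in sequentially. \<forall>t\<in>cball t d. dist (g (x n + t *s v) $ i) (g (w + t *s v) $ i) < \<epsilon>"
        proof eventually_elim
          case (elim n)
          show ?case
          proof
            fix s assume "s \<in> cball t d"
            then have s: "s \<in> cball 0 1" using d(2) ball_subset_cball by blast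
            have "dist (g (x n + s *s v)) (g (w + s *s v)) < \<epsilon>"
              by (rule \<delta>(2)[OF in2[OF xr s] in2[OF _ s]]) (use elim r(1) in \<open>simp_all add: dist_norm\<close>)
            then show "dist (g (x n + s *s v) $ i) (g (w + s *s v) $ i) < \<epsilon>"
              using dist_vec_nth_le[of "g (x n + s *s v)" i "g (w + s *s v)"] by linarith
          qed
        qed
      qed
      then show "\<exists>d>0. cball t d \<subseteq> ball 0 1 \<and> uniform_limit (cball t d) (\<lambda>n t. g (x n + t *s v) $ i) (\<lambda>t. g (w + t *s v) $ i) sequentially"
        using d by blast
    qed
    with r(1) show "\<exists>r>0. \<forall>v. norm v < r \<longrightarrow> (\<lambda>t. g (w + t *s v) $ i) holomorphic_on ball 0 1"
      by (intro exI[of _ r]) simp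
  qed
  then show "holomorphic_map_on g (f ` S)"
    unfolding T_def[symmetric] holomorphic_map_on_iff_slice_hol[OF T] by (rule allI)
qed

section \<open>The Hermitian form and the automorphisms of the ball\<close>

definition herm :: "complex ^ 'n \<Rightarrow> complex ^ 'n \<Rightarrow> complex" where
  "herm x y = (\<Sum>i\<in>UNIV. x $ i * cnj (y $ i))"

lemma herm_self: "herm x x = of_real (norm x ^ 2)"
  by (simp add: herm_def norm_vec_def L2_set_def sum_nonneg complex_norm_square[symmetric])

lemma herm_diff: "herm (x - y) z = herm x z - herm y z"
  by (simp add: herm_def algebra_simps sum_subtractf)

lemma herm_diff_right: "herm z (x - y) = herm z x - herm z y"
  by (simp add: herm_def algebra_simps sum_subtractf)

lemma herm_smult: "herm (c *s x) z = c * herm x z"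
  by (simp add: herm_def sum_distrib_left algebra_simps)

lemma herm_smult_right: "herm z (c *s x) = cnj c * herm z x"
  by (simp add: herm_def sum_distrib_left algebra_simps)

lemma herm_commute: "herm y x = cnj (herm x y)"
  by (simp add: herm_def mult.commute)

lemma norm_herm_le: "cmod (herm x y) \<le> norm x * norm y"
proof -
  have "cmod (herm x y) \<le> (\<Sum>i\<in>UNIV. \<bar>cmod (x $ i)\<bar> * \<bar>cmod (y $ i)\<bar>)"
    unfolding herm_def by (rule order_trans[OF norm_sum]) (simp add: norm_mult)
  also have "\<dots> \<le> L2_set (\<lambda>i. cmod (x $ i)) UNIV * L2_set (\<lambda>i. cmod (y $ i)) UNIV"
    by (rule L2_set_mult_ineq)
  finally show ?thesis by (simp add: norm_vec_def)
qed

lemma slice_hol_herm: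
  assumes "open S" "holomorphic_map_on G S"
  shows "slice_hol (\<lambda>w. herm (G w) a) S"
  unfolding herm_def using assms
  by (intro slice_hol_sum slice_hol_mult slice_hol_const) (simp_all add: holomorphic_map_on_iff_slice_hol)

text \<open>The standard involution of the ball exchanging 0 and \<open>a\<close>, usually written
  (a - P z - s Q z) / (1 - <z, a>) with P the orthogonal projection to the line of \<open>a\<close>
  and Q = 1 - P. Since 1 - s^2 = |a|^2, the coefficient (1 - s) / |a|^2 of <z, a> a equals 1 / (1 +
  s), which avoids a case distinction at \<open>a = 0\<close>.\<close>

definition ball_aut :: "complex ^ 'n \<Rightarrow> complex ^ 'n \<Rightarrow> complex ^ 'n" where
  "ball_aut a z = (let s = complex_of_real (sqrt (1 - (norm a)\<^sup>2)) in
     inverse (1 - herm z a) *s (a - s *s z - (herm z a * inverse (1 + s)) *s a))"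

context
  fixes a :: "complex ^ 'n" and s k :: complex
  assumes a: "norm a < 1"
  defines "s \<equiv> complex_of_real (sqrt (1 - (norm a)\<^sup>2))" and "k \<equiv> inverse (1 + s)"
begin

lemma ball_aut_s_squared: "s * s = 1 - of_real ((norm a)\<^sup>2)"
proof -
  have "(norm a)\<^sup>2 \<le> 1" using a by (simp add: power_le_one)
  then have "sqrt (1 - (norm a)\<^sup>2) * sqrt (1 - (norm a)\<^sup>2) = 1 - (norm a)\<^sup>2" by simp
  then show ?thesis unfolding s_def by (metis of_real_1 of_real_diff of_real_mult)
qed

lemma ball_aut_k_inverse: "k * (1 + s) = 1"
proof -
  have "0 \<le> sqrt (1 - (norm a)\<^sup>2)" using a by (simp add: power_le_one)
  then have "1 + sqrt (1 - (norm a)\<^sup>2) \<noteq> 0" by linarith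
  then have "1 + s \<noteq> 0" unfolding s_def by (metis of_real_1 of_real_add of_real_eq_0_iff)
  then show ?thesis by (simp add: k_def)
qed

lemma ball_aut_eq: "ball_aut a z = inverse (1 - herm z a) *s (a - s *s z - (herm z a * k) *s a)"
  by (simp add: ball_aut_def Let_def s_def k_def)

lemma herm_lt_1: "norm z < 1 \<Longrightarrow> cmod (herm z a) < 1"
  using norm_herm_le[of z a] a mult_strict_mono'[of "norm z" 1 "norm a" 1] by simp

lemma herm_ne_1: "norm z < 1 \<Longrightarrow> 1 - herm z a \<noteq> 0"
  using herm_lt_1[of z] by auto

lemma herm_ball_aut:
  "herm (ball_aut a z) a = inverse (1 - herm z a) * (1 - s * s - herm z a)"
proof -
  have "herm (a - s *s z - (herm z a * k) *s a) a = of_real ((norm a)\<^sup>2) - s * herm z a - herm z a * k * of_real ((norm a)\<^sup>2)"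
    by (simp add: herm_diff herm_smult herm_self)
  also have "\<dots> = 1 - s * s - herm z a" using ball_aut_s_squared ball_aut_k_inverse by algebra
  finally show ?thesis by (simp only: ball_aut_eq herm_smult)
qed

text \<open>The algebra is the identity 1 - |ball_aut a z|^2 = (1 - |a|^2) (1 - |z|^2) / |1 - <z,
  a>|^2, whose right-hand side is positive.\<close>

lemma norm_ball_aut:
  assumes z: "norm z < 1"
  shows "norm (ball_aut a z) < 1"
proof -
  define h where "h = herm z a"
  define N where "N = a - s *s z - (h * k) *s a"
  have cs: "cnj s = s" by (simp add: s_def)
  have ck: "cnj k = k" by (simp add: k_def s_def)
  have haz: "herm a z = cnj h" unfolding h_def by (rule herm_commute)
  have "of_real ((norm N)\<^sup>2) = herm N N" by (simp add: herm_self)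
  also have "\<dots> = of_real ((norm a)\<^sup>2) - s * cnj h - cnj h * k * of_real ((norm a)\<^sup>2)
      - s * (h - s * of_real ((norm z)\<^sup>2) - cnj h * k * h)
      - h * k * (of_real ((norm a)\<^sup>2) - s * cnj h - cnj h * k * of_real ((norm a)\<^sup>2))"
    unfolding N_def herm_diff herm_diff_right herm_smult herm_smult_right
    by (simp only: herm_self haz h_def[symmetric] complex_cnj_mult cs ck) (simp only: algebra_simps)
  also have "\<dots> = (1 - h) * (1 - cnj h) - s * s * (1 - of_real ((norm z)\<^sup>2))"
    using ball_aut_s_squared ball_aut_k_inverse by algebra
  finally have "complex_of_real ((norm N)\<^sup>2) = (1 - h) * cnj (1 - h) - s * s * (1 - of_real ((norm z)\<^sup>2))" by simp
  also have "\<dots> = of_real ((cmod (1 - h))\<^sup>2 - (1 - (norm a)\<^sup>2) * (1 - (norm z)\<^sup>2))"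
  proof -
    have "(1 - h) * cnj (1 - h) = of_real ((cmod (1 - h))\<^sup>2)" by (simp only: complex_norm_square)
    then show ?thesis unfolding ball_aut_s_squared by simp
  qed
  finally have "(norm N)\<^sup>2 = (cmod (1 - h))\<^sup>2 - (1 - (norm a)\<^sup>2) * (1 - (norm z)\<^sup>2)"
    unfolding of_real_eq_iff .
  moreover have "(norm a)\<^sup>2 < 1" "(norm z)\<^sup>2 < 1" using a z by (simp_all add: abs_square_less_1)
  ultimately have "(norm N)\<^sup>2 < (cmod (1 - h))\<^sup>2" by simp
  then have "norm N < cmod (1 - h)" by (rule power_less_imp_less_base) simp
  moreover have "norm (ball_aut a z) = norm N / cmod (1 - h)"
    unfolding ball_aut_eq norm_smult N_def h_def norm_inverse by (simp add: divide_inverse mult.commute)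
  ultimately show ?thesis using herm_ne_1[OF z] by (simp add: h_def)
qed

lemma ball_aut_involution:
  assumes z: "norm z < 1"
  shows "ball_aut a (ball_aut a z) = z"
proof -
  define p where "p = inverse (1 - herm z a)"
  define p' where "p' = inverse (1 - herm (ball_aut a z) a)"
  have p: "p * (1 - herm z a) = 1" using herm_ne_1[OF z] by (simp add: p_def)
  have p': "p' * (1 - herm (ball_aut a z) a) = 1" using herm_ne_1[OF norm_ball_aut[OF z]] by (simp add: p'_def)
  have h: "herm (ball_aut a z) a = p * (1 - s * s - herm z a)" by (simp add: herm_ball_aut p_def)
  \<comment> \<open>The two denominators \<open>1 - herm z a\<close> and
    \<open>1 - herm (ball_aut a z) a\<close> multiply to \<open>s * s\<close>.\<close>
  have pp: "p' * p * s * s = 1"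
    using p p' unfolding h by algebra
  have "ball_aut a (ball_aut a z) $ i = z $ i" for i
  proof -
    have 1: "ball_aut a z $ i = p * (a $ i - s * z $ i - herm z a * k * a $ i)"
      by (simp only: ball_aut_eq p_def vector_smult_component vector_minus_component)
    have "ball_aut a (ball_aut a z) $ i = p' * (a $ i - s * ball_aut a z $ i - herm (ball_aut a z) a * k * a $ i)"
      by (simp only: ball_aut_eq[of "ball_aut a z"] p'_def vector_smult_component vector_minus_component)
    also have "\<dots> = z $ i" unfolding 1 h using p pp ball_aut_k_inverse by algebra
    finally show ?thesis .
  qed
  then show ?thesis by (simp add: vec_eq_iff)
qed

lemma holomorphic_ball_aut: "holomorphic_map_on (ball_aut a) (ball 0 1)"
proof -
  have h: "slice_hol (\<lambda>z. herm z a) (ball 0 1)"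
    by (rule slice_hol_herm[OF open_ball holomorphic_map_on_ident])
  have "slice_hol (\<lambda>z. inverse (1 + (-1) * herm z a) * (a $ i + (- s) * z $ i + herm z a * (- k * a $ i))) (ball 0 1)" for i
    by (intro slice_hol_mult slice_hol_add slice_hol_const slice_hol_inverse slice_hol_nth open_ball h)
      (use herm_ne_1 in auto)
  moreover have "ball_aut a z $ i = inverse (1 + (-1) * herm z a) * (a $ i + (- s) * z $ i + herm z a * (- k * a $ i))" for z i
    by (simp add: ball_aut_eq algebra_simps)
  ultimately show ?thesis unfolding holomorphic_map_on_iff_slice_hol[OF open_ball] by simp
qed

end

lemma ball_aut_zero: "ball_aut a 0 = a"
  by (simp add: ball_aut_def herm_def)

section \<open>Exhaustion by images of the ball\<close>

lemma dist_add_right: "dist a (a + b) = norm (b :: 'a::real_normed_vector)"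
  by (simp add: dist_norm)

text \<open>If \<open>G w1\<close> were a unit vector, the scalar function
  \<open>herm (G w) (G w1)\<close> would have modulus at most 1 and value 1 at \<open>w1\<close>. By
  the maximum principle on complex lines the set where it equals 1 is clopen, so it equals 1 at
  \<open>z0\<close>, against Cauchy-Schwarz and \<open>norm (G z0) < 1\<close>.\<close>

lemma holomorphic_map_into_ball:
  assumes S: "open S" "connected S" and G: "holomorphic_map_on G S"
    and le: "\<And>w. w \<in> S \<Longrightarrow> norm (G w) \<le> 1" and z0: "z0 \<in> S" "norm (G z0) < 1" and w1: "w1 \<in> S"
  shows "norm (G w1) < 1"
proof (rule ccontr)
  assume "\<not> norm (G w1) < 1"
  then have n1: "norm (G w1) = 1" using le[OF w1] by simp
  define u where "u w = herm (G w) (G w1)" for w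
  have u: "slice_hol u S" unfolding u_def by (rule slice_hol_herm[OF S(1) G])
  have ule: "cmod (u w) \<le> 1" if "w \<in> S" for w
    using norm_herm_le[of "G w" "G w1"] le[OF that] n1 by (simp add: u_def)
  have u1: "u w1 = 1" by (simp add: u_def herm_self n1)
  define E where "E = {w \<in> S. u w = 1}"
  have cu: "continuous_on S u" using u by (simp add: slice_hol_def)
  have "closedin (top_of_set S) E" unfolding E_def
    using continuous_closedin_preimage_constant[OF cu, of 1] by simp
  moreover have "openin (top_of_set S) E"
  proof -
    have "open E" unfolding open_contains_ball
    proof
      fix w assume w: "w \<in> E"
      then obtain r where r: "r > 0" "ball w r \<subseteq> S"
        using S(1) open_contains_ball[of S] unfolding E_def by blast
      have "y \<in> E" if y: "y \<in> ball w r" for y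
      proof (cases "y = w")
        case False
        define \<rho> where "\<rho> = r / norm (y - w)"
        have n0: "norm (y - w) > 0" using False by simp
        have \<rho>: "\<rho> > 1" using y n0 by (simp add: \<rho>_def dist_norm norm_minus_commute)
        have inS: "w + t *s (y - w) \<in> S" if "t \<in> ball 0 \<rho>" for t
        proof -
          have "cmod t * norm (y - w) < r" using that n0 by (simp add: \<rho>_def pos_less_divide_eq)
          then have "w + t *s (y - w) \<in> ball w r" by (simp only: mem_ball dist_add_right norm_smult)
          then show ?thesis using r(2) by blast
        qed
        have hol: "(\<lambda>t. u (w + t *s (y - w))) holomorphic_on ball 0 \<rho>"
          by (rule slice_hol_line[OF u open_ball inS])
        have "(\<lambda>t. u (w + t *s (y - w))) constant_on ball 0 \<rho>"
          by (rule maximum_modulus_principle[OF hol open_ball connected_ball open_ball subset_refl, of 0])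
            (use \<rho> ule inS w in \<open>auto simp: E_def\<close>)
        then obtain c where c: "\<And>t. t \<in> ball 0 \<rho> \<Longrightarrow> u (w + t *s (y - w)) = c" unfolding constant_on_def by blast
        have "u y = u w" using c[of 0] c[of 1] \<rho> by simp
        then show ?thesis using w r(2) y by (auto simp: E_def)
      qed (use w in simp)
      then show "\<exists>e>0. ball w e \<subseteq> E" using r(1) by blast
    qed
    then show ?thesis by (intro open_subset) (auto simp: E_def)
  qed
  moreover have "E \<noteq> {}" using w1 u1 by (auto simp: E_def)
  ultimately have "E = S"
    using connected_clopen[THEN iffD1, OF S(2), rule_format, of E] by blast
  then have "u z0 = 1" using z0 by (auto simp: E_def)
  moreover have "cmod (u z0) < 1"
    using norm_herm_le[of "G z0" "G w1"] n1 z0(2) by (simp add: u_def)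
  ultimately show False by simp
qed

text \<open>Identity theorem on the complex line through 0 and \<open>x\<close>, whose part in the
  ball is a disc of radius \<open>1 / norm x > 1\<close> in the parameter.\<close>

lemma holomorphic_map_ball_identity:
  fixes \<Phi> :: "complex ^ 'n \<Rightarrow> complex ^ 'n"
  assumes \<Phi>: "holomorphic_map_on \<Phi> (ball 0 1)" and e: "e > 0" "\<And>x. x \<in> ball 0 e \<Longrightarrow> \<Phi> x = x"
    and x: "x \<in> ball 0 1"
  shows "\<Phi> x = x"
proof (cases "x = 0")
  case False
  then have n0: "norm x > 0" by simp
  define \<rho> where "\<rho> = 1 / norm x"
  have \<rho>: "\<rho> > 1" using x n0 by (simp add: \<rho>_def)
  define s where "s = min \<rho> (e / norm x)"
  have s: "s > 0" "s \<le> \<rho>" "s * norm x \<le> e" using \<rho> e n0 by (auto simp: s_def min_def field_simps)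
  have "\<Phi> x $ i = x $ i" for i
  proof -
    have u: "slice_hol (\<lambda>z. \<Phi> z $ i) (ball 0 1)" using \<Phi> by (simp add: holomorphic_map_on_iff_slice_hol)
    have "(\<lambda>t. \<Phi> (0 + t *s x) $ i) holomorphic_on ball 0 \<rho>"
      by (rule slice_hol_line[OF u open_ball]) (use n0 in \<open>simp add: norm_smult \<rho>_def pos_less_divide_eq\<close>)
    then have hol: "(\<lambda>t. \<Phi> (t *s x) $ i) holomorphic_on ball 0 \<rho>" by simp
    have "\<Phi> (1 *s x) $ i = 1 * x $ i"
    proof (rule analytic_continuation_open[where s = "ball 0 s" and s' = "ball 0 \<rho>" and f = "\<lambda>t. \<Phi> (t *s x) $ i" and g = "\<lambda>t. t * x $ i"])
      show "\<Phi> (t *s x) $ i = t * x $ i" if "t \<in> ball 0 s" for t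
      proof -
        have "cmod t * norm x < s * norm x" using that n0 by simp
        then have "t *s x \<in> ball 0 e" using s(3) by (simp add: norm_smult)
        then show ?thesis using e(2) by simp
      qed
    qed (use s \<rho> hol in \<open>auto intro!: holomorphic_intros\<close>)
    then show ?thesis by simp
  qed
  then show ?thesis by (simp add: vec_eq_iff)
qed (use e in simp)

lemma uniform_limit_subseq:
  assumes "uniform_limit K f g sequentially" "strict_mono (s :: nat \<Rightarrow> nat)"
  shows "uniform_limit K (\<lambda>n. f (s n)) g sequentially"
  using filterlim_compose[OF assms(1) filterlim_subseq[OF assms(2)]] .

text \<open>A priori \<open>Gl\<close> could reach the unit sphere and \<open>Fl\<close> the
  frontier of \<open>D\<close>. \<open>holomorphic_map_into_ball\<close> excludes the former, so
  \<open>Fl (Gl w) = w\<close> on \<open>D\<close>. The reverse identity is available only where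
  \<open>Fl x \<in> D\<close>, which includes a neighbourhood of 0; it is spread over the ball with
  the help of the maps \<open>Gl \<circ> F k\<close>.\<close>

theorem exhaustion_biholomorphic:
  fixes D :: "(complex ^ 'n) set" and F :: "nat \<Rightarrow> complex ^ 'n \<Rightarrow> complex ^ 'n"
  assumes D: "open D" "connected D" "bounded D" "z0 \<in> D"
    and hol: "\<And>k. holomorphic_map_on (F k) (ball 0 1)" and inj: "\<And>k. inj_on (F k) (ball 0 1)"
    and sub: "\<And>k. F k ` ball 0 1 \<subseteq> D" and F0: "\<And>k. F k 0 = z0"
    and ex: "\<And>w. w \<in> D \<Longrightarrow> \<exists>r>0. \<forall>\<^sub>F k in sequentially. ball w r \<subseteq> F k ` ball 0 1"
  shows "biholomorphic D (ball (0 :: complex ^ 'n) 1)"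
proof -
  let ?B = "ball (0 :: complex ^ 'n) 1"
  obtain M where M: "M > 0" "\<And>x. x \<in> D \<Longrightarrow> norm x \<le> M" using D(3) unfolding bounded_pos by blast
  \<comment> \<open>Extension by 0 makes both sequences bounded on the whole space, as
    \<open>montel\<close> asks; \<open>G k\<close> inverts \<open>F k\<close> only on its
    image.\<close>
  define F' where "F' k x = (if x \<in> ?B then F k x else 0)" for k x
  define G where "G k y = (if y \<in> F k ` ?B then inv_into ?B (F k) y else 0)" for k y
  have GF: "G k (F k x) = x" if "x \<in> ?B" for k x
    using that inv_into_f_f[OF inj that] by (auto simp: G_def)
  have FG: "F k (G k y) = y" "G k y \<in> ?B" if "y \<in> F k ` ?B" for k y
    using that GF by auto
  have holG: "holomorphic_map_on (G k) (F k ` ?B)" for k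
    by (rule holomorphic_inverse(2)[OF hol open_ball], rule GF, assumption)
  have FD: "F k x \<in> D" if "x \<in> ?B" for k x using sub that by blast
  have F'M: "norm (F' k x) \<le> M" for k x using M(1) M(2)[OF FD, of x k] by (simp add: F'_def)
  have G1: "norm (G k y) \<le> 1" for k y using FG(2)[of y k] by (cases "y \<in> F k ` ?B") (auto simp: G_def)
  have holF': "holomorphic_map_on (F' k) ?B" for k
    by (rule holomorphic_map_on_cong[OF open_ball _ hol]) (simp add: F'_def)
  have "\<exists>r>0. \<forall>\<^sub>F n in sequentially. holomorphic_map_on (F' n) (ball x r)" if x: "x \<in> ?B" for x
  proof -
    obtain r where "r > 0" "ball x r \<subseteq> ?B" using x open_contains_ball[of ?B] open_ball by blast
    then show ?thesis using holomorphic_map_on_subset[OF holF'] by (intro exI[of _ r]) simp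
  qed
  from montel[OF open_ball F'M this] obtain s1 Fl where s1: "strict_mono s1" and holFl: "holomorphic_map_on Fl ?B"
    and limF: "\<And>K. compact K \<Longrightarrow> K \<subseteq> ?B \<Longrightarrow> uniform_limit K (\<lambda>n. F' (s1 n)) Fl sequentially" by blast
  have evG: "\<exists>r>0. \<forall>\<^sub>F n in sequentially. holomorphic_map_on (G (s1 n)) (ball x r)" if x: "x \<in> D" for x
  proof -
    obtain r where r: "r > 0" "\<forall>\<^sub>F k in sequentially. ball x r \<subseteq> F k ` ?B" using ex[OF x] by blast
    from eventually_compose_filterlim[OF r(2) filterlim_subseq[OF s1]]
    have "\<forall>\<^sub>F n in sequentially. holomorphic_map_on (G (s1 n)) (ball x r)"
      by (rule eventually_mono) (rule holomorphic_map_on_subset[OF holG])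
    with r(1) show ?thesis by blast
  qed
  from montel[of D "\<lambda>n. G (s1 n)", OF D(1) G1 evG] obtain s2 Gl where s2: "strict_mono s2" and holGl: "holomorphic_map_on Gl D"
    and limG0: "\<And>K. compact K \<Longrightarrow> K \<subseteq> D \<Longrightarrow> uniform_limit K (\<lambda>n. G (s1 (s2 n))) Gl sequentially" by blast
  define s where "s n = s1 (s2 n)" for n
  have s: "strict_mono s" using s1 s2 by (simp add: s_def strict_mono_def)
  have limF: "uniform_limit K (\<lambda>n. F' (s n)) Fl sequentially" if "compact K" "K \<subseteq> ?B" for K
    unfolding s_def by (rule uniform_limit_subseq[OF limF[OF that] s2])
  have limG: "uniform_limit K (\<lambda>n. G (s n)) Gl sequentially" if "compact K" "K \<subseteq> D" for K
    unfolding s_def by (rule limG0[OF that])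
  have cF: "continuous_on ?B Fl" and cG: "continuous_on D Gl"
    using holFl holGl holomorphic_map_on_continuous by blast+
  have tF: "(\<lambda>n. F' (s n) (x n)) \<longlonglongrightarrow> Fl a" if "x \<longlonglongrightarrow> a" "a \<in> ?B" for x a
    by (rule uniform_limit_tendsto_compose[OF open_ball limF cF that])
  have tG: "(\<lambda>n. G (s n) (x n)) \<longlonglongrightarrow> Gl a" if "x \<longlonglongrightarrow> a" "a \<in> D" for x a
    by (rule uniform_limit_tendsto_compose[OF D(1) limG cG that])
  have "(\<lambda>n. G (s n) z0) \<longlonglongrightarrow> Gl z0" by (rule tG[OF tendsto_const D(4)])
  moreover have "G (s n) z0 = 0" for n using GF[of 0 "s n"] F0 by simp
  ultimately have Gz0: "Gl z0 = 0" by (simp add: LIMSEQ_const_iff)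
  have Gle: "norm (Gl w) \<le> 1" if "w \<in> D" for w
    using tendsto_norm[OF tG[OF tendsto_const that]] by (rule LIMSEQ_le_const2) (use G1 in blast)
  have GB: "Gl w \<in> ?B" if "w \<in> D" for w
    using holomorphic_map_into_ball[OF D(1,2) holGl Gle D(4) _ that] by (simp add: Gz0)
  have FGl: "Fl (Gl w) = w" if w: "w \<in> D" for w
  proof -
    obtain r where r: "r > 0" "\<forall>\<^sub>F k in sequentially. ball w r \<subseteq> F k ` ?B" using ex[OF w] by blast
    have "(\<lambda>n. F' (s n) (G (s n) w)) \<longlonglongrightarrow> Fl (Gl w)" by (rule tF[OF tG[OF tendsto_const w] GB[OF w]])
    moreover have "\<forall>\<^sub>F n in sequentially. F' (s n) (G (s n) w) = w"
      using eventually_compose_filterlim[OF r(2) filterlim_subseq[OF s]]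
    proof eventually_elim
      case (elim n)
      then have "w \<in> F (s n) ` ?B" using r(1) centre_in_ball by blast
      then show ?case using FG unfolding F'_def by presburger
    qed
    ultimately show ?thesis using tendsto_eventually LIMSEQ_unique by metis
  qed
  have GFl: "Gl (Fl x) = x" if x: "x \<in> ?B" "Fl x \<in> D" for x
  proof -
    have "(\<lambda>n. G (s n) (F' (s n) x)) \<longlonglongrightarrow> Gl (Fl x)" by (rule tG[OF tF[OF tendsto_const x(1)] x(2)])
    moreover have "G (s n) (F' (s n) x) = x" for n using GF x(1) by (simp add: F'_def)
    ultimately show ?thesis by (simp add: LIMSEQ_const_iff)
  qed
  \<comment> \<open>\<open>Gl \<circ> Fl\<close> makes sense only where \<open>Fl\<close> lands in
    \<open>D\<close>, but \<open>F (s n)\<close> always does. So \<open>H n\<close> is holomorphic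
    on the whole ball, and its limit can be compared with the identity there.\<close>
  define H where "H n x = (if x \<in> ?B then Gl (F (s n) x) else 0)" for n x
  have holH: "holomorphic_map_on (H n) ?B" for n
    by (rule holomorphic_map_on_cong[OF open_ball _ holomorphic_map_on_compose[OF hol[of "s n"] holGl sub]])
      (simp add: H_def)
  have H1: "norm (H n x) \<le> 1" for n x using Gle FD by (auto simp: H_def)
  have "\<exists>r>0. \<forall>\<^sub>F n in sequentially. holomorphic_map_on (H n) (ball x r)" if x: "x \<in> ?B" for x
  proof -
    obtain r where "r > 0" "ball x r \<subseteq> ?B" using x open_contains_ball[of ?B] open_ball by blast
    then show ?thesis using holomorphic_map_on_subset[OF holH] by (intro exI[of _ r]) simp
  qed
  from montel[OF open_ball H1 this] obtain s3 \<Phi> where s3: "strict_mono s3" and hol\<Phi>: "holomorphic_map_on \<Phi> ?B"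
    and lim\<Phi>: "\<And>K. compact K \<Longrightarrow> K \<subseteq> ?B \<Longrightarrow> uniform_limit K (\<lambda>n. H (s3 n)) \<Phi> sequentially" by blast
  have c\<Phi>: "continuous_on ?B \<Phi>" by (rule holomorphic_map_on_continuous[OF hol\<Phi>])
  have \<Phi>N: "\<Phi> x = x" if x: "x \<in> ?B" "Fl x \<in> D" for x
  proof -
    have "(\<lambda>n. H (s3 n) x) \<longlonglongrightarrow> \<Phi> x"
      by (rule uniform_limit_tendsto_compose[OF open_ball lim\<Phi> c\<Phi> tendsto_const x(1)])
    moreover have "(\<lambda>n. H (s3 n) x) \<longlonglongrightarrow> Gl (Fl x)"
    proof -
      have "isCont Gl (Fl x)" using cG D(1) x(2) continuous_on_eq_continuous_at by blast
      from isCont_tendsto_compose[OF this tF[OF tendsto_const x(1)]]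
      have "(\<lambda>n. H n x) \<longlonglongrightarrow> Gl (Fl x)" using x(1) by (simp add: H_def F'_def)
      from LIMSEQ_subseq_LIMSEQ[OF this s3] show ?thesis by (simp add: o_def)
    qed
    ultimately show ?thesis using GFl[OF x] LIMSEQ_unique by metis
  qed
  have "Fl 0 = z0" using FGl[OF D(4)] Gz0 by simp
  moreover have "open (?B \<inter> Fl -` D)" using cF D(1) by (intro continuous_open_preimage) auto
  ultimately obtain e where e: "e > 0" "ball 0 e \<subseteq> ?B \<inter> Fl -` D"
    using D(4) open_contains_ball[of "?B \<inter> Fl -` D"] by force
  have \<Phi>id: "\<Phi> x = x" if "x \<in> ?B" for x
    by (rule holomorphic_map_ball_identity[OF hol\<Phi> e(1) \<Phi>N that]) (use e(2) in auto)
  text \<open>The maps \<open>Gl \<circ> F k\<close> converge to the identity, so their images eventually contain any given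
    point of the ball by Brouwer's theorem.\<close>
  have surj: "\<exists>w\<in>D. Gl w = x" if x: "x \<in> ?B" for x
  proof -
    define d where "d = (1 - norm x) / 2"
    have d: "d > 0" using x by (simp add: d_def)
    have inB: "cball x d \<subseteq> ?B"
    proof
      fix y assume "y \<in> cball x d"
      then show "y \<in> ?B" using norm_triangle_ineq[of x "y - x"] d by (simp add: dist_norm norm_minus_commute d_def)
    qed
    have "\<forall>\<^sub>F n in sequentially. \<forall>y\<in>cball x d. dist (H (s3 n) y) (\<Phi> y) < d"
      using lim\<Phi>[OF compact_cball inB] d by (simp add: uniform_limit_iff)
    then obtain n where n: "\<And>y. y \<in> cball x d \<Longrightarrow> dist (H (s3 n) y) (\<Phi> y) < d"
      using eventually_happens'[OF sequentially_bot] by blast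
    have "continuous_on (cball x d) (\<lambda>y. x - (H (s3 n) y - y))"
      by (intro continuous_intros continuous_on_subset[OF holomorphic_map_on_continuous[OF holH] inB])
    moreover have "(\<lambda>y. x - (H (s3 n) y - y)) \<in> cball x d \<rightarrow> cball x d"
    proof
      fix y assume y: "y \<in> cball x d"
      then have "\<Phi> y = y" using \<Phi>id inB by blast
      then show "x - (H (s3 n) y - y) \<in> cball x d" using n[OF y] by (simp add: dist_norm)
    qed
    ultimately obtain y where y: "y \<in> cball x d" "x - (H (s3 n) y - y) = y"
      using brouwer_ball[OF d] by blast
    then have "H (s3 n) y = x" by (simp add: algebra_simps)
    then show ?thesis using y(1) inB FD by (auto simp: H_def split: if_splits)
  qed
  \<comment> \<open>Surjectivity of \<open>Gl\<close> is what forces \<open>Fl\<close> into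
    \<open>D\<close>: for \<open>x = Gl w\<close> the value \<open>Fl x\<close> is
    \<open>w\<close>.\<close>
  have FlD: "Fl x \<in> D" if "x \<in> ?B" for x using surj[OF that] FGl by metis
  show ?thesis unfolding biholomorphic_def
  proof (rule exI[of _ Gl], rule exI[of _ Fl], intro conjI ballI)
    show "Gl ` D = ?B" using GB surj by blast
    show "Fl ` ?B = D" using FlD FGl GB by (metis image_eqI image_subsetI subsetI subset_antisym)
  qed (use holGl holFl FGl GFl FlD in auto)
qed

section \<open>The Kobayashi distance\<close>

definition chain_lengths :: "(complex ^ 'n) set \<Rightarrow> complex ^ 'n \<Rightarrow> complex ^ 'n \<Rightarrow> real set" where
  "chain_lengths D z w = {(\<Sum>i<k. poincare_dist (a i) (b i)) |k \<phi> a b x.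
            x 0 = z \<and> x k = w \<and>
            (\<forall>i<k. holomorphic_disc_in (\<phi> i) D \<and> a i \<in> ball 0 1 \<and> b i \<in> ball 0 1 \<and>
                   \<phi> i (a i) = x i \<and> \<phi> i (b i) = x (Suc i))}"

lemma kobayashi_dist_eq: "kobayashi_dist D z w = Inf (chain_lengths D z w)"
  by (simp add: kobayashi_dist_def chain_lengths_def)

lemma pseudohyperbolic_lt_1:
  assumes "a \<in> ball 0 1" "b \<in> ball 0 1"
  shows "cmod ((a - b) / (1 - cnj a * b)) < 1"
proof -
  have "cmod ((b - a) / (1 - cnj a * b)) < 1"
    using Moebius_function_norm_lt_1[of a b 0] assms by (simp add: Moebius_function_simple)
  then show ?thesis by (simp add: norm_divide norm_minus_commute)
qed

text \<open>By \<open>- ln (1 - m) \<ge> m\<close>. A linear bound is enough for comparing chain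
  lengths with the Euclidean norm.\<close>

lemma poincare_dist_ge:
  assumes "a \<in> ball 0 1" "b \<in> ball 0 1"
  shows "cmod ((a - b) / (1 - cnj a * b)) \<le> poincare_dist a b"
proof -
  define m where "m = cmod ((a - b) / (1 - cnj a * b))"
  have m: "0 \<le> m" "m < 1" using pseudohyperbolic_lt_1[OF assms] by (simp_all add: m_def)
  have "ln (1 - m) \<le> - m" using ln_le_minus_one[of "1 - m"] m by simp
  moreover have "0 \<le> ln (1 + m)" using m by simp
  moreover have "poincare_dist a b = ln (1 + m) - ln (1 - m)"
    using m by (simp add: poincare_dist_def m_def[symmetric] Let_def ln_div)
  ultimately show ?thesis by (simp add: m_def[symmetric])
qed

lemma poincare_dist_nonneg: "a \<in> ball 0 1 \<Longrightarrow> b \<in> ball 0 1 \<Longrightarrow> 0 \<le> poincare_dist a b"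
  using poincare_dist_ge[of a b] norm_ge_zero order_trans by blast

lemma chain_lengths_nonneg: "l \<in> chain_lengths D z w \<Longrightarrow> 0 \<le> l"
  unfolding chain_lengths_def by (auto intro!: sum_nonneg poincare_dist_nonneg simp del: mem_ball)

lemma bdd_below_chain_lengths: "bdd_below (chain_lengths D z w)"
  using chain_lengths_nonneg by (rule bdd_belowI)

lemma kobayashi_dist_le: "l \<in> chain_lengths D z w \<Longrightarrow> kobayashi_dist D z w \<le> l"
  unfolding kobayashi_dist_eq by (rule cInf_lower[OF _ bdd_below_chain_lengths])

lemma sum_lessThan_add: "(\<Sum>i<m + n. f i) = (\<Sum>i<m. f i) + (\<Sum>i<n. f (m + i) :: real)" for m n :: nat
  by (induction n) auto

lemma chain_lengths_append:
  assumes "l1 \<in> chain_lengths D z w" "l2 \<in> chain_lengths D w v"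
  shows "l1 + l2 \<in> chain_lengths D z v"
proof -
  obtain k1 \<phi>1 a1 b1 x1 where 1: "l1 = (\<Sum>i<k1. poincare_dist (a1 i) (b1 i))" "x1 0 = z" "x1 k1 = w"
    "\<forall>i<k1. holomorphic_disc_in (\<phi>1 i) D \<and> a1 i \<in> ball 0 1 \<and> b1 i \<in> ball 0 1 \<and> \<phi>1 i (a1 i) = x1 i \<and> \<phi>1 i (b1 i) = x1 (Suc i)"
    using assms(1) unfolding chain_lengths_def by blast
  obtain k2 \<phi>2 a2 b2 x2 where 2: "l2 = (\<Sum>i<k2. poincare_dist (a2 i) (b2 i))" "x2 0 = w" "x2 k2 = v"
    "\<forall>i<k2. holomorphic_disc_in (\<phi>2 i) D \<and> a2 i \<in> ball 0 1 \<and> b2 i \<in> ball 0 1 \<and> \<phi>2 i (a2 i) = x2 i \<and> \<phi>2 i (b2 i) = x2 (Suc i)"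
    using assms(2) unfolding chain_lengths_def by blast
  define a where "a i = (if i < k1 then a1 i else a2 (i - k1))" for i
  define b where "b i = (if i < k1 then b1 i else b2 (i - k1))" for i
  define \<phi> where "\<phi> i = (if i < k1 then \<phi>1 i else \<phi>2 (i - k1))" for i
  \<comment> \<open>At the joint the second chain takes over; the points agree there because
    \<open>x1 k1 = w = x2 0\<close>.\<close>
  define x where "x i = (if i < k1 then x1 i else x2 (i - k1))" for i
  have "l1 + l2 = (\<Sum>i<k1 + k2. poincare_dist (a i) (b i))"
    unfolding sum_lessThan_add 1(1) 2(1) by (simp add: a_def b_def)
  moreover have "x 0 = z" using 1(2,3) 2(2) by (cases "k1 = 0") (auto simp: x_def)
  moreover have "x (k1 + k2) = v" using 2(3) by (simp add: x_def)
  moreover have "\<forall>i<k1 + k2. holomorphic_disc_in (\<phi> i) D \<and> a i \<in> ball 0 1 \<and> b i \<in> ball 0 1 \<and> \<phi> i (a i) = x i \<and> \<phi> i (b i) = x (Suc i)"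
  proof (intro allI impI)
    fix i assume i: "i < k1 + k2"
    show "holomorphic_disc_in (\<phi> i) D \<and> a i \<in> ball 0 1 \<and> b i \<in> ball 0 1 \<and> \<phi> i (a i) = x i \<and> \<phi> i (b i) = x (Suc i)"
    proof (cases "i < k1")
      case True
      have "x (Suc i) = x1 (Suc i)"
        using True 1(3) 2(2) by (cases "Suc i = k1") (auto simp: x_def)
      then show ?thesis using True 1(4) by (simp add: a_def b_def \<phi>_def) (simp add: x_def)
    next
      case False
      then have "i - k1 < k2" "Suc i - k1 = Suc (i - k1)" using i by auto
      then show ?thesis using False 2(4) by (simp add: a_def b_def \<phi>_def x_def)
    qed
  qed
  ultimately show ?thesis unfolding chain_lengths_def by blast
qed

lemma chain_lengths_disc:
  assumes "holomorphic_disc_in \<phi> D" "a \<in> ball 0 1" "b \<in> ball 0 1"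
  shows "poincare_dist a b \<in> chain_lengths D (\<phi> a) (\<phi> b)"
  unfolding chain_lengths_def
  by (rule CollectI, rule exI[of _ 1], rule exI[of _ "\<lambda>_. \<phi>"], rule exI[of _ "\<lambda>_. a"], rule exI[of _ "\<lambda>_. b"],
      rule exI[of _ "\<lambda>i. if i = 0 then \<phi> a else \<phi> b"]) (use assms in auto)

text \<open>\<open>Inf\<close> of an empty set of reals carries no information, hence the
  nonemptiness hypotheses; \<open>chain_lengths_nonempty\<close> supplies them on a domain.\<close>

lemma kobayashi_dist_triangle:
  assumes "chain_lengths D z w \<noteq> {}" "chain_lengths D w v \<noteq> {}"
  shows "kobayashi_dist D z v \<le> kobayashi_dist D z w + kobayashi_dist D w v"
proof (rule field_le_epsilon)
  fix e :: real assume "e > 0"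
  then have "Inf (chain_lengths D z w) < kobayashi_dist D z w + e / 2" "Inf (chain_lengths D w v) < kobayashi_dist D w v + e / 2"
    by (simp_all add: kobayashi_dist_eq)
  then obtain l1 l2 where l: "l1 \<in> chain_lengths D z w" "l1 < kobayashi_dist D z w + e / 2"
    "l2 \<in> chain_lengths D w v" "l2 < kobayashi_dist D w v + e / 2"
    using cInf_lessD[OF assms(1)] cInf_lessD[OF assms(2)] by blast
  from kobayashi_dist_le[OF chain_lengths_append[OF l(1,3)]] l(2,4)
  show "kobayashi_dist D z v \<le> kobayashi_dist D z w + kobayashi_dist D w v + e" by simp
qed

lemma affine_disc:
  assumes "\<And>\<zeta>. \<zeta> \<in> ball 0 1 \<Longrightarrow> w + \<zeta> *s v \<in> D"
  shows "holomorphic_disc_in (\<lambda>\<zeta>. w + \<zeta> *s v) D"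
  using assms unfolding holomorphic_disc_in_def by (auto intro!: holomorphic_intros)

text \<open>An affine disc centred at \<open>w\<close> passes through \<open>y\<close> at parameter
  1/2, and \<open>poincare_dist 0 (1/2) = ln 3\<close>. What matters later is that this cost depends
  neither on \<open>r\<close> nor on \<open>y\<close>.\<close>

lemma chain_lengths_ball:
  assumes D: "ball w r \<subseteq> D" and y: "norm (y - w) < r / 2"
  shows "ln 3 \<in> chain_lengths D w y" "ln 3 \<in> chain_lengths D y w"
proof -
  define \<phi> where "\<phi> \<zeta> = w + \<zeta> *s (2 *s (y - w))" for \<zeta>
  have disc: "holomorphic_disc_in \<phi> D" unfolding \<phi>_def
  proof (rule affine_disc)
    fix \<zeta> :: complex assume "\<zeta> \<in> ball 0 1"
    then have "cmod \<zeta> * (2 * norm (y - w)) \<le> 1 * (2 * norm (y - w))" by (intro mult_right_mono) auto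
    then have "w + \<zeta> *s (2 *s (y - w)) \<in> ball w r" using y by (simp only: mem_ball dist_add_right norm_smult) simp
    then show "w + \<zeta> *s (2 *s (y - w)) \<in> D" using D by blast
  qed
  have "\<phi> 0 = w" "\<phi> (1/2) = y" by (simp_all add: \<phi>_def vec_eq_iff)
  moreover have "poincare_dist 0 (1/2) = ln 3" "poincare_dist (1/2) 0 = ln 3"
    by (simp_all add: poincare_dist_def Let_def norm_divide)
  ultimately show "ln 3 \<in> chain_lengths D w y" "ln 3 \<in> chain_lengths D y w"
    using chain_lengths_disc[OF disc, of 0 "1/2"] chain_lengths_disc[OF disc, of "1/2" 0] by simp_all
qed

text \<open>Being joined by chains in both directions is an equivalence relation whose classes are
  open by \<open>chain_lengths_ball\<close>.\<close>

lemma chain_lengths_nonempty: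
  assumes D: "open D" "connected D" and zw: "z \<in> D" "w \<in> D"
  shows "chain_lengths D z w \<noteq> {}"
proof -
  have "chain_lengths D z w \<noteq> {} \<and> chain_lengths D w z \<noteq> {}"
  proof (rule connected_equivalence_relation[OF D(2) zw])
    fix a b c
    assume "chain_lengths D a b \<noteq> {} \<and> chain_lengths D b a \<noteq> {}" "chain_lengths D b c \<noteq> {} \<and> chain_lengths D c b \<noteq> {}"
    then show "chain_lengths D a c \<noteq> {} \<and> chain_lengths D c a \<noteq> {}" using chain_lengths_append by blast
  next
    fix a assume a: "a \<in> D"
    then obtain r where r: "r > 0" "ball a r \<subseteq> D" using D(1) open_contains_ball by blast
    show "\<exists>T. openin (top_of_set D) T \<and> a \<in> T \<and> (\<forall>x\<in>T. chain_lengths D a x \<noteq> {} \<and> chain_lengths D x a \<noteq> {})"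
    proof (intro exI[of _ "ball a (r / 2)"] conjI ballI)
      show "openin (top_of_set D) (ball a (r / 2))" using r by (intro open_subset) auto
      fix x assume "x \<in> ball a (r / 2)"
      then have "norm (x - a) < r / 2" by (simp add: dist_norm norm_minus_commute)
      from chain_lengths_ball[OF r(2) this] show "chain_lengths D a x \<noteq> {}" "chain_lengths D x a \<noteq> {}" by blast+
    qed (use r in simp)
  qed blast
  then show ?thesis by blast
qed

text \<open>Schwarz's lemma for \<open>(f \<circ> T - f a) / (2 * M)\<close>, where the Moebius map
  \<open>T\<close> moves 0 to \<open>a\<close>; the 2 accounts for a difference of two values of
  \<open>f\<close>.\<close>

lemma schwarz_pick:
  assumes f: "f holomorphic_on ball 0 1" and M: "\<And>\<zeta>. \<zeta> \<in> ball 0 1 \<Longrightarrow> cmod (f \<zeta>) < M"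
    and ab: "a \<in> ball 0 1" "b \<in> ball 0 1"
  shows "cmod (f a - f b) \<le> 2 * M * cmod ((a - b) / (1 - cnj a * b))"
proof -
  have M0: "M > 0" using M[OF ab(1)] norm_ge_zero[of "f a"] by linarith
  define T where "T = Moebius_function 0 (- a)"
  have T1: "T \<zeta> \<in> ball 0 1" if "\<zeta> \<in> ball 0 1" for \<zeta>
    using Moebius_function_norm_lt_1[of "- a" \<zeta> 0] ab that by (simp add: T_def)
  have T0: "T 0 = a" by (simp add: T_def Moebius_function_of_zero)
  define \<xi> where "\<xi> = Moebius_function 0 a b"
  have \<xi>: "\<xi> \<in> ball 0 1" using Moebius_function_norm_lt_1[of a b 0] ab by (simp add: \<xi>_def)
  have T\<xi>: "T \<xi> = b" unfolding T_def \<xi>_def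
    by (rule Moebius_function_compose) (use ab in auto)
  define g where "g \<zeta> = (f (T \<zeta>) - f a) / (2 * of_real M)" for \<zeta>
  have "T holomorphic_on ball 0 1" unfolding T_def using ab by (intro Moebius_function_holomorphic) simp
  then have "(f \<circ> T) holomorphic_on ball 0 1"
    by (intro holomorphic_on_compose_gen[OF _ f]) (use T1 in auto)
  then have "g holomorphic_on ball 0 1" unfolding g_def using M0 by (auto intro!: holomorphic_intros simp: o_def)
  moreover have "g 0 = 0" by (simp add: g_def T0)
  moreover have "cmod (g \<zeta>) < 1" if "cmod \<zeta> < 1" for \<zeta>
  proof -
    have "cmod (f (T \<zeta>) - f a) < M + M"
      using norm_triangle_ineq4[of "f (T \<zeta>)" "f a"] M[OF T1] M[OF ab(1)] that by fastforce
    then show ?thesis using M0 by (simp add: g_def norm_divide norm_mult)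
  qed
  ultimately have "cmod (g \<xi>) \<le> cmod \<xi>" using \<xi> by (intro Schwarz_Lemma(1)) auto
  then have "cmod (f b - f a) \<le> 2 * M * cmod \<xi>" using M0
    by (simp add: g_def T\<xi> norm_divide norm_mult pos_divide_le_eq mult.commute)
  then show ?thesis by (simp add: \<xi>_def Moebius_function_simple norm_divide norm_minus_commute)
qed

text \<open>By \<open>schwarz_pick\<close> in each component, a disc moves points by at most a
  constant times \<open>poincare_dist\<close>, and this adds up along chains. Consequently small
  Kobayashi balls lie in small Euclidean balls.\<close>

lemma norm_le_kobayashi_dist:
  fixes D :: "(complex ^ 'n) set"
  assumes D: "open D" "connected D" and M: "\<And>x. x \<in> D \<Longrightarrow> norm x < M" and zw: "z \<in> D" "w \<in> D"
  shows "norm (z - w) \<le> real CARD('n) * (2 * M) * kobayashi_dist D z w"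
proof -
  have M0: "M > 0" using M[OF zw(1)] norm_ge_zero[of z] by linarith
  define C where "C = real CARD('n) * (2 * M)"
  have C: "C > 0" using M0 by (simp add: C_def)
  have disc: "norm (\<phi> a - \<phi> b) \<le> C * poincare_dist a b"
    if \<phi>: "holomorphic_disc_in \<phi> D" and ab: "a \<in> ball 0 1" "b \<in> ball 0 1" for \<phi> a b
  proof -
    have "norm ((\<phi> a - \<phi> b) $ i) \<le> 2 * M * poincare_dist a b" for i
    proof -
      have "cmod (\<phi> a $ i - \<phi> b $ i) \<le> 2 * M * cmod ((a - b) / (1 - cnj a * b))"
      proof (rule schwarz_pick[OF _ _ ab])
        show "(\<lambda>\<zeta>. \<phi> \<zeta> $ i) holomorphic_on ball 0 1" using \<phi> by (simp add: holomorphic_disc_in_def)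
        show "cmod (\<phi> \<zeta> $ i) < M" if "\<zeta> \<in> ball 0 1" for \<zeta>
        proof -
          have "\<phi> \<zeta> \<in> D" using \<phi> that unfolding holomorphic_disc_in_def by blast
          from M[OF this] Finite_Cartesian_Product.norm_nth_le[of "\<phi> \<zeta>" i] show ?thesis by linarith
        qed
      qed
      also have "\<dots> \<le> 2 * M * poincare_dist a b"
        by (rule mult_left_mono[OF poincare_dist_ge[OF ab]]) (use M0 in simp)
      finally show ?thesis by simp
    qed
    then have "(\<Sum>i\<in>UNIV. norm ((\<phi> a - \<phi> b) $ i)) \<le> (\<Sum>i\<in>(UNIV :: 'n set). 2 * M * poincare_dist a b)"
      by (intro sum_mono)
    also have "\<dots> = C * poincare_dist a b" by (simp add: C_def)
    finally show ?thesis using norm_le_sum_norm_nth[of "\<phi> a - \<phi> b"] by linarith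
  qed
  have "norm (z - w) / C \<le> l" if "l \<in> chain_lengths D z w" for l
  proof -
    obtain k \<phi> a b x where l: "l = (\<Sum>i<k. poincare_dist (a i) (b i))" "x 0 = z" "x k = w"
      "\<forall>i<k. holomorphic_disc_in (\<phi> i) D \<and> a i \<in> ball 0 1 \<and> b i \<in> ball 0 1 \<and> \<phi> i (a i) = x i \<and> \<phi> i (b i) = x (Suc i)"
      using \<open>l \<in> chain_lengths D z w\<close> unfolding chain_lengths_def by blast
    have "norm (x 0 - x j) \<le> C * (\<Sum>i<j. poincare_dist (a i) (b i))" if "j \<le> k" for j
      using that
    proof (induction j)
      case (Suc j)
      then have "norm (x j - x (Suc j)) \<le> C * poincare_dist (a j) (b j)"
        using disc[of "\<phi> j" "a j" "b j"] l(4) by (metis Suc_le_eq)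
      moreover have "norm (x 0 - x (Suc j)) \<le> norm (x 0 - x j) + norm (x j - x (Suc j))"
        using norm_triangle_ineq[of "x 0 - x j" "x j - x (Suc j)"] by simp
      ultimately show ?case using Suc by (simp add: distrib_left)
    qed simp
    from this[of k] show ?thesis using l C by (simp add: pos_divide_le_eq mult.commute)
  qed
  then have "norm (z - w) / C \<le> kobayashi_dist D z w"
    unfolding kobayashi_dist_eq using chain_lengths_nonempty[OF D zw] by (intro cInf_greatest) auto
  then show ?thesis using C by (simp add: pos_divide_le_eq mult.commute C_def)
qed

section \<open>Fridman's invariant\<close>

lemma kobayashi_ball_mono: "r \<le> r' \<Longrightarrow> kobayashi_ball D z r \<subseteq> kobayashi_ball D z r'"
  by (auto simp: kobayashi_ball_def)

text \<open>Keeps the infimum in \<open>fridman_h\<close> from being \<infinity> for want of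
  competitors.\<close>

lemma ball_embeddings_nonempty:
  assumes "open D" "z \<in> D"
  shows "ball_embeddings D z \<noteq> {}"
proof -
  obtain r where r: "r > 0" "ball z r \<subseteq> D" using assms open_contains_ball by blast
  define f where "f y = z + of_real r *s y" for y
  have "(f has_derivative (\<lambda>y. of_real r *s y)) (at x)" for x
  proof -
    have "bounded_linear (\<lambda>y :: complex ^ 'a. of_real r *s y)"
      unfolding scaleR_eq_smult[symmetric] by (rule bounded_linear_scaleR_right)
    from has_derivative_add[OF has_derivative_const bounded_linear_imp_has_derivative[OF this]]
    show ?thesis by (simp add: f_def[abs_def])
  qed
  then have "holomorphic_map_on f (ball 0 1)" unfolding holomorphic_map_on_def
    by (intro ballI exI[of _ "\<lambda>y. of_real r *s y"]) (simp add: mult.commute)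
  moreover have "inj_on f (ball 0 1)" using r by (auto simp: inj_on_def f_def)
  moreover have "f ` ball 0 1 \<subseteq> D"
  proof
    fix x assume "x \<in> f ` ball 0 1"
    then obtain y where y: "y \<in> ball 0 1" "x = f y" by blast
    have "\<bar>r\<bar> * norm y < r" using y(1) r(1) by simp
    then have "x \<in> ball z r" unfolding y(2) f_def mem_ball dist_add_right norm_smult norm_of_real .
    then show "x \<in> D" using r(2) by blast
  qed
  moreover have "f 0 = z" by (simp add: f_def)
  ultimately show ?thesis unfolding ball_embeddings_def by blast
qed

text \<open>The image of \<open>f\<close> is open, so it contains a Euclidean ball about
  \<open>z\<close> and, by \<open>norm_le_kobayashi_dist\<close>, a Kobayashi ball. With
  \<open>q > 0\<close> the value \<open>1 / q\<close> is finite, so \<open>fridman_e\<close> is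
  governed by its defining equation whenever \<open>fridman_h\<close> is not 0.\<close>

lemma fridman_q_pos:
  fixes D :: "(complex ^ 'n) set"
  assumes D: "open D" "connected D" "bounded D" and z: "z \<in> D" and f: "f \<in> ball_embeddings D z"
  shows "fridman_q D f z > 0"
proof -
  have fh: "holomorphic_map_on f (ball 0 1)" and fi: "inj_on f (ball 0 1)" and f0: "f 0 = z"
    using f by (auto simp: ball_embeddings_def)
  have "open (f ` ball 0 1)"
    by (rule invariance_of_domain[OF holomorphic_map_on_continuous[OF fh] open_ball fi])
  moreover have "z \<in> f ` ball 0 1" using f0 by force
  ultimately obtain \<rho> where \<rho>: "\<rho> > 0" "ball z \<rho> \<subseteq> f ` ball 0 1" using open_contains_ball by blast
  obtain M where M: "M > 0" "\<And>x. x \<in> D \<Longrightarrow> norm x \<le> M" using D(3) unfolding bounded_pos by blast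
  define C where "C = real CARD('n) * (2 * (M + 1))"
  have C: "C > 0" using M by (simp add: C_def)
  have "kobayashi_ball D z (\<rho> / C) \<subseteq> f ` ball 0 1"
  proof
    fix w assume "w \<in> kobayashi_ball D z (\<rho> / C)"
    then have w: "w \<in> D" "kobayashi_dist D z w < \<rho> / C" by (auto simp: kobayashi_ball_def)
    have "norm (z - w) \<le> C * kobayashi_dist D z w"
      unfolding C_def using M(2) by (intro norm_le_kobayashi_dist D z w) force
    also have "\<dots> < \<rho>" using w(2) C by (simp add: pos_less_divide_eq mult.commute)
    finally have "w \<in> ball z \<rho>" by (simp add: dist_norm)
    then show "w \<in> f ` ball 0 1" using \<rho>(2) by blast
  qed
  then have "ereal (\<rho> / C) \<le> fridman_q D f z" unfolding fridman_q_def
    using \<rho>(1) C by (intro Sup_upper) auto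
  moreover have "0 < ereal (\<rho> / C)" using \<rho>(1) C by simp
  ultimately show ?thesis by (rule less_le_trans[rotated])
qed

lemma ereal_inverse_less_imp_less:
  fixes q :: ereal
  assumes "0 < q" "1 / q < ereal (1 / T)" "0 < T"
  shows "ereal T < q"
  using assms by (cases q) (auto simp: field_simps one_ereal_def)

text \<open>With \<open>d = fridman_e D z < 1\<close> the hypothesis says \<open>1 - d < x\<close>,
  hence \<open>(1 + d) / (1 - d) > 1 / x\<close> and \<open>1 / fridman_h D z > - ln x\<close>; the
  case \<open>fridman_h D z = 0\<close> is immediate. Strictness is what allows passing from the
  infimum to one embedding and from the supremum in \<open>fridman_q\<close> to one radius.\<close>

lemma fridman_e_gt_imp_embedding:
  fixes D :: "(complex ^ 'n) set"
  assumes D: "open D" "connected D" "bounded D" and z: "z \<in> D"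
    and x: "0 < x" "x < 1" and e: "fridman_e D z > 1 - x"
  obtains f where "f \<in> ball_embeddings D z" "kobayashi_ball D z (- ln x) \<subseteq> f ` ball 0 1"
proof -
  define T where "T = - ln x"
  have T: "T > 0" using x by (simp add: T_def)
  obtain f0 where f0: "f0 \<in> ball_embeddings D z" using ball_embeddings_nonempty[OF D(1) z] by blast
  have q: "0 < fridman_q D f z" if "f \<in> ball_embeddings D z" for f by (rule fridman_q_pos[OF D z that])
  have h0: "0 \<le> fridman_h D z" unfolding fridman_h_def
  proof (rule INF_greatest)
    fix f assume "f \<in> ball_embeddings D z"
    then show "0 \<le> 1 / fridman_q D f z" using q[of f] by (cases "fridman_q D f z") (auto simp: one_ereal_def)
  qed
  have "fridman_h D z \<le> 1 / fridman_q D f0 z" unfolding fridman_h_def by (rule INF_lower[OF f0])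
  moreover have "1 / fridman_q D f0 z < \<infinity>" using q[OF f0] by (cases "fridman_q D f0 z") (auto simp: one_ereal_def)
  ultimately have hfin: "fridman_h D z < \<infinity>" by (rule le_less_trans)
  have "fridman_h D z < ereal (1 / T)"
  proof (cases "fridman_h D z = 0")
    case True
    then show ?thesis using T by (simp add: zero_ereal_def)
  next
    case False
    with h0 hfin obtain \<eta> where \<eta>: "fridman_h D z = ereal \<eta>" "\<eta> > 0"
      by (cases "fridman_h D z") (auto simp: zero_ereal_def)
    define d where "d = fridman_e D z"
    have "1 / fridman_h D z = ereal (1 / \<eta>)" using \<eta> by (simp add: one_ereal_def)
    then have "d = (THE e. 0 < e \<and> e < 1 \<and> ereal (1 / \<eta>) = ereal (ln ((1 + e) / (1 - e))))"
      unfolding d_def fridman_e_def using False by simp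
    moreover have "\<exists>!e. 0 < e \<and> e < 1 \<and> ereal (1 / \<eta>) = ereal (ln ((1 + e) / (1 - e)))"
      by (rule fridman_e_unique) (use \<eta> in simp)
    ultimately have d: "0 < d" "d < 1" "1 / \<eta> = ln ((1 + d) / (1 - d))"
      using theI'[of "\<lambda>e. 0 < e \<and> e < 1 \<and> ereal (1 / \<eta>) = ereal (ln ((1 + e) / (1 - e)))"] by simp_all
    have dx: "1 - d < x" using e by (simp add: d_def)
    have "1 / x < 1 / (1 - d)" using dx d by (intro divide_strict_left_mono) (auto intro: mult_pos_pos x)
    also have "\<dots> \<le> (1 + d) / (1 - d)" using d by (intro divide_right_mono) auto
    finally have "ln (1 / x) < ln ((1 + d) / (1 - d))" using x by (subst ln_less_cancel_iff) (use d in auto)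
    then have "T < 1 / \<eta>" using x d(3) by (simp add: T_def ln_div)
    then show ?thesis using \<eta> T by (simp add: field_simps)
  qed
  then obtain f where f: "f \<in> ball_embeddings D z" "1 / fridman_q D f z < ereal (1 / T)"
    unfolding fridman_h_def INF_less_iff by blast
  have "ereal T < fridman_q D f z" by (rule ereal_inverse_less_imp_less[OF q[OF f(1)] f(2) T])
  then obtain r where r: "T < r" "kobayashi_ball D z r \<subseteq> f ` ball 0 1"
    unfolding fridman_q_def less_Sup_iff by auto
  then show ?thesis using that[OF f(1)] kobayashi_ball_mono[of T r D z] by (simp add: T_def[symmetric])
qed

section \<open>The Kobayashi distance near a smooth boundary point\<close>

text \<open>A bound for \<open>\<rho>''\<close> on a compact ball makes \<open>\<rho>'\<close>
  Lipschitz there, which gives a quadratic remainder. One constant \<open>M\<close> must serve all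
  base points near \<open>p\<close>, because discs are attached at the moving points
  \<open>z j\<close>.\<close>

lemma C2_taylor:
  fixes \<rho> :: "'a::euclidean_space \<Rightarrow> real"
  assumes U: "open U" "p \<in> U" and C2: "C2_on \<rho> U"
  obtains \<rho>' :: "'a \<Rightarrow> 'a \<Rightarrow>\<^sub>L real" and R M where "R > 0" "M > 0" "cball p R \<subseteq> U"
    "\<And>x. x \<in> U \<Longrightarrow> (\<rho> has_derivative blinfun_apply (\<rho>' x)) (at x)" "continuous_on U \<rho>'"
    "\<And>x y. x \<in> cball p R \<Longrightarrow> y \<in> cball p R \<Longrightarrow> \<bar>\<rho> y - \<rho> x - \<rho>' x (y - x)\<bar> \<le> M * (norm (y - x))\<^sup>2"
proof -
  obtain \<rho>' :: "'a \<Rightarrow> 'a \<Rightarrow>\<^sub>L real" and \<rho>'' :: "'a \<Rightarrow> 'a \<Rightarrow>\<^sub>L 'a \<Rightarrow>\<^sub>L real"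
    where d1: "\<And>x. x \<in> U \<Longrightarrow> (\<rho> has_derivative blinfun_apply (\<rho>' x)) (at x)"
      and d2: "\<And>x. x \<in> U \<Longrightarrow> (\<rho>' has_derivative blinfun_apply (\<rho>'' x)) (at x)" and c: "continuous_on U \<rho>''"
    using C2 unfolding C2_on_def by blast
  obtain R where R: "R > 0" "cball p R \<subseteq> U" using U open_contains_cball by blast
  have "bounded (\<rho>'' ` cball p R)"
    using R(2) c by (intro compact_imp_bounded compact_continuous_image) (auto intro: continuous_on_subset)
  then obtain M where M: "M > 0" "\<And>x. x \<in> cball p R \<Longrightarrow> norm (\<rho>'' x) \<le> M" unfolding bounded_pos by auto
  have lip: "norm (\<rho>' x - \<rho>' y) \<le> M * norm (x - y)" if "x \<in> cball p R" "y \<in> cball p R" for x y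
  proof (rule differentiable_bound[OF convex_cball[of p R] _ _ that])
    show "(\<rho>' has_derivative blinfun_apply (\<rho>'' x)) (at x within cball p R)" if "x \<in> cball p R" for x
      using d2 R(2) that by (meson has_derivative_at_withinI subsetD)
    show "onorm (blinfun_apply (\<rho>'' x)) \<le> M" if "x \<in> cball p R" for x
      using M(2)[OF that] by (simp add: norm_blinfun.rep_eq)
  qed
  have taylor: "\<bar>\<rho> y - \<rho> x - \<rho>' x (y - x)\<bar> \<le> M * (norm (y - x))\<^sup>2" if xy: "x \<in> cball p R" "y \<in> cball p R" for x y
  proof -
    have seg: "closed_segment x y \<subseteq> cball p R" using xy by (intro closed_segment_subset convex_cball)
    have "norm (\<rho> y - \<rho> x - \<rho>' x (y - x)) \<le> norm (y - x) * (M * norm (y - x))"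
    proof (rule differentiable_bound_linearization[where S = "closed_segment x y" and f' = "\<lambda>x. blinfun_apply (\<rho>' x)"])
      show "x + t *\<^sub>R (y - x) \<in> closed_segment x y" if "t \<in> {0..1}" for t
        using that unfolding in_segment by (intro exI[of _ t]) (auto simp: algebra_simps)
      show "(\<rho> has_derivative blinfun_apply (\<rho>' u)) (at u within closed_segment x y)" if "u \<in> closed_segment x y" for u
        using d1 R(2) seg that by (meson has_derivative_at_withinI subsetD)
      show "onorm (blinfun_apply (\<rho>' u) - blinfun_apply (\<rho>' x)) \<le> M * norm (y - x)" if u: "u \<in> closed_segment x y" for u
      proof -
        have "blinfun_apply (\<rho>' u) - blinfun_apply (\<rho>' x) = blinfun_apply (\<rho>' u - \<rho>' x)"
          by (simp add: fun_eq_iff blinfun.diff_left)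
        then have "onorm (blinfun_apply (\<rho>' u) - blinfun_apply (\<rho>' x)) = norm (\<rho>' u - \<rho>' x)"
          by (simp add: norm_blinfun.rep_eq)
        also have "\<dots> \<le> M * norm (u - x)" using lip seg u xy by blast
        also have "\<dots> \<le> M * norm (y - x)"
          using M(1) segment_bound1[OF u] by (simp add: norm_minus_commute)
        finally show ?thesis .
      qed
    qed simp
    then show ?thesis by (simp add: power2_eq_square mult_ac)
  qed
  have "continuous_on U \<rho>'"
    using d2 has_derivative_continuous by (metis continuous_at_imp_continuous_on)
  from that[OF R(1) M(1) R(2) d1 this taylor] show ?thesis by blast
qed

lemma infdist_frontier_le:
  fixes x y :: "'a::real_normed_vector"
  assumes "x \<in> D" "y \<notin> D"
  shows "infdist x (frontier D) \<le> dist x y"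
proof -
  have "closed_segment x y \<inter> frontier D \<noteq> {}"
    by (rule connected_Int_frontier) (use assms in auto)
  then obtain q where q: "q \<in> closed_segment x y" "q \<in> frontier D" by blast
  have "infdist x (frontier D) \<le> dist x q" by (rule infdist_le[OF q(2)])
  also have "\<dots> \<le> dist x y" using segment_bound1[OF q(1)] by (simp add: dist_norm norm_minus_commute)
  finally show ?thesis .
qed

lemma real_linear_on_complex_line:
  fixes L :: "(complex ^ 'n) \<Rightarrow>\<^sub>L real"
  shows "L (\<zeta> *s e) = Re (Complex (L e) (- L (\<i> *s e)) * \<zeta>)"
proof -
  have "\<zeta> *s e = Re \<zeta> *\<^sub>R e + Im \<zeta> *\<^sub>R (\<i> *s e)"
    unfolding scaleR_eq_smult by (simp add: vec_eq_iff) (simp add: complex_eq_iff algebra_simps)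
  then show ?thesis by (simp add: blinfun.add_right blinfun.scaleR_right)
qed

text \<open>Near \<open>p\<close> the complex disc of radius \<open>r + \<eta>\<close> about \<open>x + r v\<close>, with \<open>v\<close> the inner complex normal
  direction at \<open>x\<close> and \<open>\<eta>\<close> comparable to \<open>- \<rho> x\<close>, stays in \<open>D\<close> and contains \<open>x\<close> at depth \<open>\<eta>\<close>.\<close>

lemma kobayashi_dist_upper_estimate:
  fixes D :: "(complex ^ 'n) set"
  assumes D: "open D" "connected D" and p: "C2_boundary_point D p"
    and z: "\<And>j. j \<ge> 1 \<Longrightarrow> z j \<in> D" "z \<longlonglongrightarrow> p"
  obtains z0 C where "z0 \<in> D"
    "\<forall>\<^sub>F j in sequentially. kobayashi_dist D (z j) z0 \<le> C - ln (infdist (z j) (frontier D))"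
proof -
  obtain U \<rho> where U: "open U" "p \<in> U" "C2_on \<rho> U" "\<And>z. z \<in> U \<Longrightarrow> frechet_derivative \<rho> (at z) \<noteq> (\<lambda>v. 0)"
    "D \<inter> U = {z \<in> U. \<rho> z < 0}" and pf: "p \<in> frontier D"
    using p unfolding C2_boundary_point_def by blast
  obtain \<rho>' R M where R: "R > 0" "M > 0" "cball p R \<subseteq> U"
    and d\<rho>: "\<And>x. x \<in> U \<Longrightarrow> (\<rho> has_derivative blinfun_apply (\<rho>' x)) (at x)" and c\<rho>': "continuous_on U \<rho>'"
    and taylor: "\<And>x y. x \<in> cball p R \<Longrightarrow> y \<in> cball p R \<Longrightarrow> \<bar>\<rho> y - \<rho> x - \<rho>' x (y - x)\<bar> \<le> M * (norm (y - x))\<^sup>2"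
    using C2_taylor[OF U(1-3)] by metis
  have mem: "x \<in> D \<longleftrightarrow> \<rho> x < 0" if "x \<in> cball p R" for x using U(5) R(3) that by blast
  have pR: "p \<in> cball p R" using R by simp
  have evD: "\<forall>\<^sub>F j in sequentially. z j \<in> D"
    using eventually_ge_at_top[of "1::nat"] by eventually_elim (rule z(1))
  have evR: "\<forall>\<^sub>F j in sequentially. z j \<in> cball p (R / 2)"
    using tendstoD[OF z(2), of "R / 2"] R(1) by (auto simp: dist_commute elim!: eventually_mono)
  have isC: "isCont \<rho> p" using d\<rho>[OF U(2)] by (rule has_derivative_continuous)
  have lim\<rho>: "(\<lambda>j. \<rho> (z j)) \<longlonglongrightarrow> \<rho> p" by (rule isCont_tendsto_compose[OF isC z(2)])
  have "\<rho> p = 0"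
  proof (rule antisym)
    show "\<rho> p \<le> 0"
    proof (rule tendsto_upperbound[OF lim\<rho>])
      show "\<forall>\<^sub>F j in sequentially. \<rho> (z j) \<le> 0" using evD evR
      proof eventually_elim
        case (elim j)
        then have "z j \<in> cball p R" using R(1) by simp
        then show ?case using mem elim(1) by force
      qed
    qed simp
    have "p \<notin> D" using pf D(1) by (simp add: frontier_def interior_open)
    then show "0 \<le> \<rho> p" using mem[OF pR] by simp
  qed
  then have lim0: "(\<lambda>j. - \<rho> (z j)) \<longlonglongrightarrow> 0" using tendsto_minus[OF lim\<rho>] by simp
  obtain e0 where "blinfun_apply (\<rho>' p) e0 \<noteq> 0"
    using U(4)[OF U(2)] frechet_derivative_at[OF d\<rho>[OF U(2)]] by auto
  then have e0: "blinfun_apply (\<rho>' p) e0 \<noteq> 0" "e0 \<noteq> 0" by (auto simp: blinfun.zero_right)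
  define e where "e = (1 / norm e0) *\<^sub>R e0"
  have e: "norm e = 1" "\<rho>' p e \<noteq> 0" using e0 by (simp_all add: e_def blinfun.scaleR_right)
  \<comment> \<open>\<open>c x\<close> is twice the Wirtinger derivative of \<open>\<rho>\<close> at
    \<open>x\<close> in the direction \<open>e\<close>. Fixing \<open>e\<close> for all
    \<open>x\<close> makes \<open>c\<close> continuous.\<close>
  define c where "c x = Complex (\<rho>' x e) (- \<rho>' x (\<i> *s e))" for x
  have c: "\<rho>' x (\<zeta> *s e) = Re (c x * \<zeta>)" for x \<zeta> unfolding c_def by (rule real_linear_on_complex_line)
  \<comment> \<open>Half of \<open>cmod (c p)\<close>, so that \<open>cmod (c (z j))\<close> is
    eventually between \<open>\<kappa>\<close> and \<open>3 * \<kappa>\<close>.\<close>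
  define \<kappa> where "\<kappa> = cmod (c p) / 2"
  have cp0: "c p \<noteq> 0" using e(2) by (simp add: c_def complex_eq_iff)
  then have \<kappa>: "\<kappa> > 0" by (simp add: \<kappa>_def)
  \<comment> \<open>A unit multiple of \<open>e\<close>, rotated so that
    \<open>\<rho>' x (\<zeta> *s v x) = - cmod (c x) * Re \<zeta>\<close>: to first order, positive
    \<zeta> decrease \<open>\<rho>\<close> and imaginary \<zeta> leave it unchanged.\<close>
  define v where "v x = (- (cnj (c x) / of_real (cmod (c x)))) *s e" for x
  have cv: "\<rho>' x (\<zeta> *s v x) = - cmod (c x) * Re \<zeta>" if "c x \<noteq> 0" for x \<zeta>
  proof -
    have "c x * (\<zeta> * (- (cnj (c x) / of_real (cmod (c x))))) = - (\<zeta> * (c x * cnj (c x)) / of_real (cmod (c x)))"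
      by simp
    also have "c x * cnj (c x) = of_real (cmod (c x) * cmod (c x))"
      by (simp add: complex_norm_square[symmetric] power2_eq_square[symmetric])
    also have "- (\<zeta> * of_real (cmod (c x) * cmod (c x)) / of_real (cmod (c x))) = of_real (- cmod (c x)) * \<zeta>"
      using that by simp
    finally have *: "c x * (\<zeta> * (- (cnj (c x) / of_real (cmod (c x))))) = of_real (- cmod (c x)) * \<zeta>" .
    have "\<rho>' x (\<zeta> *s v x) = Re (c x * (\<zeta> * (- (cnj (c x) / of_real (cmod (c x))))))"
      unfolding v_def vector_smult_assoc c ..
    then show ?thesis unfolding * by simp
  qed
  have nv: "norm (v x) = 1" if "c x \<noteq> 0" for x using that e(1) by (simp add: v_def norm_smult norm_divide)
  have "isCont \<rho>' p" using c\<rho>' U(1,2) continuous_on_eq_continuous_at by blast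
  then have limc: "(\<lambda>j. c (z j)) \<longlonglongrightarrow> c p" unfolding c_def
    by (intro tendsto_Complex tendsto_minus blinfun.tendsto tendsto_const isCont_tendsto_compose[OF _ z(2)])
  have evc: "\<forall>\<^sub>F j in sequentially. \<kappa> < cmod (c (z j)) \<and> cmod (c (z j)) < 3 * \<kappa>"
    using tendstoD[OF limc \<kappa>]
  proof eventually_elim
    case (elim j)
    then have "cmod (c (z j) - c p) < \<kappa>" by (simp add: dist_norm)
    moreover have "\<bar>cmod (c (z j)) - cmod (c p)\<bar> \<le> cmod (c (z j) - c p)" by (rule norm_triangle_ineq3)
    moreover have "cmod (c p) = 2 * \<kappa>" by (simp add: \<kappa>_def)
    ultimately show ?case by linarith
  qed
  have taylor_v: "\<bar>\<rho> (x + \<zeta> *s v x) - \<rho> x + cmod (c x) * Re \<zeta>\<bar> \<le> M * (cmod \<zeta>)\<^sup>2"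
    "x + \<zeta> *s v x \<in> cball p R"
    if "x \<in> cball p (R / 2)" "c x \<noteq> 0" "cmod \<zeta> \<le> R / 2" for x \<zeta>
  proof -
    have n: "norm (\<zeta> *s v x) = cmod \<zeta>" using nv[OF that(2)] by (simp add: norm_smult)
    have "dist p (x + \<zeta> *s v x) \<le> dist p x + dist x (x + \<zeta> *s v x)" by (rule dist_triangle)
    then show in2: "x + \<zeta> *s v x \<in> cball p R" using that(1,3) unfolding dist_add_right n by simp
    have "x \<in> cball p R" using that(1) R(1) by simp
    from taylor[OF this in2] show "\<bar>\<rho> (x + \<zeta> *s v x) - \<rho> x + cmod (c x) * Re \<zeta>\<bar> \<le> M * (cmod \<zeta>)\<^sup>2"
      by (simp add: n cv[OF that(2)])
  qed
  \<comment> \<open>The bound \<open>2 * M * r \<le> \<kappa>\<close> lets the linear term absorb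
    the quadratic remainder. The bound \<open>R / 6\<close> keeps the disc of radius
    \<open>r + \<eta>\<close> about \<open>x + r v\<close> within reach of the Taylor estimate, as
    its parameters satisfy \<open>cmod \<zeta> < 3 * r \<le> R / 2\<close>.\<close>
  define r where "r = min (\<kappa> / (2 * M)) (R / 6)"
  have r: "r > 0" "r \<le> R / 6" using \<kappa> R by (simp_all add: r_def)
  have "2 * M * r \<le> 2 * M * (\<kappa> / (2 * M))" using R(2) by (intro mult_left_mono) (simp_all add: r_def)
  then have rM: "2 * M * r \<le> \<kappa>" using R(2) by simp
  define z0 where "z0 = p + of_real r *s v p"
  have z0: "z0 \<in> D"
  proof -
    have rr: "cmod (of_real r) \<le> R / 2" using r R(1) by simp
    have "\<bar>\<rho> z0 - \<rho> p + 2 * \<kappa> * r\<bar> \<le> M * r\<^sup>2" "z0 \<in> cball p R"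
      using taylor_v[of p "of_real r"] rr cp0 R(1) by (simp_all add: z0_def \<kappa>_def)
    moreover have "M * r\<^sup>2 \<le> \<kappa> * r"
    proof -
      have "M * r * r \<le> \<kappa> * r"
        using rM r(1) mult_pos_pos[OF R(2) r(1)] by (intro mult_right_mono) linarith+
      then show ?thesis by (simp add: power2_eq_square mult.assoc)
    qed
    moreover have "\<kappa> * r > 0" using \<kappa> r by simp
    ultimately have "\<rho> z0 < 0" using \<open>\<rho> p = 0\<close> unfolding abs_le_iff by linarith
    then show ?thesis using mem \<open>z0 \<in> cball p R\<close> by blast
  qed
  obtain r0 where r0: "r0 > 0" "ball z0 r0 \<subseteq> D" using z0 D(1) open_contains_ball by blast
  have "(\<lambda>j. z j + of_real r *s v (z j)) \<longlonglongrightarrow> z0"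
  proof -
    have "(\<lambda>j. - (cnj (c (z j)) / of_real (cmod (c (z j))))) \<longlonglongrightarrow> - (cnj (c p) / of_real (cmod (c p)))"
      using limc cp0 by (intro tendsto_intros) auto
    then have "(\<lambda>j. v (z j)) \<longlonglongrightarrow> v p" unfolding v_def by (rule bounded_linear.tendsto[OF bounded_linear_smult_left])
    then show ?thesis unfolding z0_def scaleR_eq_smult[symmetric] by (intro tendsto_intros z(2))
  qed
  then have evw: "\<forall>\<^sub>F j in sequentially. dist (z j + of_real r *s v (z j)) z0 < r0 / 2"
    by (rule tendstoD) (use r0 in simp)
  have small: "\<forall>\<^sub>F j in sequentially. - \<rho> (z j) < a" if "a > 0" for a
    by (rule order_tendstoD(2)[OF lim0 that])
  \<comment> \<open>Thresholds for \<open>\<sigma> = - \<rho> x\<close>: they ensure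
    \<open>\<eta> < r\<close>, \<open>M * t \<le> \<kappa> / 2\<close> and
    \<open>t \<le> R / 2\<close> respectively.\<close>
  have pos: "6 * \<kappa> * r > 0" "\<kappa> * \<kappa> / (4 * M) > 0" "\<kappa> * R / 4 > 0" using \<kappa> R r by simp_all
  define C where "C = ln (3 * r) + ln (6 * \<kappa>) - ln (\<kappa> / 2) + ln 3"
  have "\<forall>\<^sub>F j in sequentially. kobayashi_dist D (z j) z0 \<le> C - ln (infdist (z j) (frontier D))"
    using evD evR evc evw small[OF pos(1)] small[OF pos(2)] small[OF pos(3)]
  proof eventually_elim
    case (elim j)
    define x where "x = z j"
    define \<sigma> where "\<sigma> = - \<rho> x"
    define w where "w = x + of_real r *s v x"
    have xD: "x \<in> D" and xR: "x \<in> cball p (R / 2)" and cx: "\<kappa> < cmod (c x)" "cmod (c x) < 3 * \<kappa>"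
      and wz: "dist w z0 < r0 / 2"
      using elim by (simp_all add: x_def w_def)
    have cx0: "c x \<noteq> 0" using cx \<kappa> by auto
    have "x \<in> cball p R" using xR R(1) by simp
    then have \<sigma>0: "\<sigma> > 0" using mem xD by (simp add: \<sigma>_def)
    have \<sigma>1: "\<sigma> < 6 * \<kappa> * r" "\<sigma> < \<kappa> * \<kappa> / (4 * M)" "\<sigma> < \<kappa> * R / 4"
      using elim \<kappa> R by (simp_all add: \<sigma>_def x_def)
    \<comment> \<open>Going out by \<open>\<eta>\<close> beyond \<open>x\<close> will raise
      \<open>\<rho>\<close> by at most \<open>9 / 2 * \<kappa> * \<eta>\<close>, so
      \<open>\<sigma> = 6 * \<kappa> * \<eta>\<close> leaves a margin.\<close>
    define \<eta> where "\<eta> = \<sigma> / (6 * \<kappa>)"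
    have \<eta>: "\<eta> > 0" "\<eta> < r" using \<sigma>0 \<sigma>1(1) \<kappa> by (simp_all add: \<eta>_def pos_divide_less_eq mult_ac)
    have \<sigma>\<eta>: "\<sigma> = 6 * \<kappa> * \<eta>" using \<kappa> by (simp add: \<eta>_def)
    \<comment> \<open>Stepping outward by \<open>t\<close> gains at least
      \<open>\<kappa> * t = 2 * \<sigma>\<close> to first order and loses at most
      \<open>\<kappa> / 2 * t = \<sigma>\<close> to the remainder, so the endpoint is outside
      \<open>D\<close>. Hence the distance to the frontier is at most
      \<open>2 * \<sigma> / \<kappa>\<close>.\<close>
    define t where "t = 2 * \<sigma> / \<kappa>"
    have t: "t > 0" "M * t \<le> \<kappa> / 2" "t \<le> R / 2" "\<kappa> * t = 2 * \<sigma>"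
      using \<sigma>0 \<sigma>1 \<kappa> R by (simp_all add: t_def field_simps)
    have "x + of_real (- t) *s v x \<notin> D"
    proof -
      have "\<bar>\<rho> (x + of_real (- t) *s v x) - \<rho> x - cmod (c x) * t\<bar> \<le> M * t\<^sup>2"
        and in2: "x + of_real (- t) *s v x \<in> cball p R"
        using taylor_v[OF xR cx0, of "of_real (- t)"] t by simp_all
      then have "\<rho> (x + of_real (- t) *s v x) \<ge> - \<sigma> + cmod (c x) * t - M * t\<^sup>2" by (simp add: \<sigma>_def abs_le_iff)
      moreover have "\<kappa> * t \<le> cmod (c x) * t" using cx t by (intro mult_right_mono) auto
      moreover have "M * t\<^sup>2 \<le> \<kappa> / 2 * t" using mult_right_mono[OF t(2), of t] t(1) by (simp add: power2_eq_square mult.assoc)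
      ultimately have "\<rho> (x + of_real (- t) *s v x) \<ge> 0" using t(4) by (simp add: algebra_simps)
      then show ?thesis using mem[OF in2] by simp
    qed
    from infdist_frontier_le[OF xD this] have "infdist x (frontier D) \<le> norm (of_real (- t) *s v x)"
      unfolding dist_add_right .
    then have "infdist x (frontier D) \<le> t" using nv[OF cx0] t(1) by (simp add: norm_smult)
    then have \<delta>1: "\<kappa> / 2 * infdist x (frontier D) \<le> \<sigma>" using mult_left_mono[of "infdist x (frontier D)" t \<kappa>] \<kappa> t(4) by simp
    have "infdist x (frontier D) > 0"
    proof -
      have "x \<notin> frontier D" using xD D(1) by (simp add: frontier_def interior_open)
      then show ?thesis using infdist_pos_not_in_closed[OF frontier_closed _ ] pf by blast
    qed
    then have \<delta>2: "ln (\<kappa> / 2) + ln (infdist x (frontier D)) \<le> ln \<sigma>"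
      using \<delta>1 \<kappa> \<sigma>0 by (subst ln_mult_pos[symmetric]) auto
    have disc: "holomorphic_disc_in (\<lambda>\<xi>. w + \<xi> *s (of_real (r + \<eta>) *s v x)) D"
    proof (rule affine_disc)
      fix \<xi> :: complex assume \<xi>: "\<xi> \<in> ball 0 1"
      define \<zeta> where "\<zeta> = of_real r + of_real (r + \<eta>) * \<xi>"
      have eq: "w + \<xi> *s (of_real (r + \<eta>) *s v x) = x + \<zeta> *s v x"

        by (simp add: w_def \<zeta>_def vec_eq_iff algebra_simps)
      have zr: "cmod (\<zeta> - of_real r) < r + \<eta>" using \<xi> r \<eta> by (simp add: \<zeta>_def norm_mult del: of_real_add)
      then have "(cmod (\<zeta> - of_real r))\<^sup>2 < (r + \<eta>)\<^sup>2" using r \<eta> by (intro power_strict_mono) auto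
      \<comment> \<open>The square of \<open>cmod (\<zeta> - r) < r + \<eta>\<close>, expanded. It
        trades the quadratic remainder for \<open>2 * M * r * Re \<zeta>\<close>, which changes the
        coefficient \<open>cmod (c x)\<close> only to \<open>cmod (c x) - 2 * M * r\<close>, still
        nonnegative; then \<open>Re \<zeta> > - \<eta>\<close> finishes the estimate.\<close>
      then have q: "(cmod \<zeta>)\<^sup>2 < 2 * r * Re \<zeta> + 2 * r * \<eta> + \<eta>\<^sup>2"
        unfolding cmod_power2 by (simp add: power2_eq_square algebra_simps)
      have "\<bar>Re (\<zeta> - of_real r)\<bar> < r + \<eta>" using zr abs_Re_le_cmod le_less_trans by blast
      then have Re: "Re \<zeta> > - \<eta>" by simp
      have "cmod \<zeta> \<le> cmod (\<zeta> - of_real r) + cmod (of_real r)" using norm_triangle_ineq[of "\<zeta> - of_real r" "of_real r"] by simp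
      then have "cmod \<zeta> \<le> R / 2" using zr r \<eta> by simp
      from taylor_v[OF xR cx0 this]
      have 1: "\<rho> (x + \<zeta> *s v x) \<le> - \<sigma> - cmod (c x) * Re \<zeta> + M * (cmod \<zeta>)\<^sup>2" and in2: "x + \<zeta> *s v x \<in> cball p R"
        by (simp_all add: abs_le_iff \<sigma>_def)
      have 2: "M * (cmod \<zeta>)\<^sup>2 \<le> M * (2 * r * Re \<zeta> + 2 * r * \<eta> + \<eta>\<^sup>2)" using q R(2) by (intro mult_left_mono) auto
      have 3: "M * \<eta>\<^sup>2 \<le> M * (r * \<eta>)" using \<eta> R(2) by (simp add: power2_eq_square)
      have 4: "M * (r * \<eta>) \<le> \<kappa> / 2 * \<eta>" using mult_right_mono[OF rM, of \<eta>] \<eta> by (simp add: mult_ac)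
      have 5: "(cmod (c x) - 2 * M * r) * (- Re \<zeta>) \<le> (cmod (c x) - 2 * M * r) * \<eta>"
        using Re rM cx by (intro mult_left_mono) auto
      have 6: "(cmod (c x) - 2 * M * r) * \<eta> \<le> 3 * \<kappa> * \<eta>"
      proof -
        have "0 < M * r" using R(2) r(1) by simp
        then show ?thesis using cx \<eta> by (intro mult_right_mono) auto
      qed
      have 7: "\<kappa> * \<eta> > 0" using \<kappa> \<eta> by simp
      have "M * (2 * r * Re \<zeta> + 2 * r * \<eta> + \<eta>\<^sup>2) = 2 * M * r * Re \<zeta> + 2 * (M * (r * \<eta>)) + M * \<eta>\<^sup>2" by (simp add: algebra_simps)
      moreover have "(cmod (c x) - 2 * M * r) * (- Re \<zeta>) = - cmod (c x) * Re \<zeta> + 2 * M * r * Re \<zeta>" by (simp add: algebra_simps)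
      ultimately have "\<rho> (x + \<zeta> *s v x) \<le> - \<sigma> + 3 * (\<kappa> * \<eta>) + 3 / 2 * (\<kappa> * \<eta>)"
        using 1 2 3 4 5 6 by linarith
      then have "\<rho> (x + \<zeta> *s v x) < 0" using 7 \<sigma>\<eta> by linarith
      then show "w + \<xi> *s (of_real (r + \<eta>) *s v x) \<in> D" unfolding eq using mem[OF in2] by blast
    qed
    \<comment> \<open>\<open>x\<close> sits at parameter \<open>- m\<close> of the disc, whose
      centre is \<open>w\<close>. Their distance is
      \<open>ln ((2 * r + \<eta>) / \<eta>) \<le> ln (3 * r / \<eta>)\<close>, that is
      \<open>- ln \<sigma>\<close> plus a constant: the coefficient 1 comes from this
      computation.\<close>
    define m where "m = r / (r + \<eta>)"
    have m: "0 < m" "m < 1" using r \<eta> by (simp_all add: m_def)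
    have m_in: "of_real (- m) \<in> ball (0::complex) 1" using m by simp
    have "w + of_real (- m) *s (of_real (r + \<eta>) *s v x) = x"
    proof -
      have "of_real (- m) * of_real (r + \<eta>) = (of_real (- r) :: complex)"
        unfolding of_real_mult[symmetric] using r \<eta> by (simp add: m_def)
      then show ?thesis unfolding vector_smult_assoc by (simp add: w_def vector_smult_lneg)
    qed
    moreover have "w + 0 *s (of_real (r + \<eta>) *s v x) = w" by simp
    ultimately have l1: "poincare_dist (of_real (- m)) 0 \<in> chain_lengths D x w"
      using chain_lengths_disc[OF disc m_in, of 0] by simp
    have "poincare_dist (of_real (- m)) 0 = ln ((1 + m) / (1 - m))"
      using m by (simp add: poincare_dist_def Let_def)
    also have "(1 + m) / (1 - m) = (2 * r + \<eta>) / \<eta>"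
    proof -
      have "1 + m = (2 * r + \<eta>) / (r + \<eta>)" "1 - m = \<eta> / (r + \<eta>)" using r \<eta> by (simp_all add: m_def field_simps)
      then show ?thesis using r \<eta> by simp
    qed
    also have "ln ((2 * r + \<eta>) / \<eta>) \<le> ln (3 * r / \<eta>)" using r \<eta> by (simp add: divide_right_mono)
    also have "\<dots> = ln (3 * r) - ln \<eta>" using r \<eta> by (simp add: ln_div)
    also have "ln \<eta> = ln \<sigma> - ln (6 * \<kappa>)" using \<sigma>0 \<kappa> by (simp add: \<eta>_def ln_div)
    finally have l2: "poincare_dist (of_real (- m)) 0 \<le> ln (3 * r) + ln (6 * \<kappa>) - ln \<sigma>" by simp
    have "norm (w - z0) < r0 / 2" using wz by (simp add: dist_norm)
    from chain_lengths_append[OF l1 chain_lengths_ball(2)[OF r0(2) this]]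
    have "kobayashi_dist D x z0 \<le> poincare_dist (of_real (- m)) 0 + ln 3" by (rule kobayashi_dist_le)
    then show ?case using l2 \<delta>2 unfolding C_def x_def[symmetric] by linarith
  qed
  then show ?thesis using that z0 by blast
qed

section \<open>The main theorem\<close>

theorem theorem1p3:
  fixes D :: "(complex ^ 'n) set" and p :: "complex ^ 'n"
    and z :: "nat \<Rightarrow> complex ^ 'n" and \<epsilon> :: "nat \<Rightarrow> real"
  assumes "open D" and "connected D" and "bounded D"
    and "C2_boundary_point D p"
    and "\<And>j. j \<ge> 1 \<Longrightarrow> z j \<in> D" and "z \<longlonglongrightarrow> p"
    and "\<And>j. j \<ge> 1 \<Longrightarrow> \<epsilon> j > 0" and "\<epsilon> \<longlonglongrightarrow> 0"
    and "\<And>j. j \<ge> 1 \<Longrightarrow> fridman_e D (z j) > 1 - \<epsilon> j * infdist (z j) (frontier D)"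
  shows "biholomorphic D (ball (0 :: complex ^ 'n) 1)"
proof -
  note D = assms(1-3)
  let ?B = "ball (0 :: complex ^ 'n) 1"
  let ?\<delta> = "\<lambda>j. infdist (z j) (frontier D)"
  obtain z0 C where z0: "z0 \<in> D"
    and C: "\<forall>\<^sub>F j in sequentially. kobayashi_dist D (z j) z0 \<le> C - ln (?\<delta> j)"
    using kobayashi_dist_upper_estimate[OF D(1,2) assms(4,5,6)] by blast
  have pf: "p \<in> frontier D" using assms(4) by (simp add: C2_boundary_point_def)
  have "\<exists>F. holomorphic_map_on F ?B \<and> inj_on F ?B \<and> F ` ?B \<subseteq> D \<and> F 0 = z0 \<and> kobayashi_ball D z0 (real (Suc k)) \<subseteq> F ` ?B" for k
  proof -
    have "\<forall>\<^sub>F j in sequentially. \<epsilon> j < min 1 (exp (- C - real (Suc k)))"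
      by (rule order_tendstoD(2)[OF assms(8)]) simp
    moreover have "\<forall>\<^sub>F j in sequentially. dist (z j) p < 1" by (rule tendstoD[OF assms(6)]) simp
    moreover have "\<forall>\<^sub>F j in sequentially. 1 \<le> j" by (rule eventually_ge_at_top)
    ultimately have "\<forall>\<^sub>F j in sequentially. kobayashi_dist D (z j) z0 \<le> C - ln (?\<delta> j) \<and>
        \<epsilon> j < min 1 (exp (- C - real (Suc k))) \<and> dist (z j) p < 1 \<and> 1 \<le> j" using C by eventually_elim blast
    then obtain j where j: "kobayashi_dist D (z j) z0 \<le> C - ln (?\<delta> j)"
      "\<epsilon> j < 1" "\<epsilon> j < exp (- C - real (Suc k))" "dist (z j) p < 1" "1 \<le> j"
      using eventually_happens'[OF sequentially_bot] by fastforce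
    have zj: "z j \<in> D" and \<epsilon>j: "\<epsilon> j > 0" using assms(5,7) j(5) by blast+
    have "z j \<notin> frontier D" using zj D(1) by (simp add: frontier_def interior_open)
    then have \<delta>: "?\<delta> j > 0" using infdist_pos_not_in_closed[OF frontier_closed] pf by blast
    have "?\<delta> j < 1" using infdist_le[OF pf, of "z j"] j(4) by simp
    \<comment> \<open>Both factors are below 1, so the radius
      \<open>- ln (\<epsilon> j * \<delta>)\<close> is positive.\<close>
    then have x1: "\<epsilon> j * ?\<delta> j < 1" using mult_strict_mono[OF j(2), of "?\<delta> j" 1] \<delta> by simp
    have x0: "0 < \<epsilon> j * ?\<delta> j" using \<epsilon>j \<delta> by simp
    obtain f where f: "f \<in> ball_embeddings D (z j)" "kobayashi_ball D (z j) (- ln (\<epsilon> j * ?\<delta> j)) \<subseteq> f ` ?B"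
      using fridman_e_gt_imp_embedding[OF D zj x0 x1 assms(9)[OF j(5)]] by blast
    have "ln (\<epsilon> j) < - C - real (Suc k)"
      using j(3) \<epsilon>j by (metis exp_less_cancel_iff exp_ln)
    \<comment> \<open>The term \<open>- ln \<delta>\<close> occurs on both sides and cancels; what
      remains is the choice of \<open>j\<close> with
      \<open>\<epsilon> j < exp (- C - real (Suc k))\<close>.\<close>
    then have T: "real (Suc k) + (C - ln (?\<delta> j)) < - ln (\<epsilon> j * ?\<delta> j)"
      using \<epsilon>j \<delta> by (simp add: ln_mult_pos)
    have sub: "kobayashi_ball D z0 (real (Suc k)) \<subseteq> f ` ?B"
    proof
      fix w assume "w \<in> kobayashi_ball D z0 (real (Suc k))"
      then have w: "w \<in> D" "kobayashi_dist D z0 w < real (Suc k)" by (auto simp: kobayashi_ball_def)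
      have "kobayashi_dist D (z j) w \<le> kobayashi_dist D (z j) z0 + kobayashi_dist D z0 w"
        by (intro kobayashi_dist_triangle chain_lengths_nonempty D zj z0 w)
      then have "w \<in> kobayashi_ball D (z j) (- ln (\<epsilon> j * ?\<delta> j))"
        using w j(1) T by (simp add: kobayashi_ball_def)
      then show "w \<in> f ` ?B" using f(2) by blast
    qed
    \<comment> \<open>The empty chain puts \<open>z0\<close> into its own Kobayashi ball and so into
      the image of \<open>f\<close>; composing with \<open>ball_aut a\<close> makes the centre take
      over the role of the preimage \<open>a\<close>.\<close>
    have "0 \<in> chain_lengths D z0 z0"
      unfolding chain_lengths_def by (rule CollectI, rule exI[of _ 0]) auto
    then have "z0 \<in> kobayashi_ball D z0 (real (Suc k))"
      using z0 kobayashi_dist_le[of 0 D z0 z0] by (simp add: kobayashi_ball_def)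
    then obtain a where a: "a \<in> ?B" "f a = z0" using sub by blast
    have na: "norm a < 1" using a by simp
    have fe: "holomorphic_map_on f ?B" "inj_on f ?B" "f ` ?B \<subseteq> D" using f(1) by (auto simp: ball_embeddings_def)
    have aB: "ball_aut a y \<in> ?B" if "y \<in> ?B" for y using norm_ball_aut[OF na] that by simp
    have aa: "ball_aut a (ball_aut a y) = y" if "y \<in> ?B" for y using ball_aut_involution[OF na] that by simp
    have img: "ball_aut a ` ?B = ?B"
    proof
      show "?B \<subseteq> ball_aut a ` ?B" using aB aa by (metis image_eqI subsetI)
    qed (use aB in blast)
    show ?thesis
    proof (rule exI[of _ "\<lambda>y. f (ball_aut a y)"], intro conjI)
      show "holomorphic_map_on (\<lambda>y. f (ball_aut a y)) ?B"
        by (rule holomorphic_map_on_compose[OF holomorphic_ball_aut[OF na] fe(1)]) (simp add: img)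
      have "inj_on (ball_aut a) ?B" by (rule inj_on_inverseI[of _ "ball_aut a"]) (rule aa)
      then have "inj_on (f \<circ> ball_aut a) ?B" by (rule comp_inj_on) (simp add: img fe(2))
      then show "inj_on (\<lambda>y. f (ball_aut a y)) ?B" by (simp add: o_def)
      have "(\<lambda>y. f (ball_aut a y)) ` ?B = f ` ?B" using img by (metis image_image)
      then show "(\<lambda>y. f (ball_aut a y)) ` ?B \<subseteq> D"
        "kobayashi_ball D z0 (real (Suc k)) \<subseteq> (\<lambda>y. f (ball_aut a y)) ` ?B" using fe(3) sub by simp_all
      show "f (ball_aut a 0) = z0" by (simp add: ball_aut_zero a)
    qed
  qed
  then obtain F where F: "\<And>k. holomorphic_map_on (F k) ?B" "\<And>k. inj_on (F k) ?B" "\<And>k. F k ` ?B \<subseteq> D" "\<And>k. F k 0 = z0"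
    and Fb: "\<And>k. kobayashi_ball D z0 (real (Suc k)) \<subseteq> F k ` ?B" by metis
  show ?thesis
  proof (rule exhaustion_biholomorphic[OF D z0 F])
    fix w assume w: "w \<in> D"
    obtain r where r: "r > 0" "ball w r \<subseteq> D" using w D(1) open_contains_ball by blast
    \<comment> \<open>The extra \<open>ln 3\<close> pays for the step from \<open>w\<close> to any
      point of \<open>ball w (r / 2)\<close>, so one \<open>N\<close> serves a whole Euclidean
      ball.\<close>
    obtain N :: nat where N: "kobayashi_dist D z0 w + ln 3 < real N" using reals_Archimedean2 by blast
    have "ball w (r / 2) \<subseteq> F k ` ?B" if k: "N \<le> k" for k
    proof
      fix y assume "y \<in> ball w (r / 2)"
      then have y: "norm (y - w) < r / 2" by (simp add: dist_norm norm_minus_commute)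
      then have yD: "y \<in> D" using r by (auto simp: dist_norm norm_minus_commute)
      have "kobayashi_dist D z0 y \<le> kobayashi_dist D z0 w + kobayashi_dist D w y"
        by (intro kobayashi_dist_triangle chain_lengths_nonempty D z0 w yD)
      also have "kobayashi_dist D w y \<le> ln 3" by (rule kobayashi_dist_le[OF chain_lengths_ball(1)[OF r(2) y]])
      finally have "kobayashi_dist D z0 y < real (Suc k)" using N k by simp
      then have "y \<in> kobayashi_ball D z0 (real (Suc k))" using yD by (simp add: kobayashi_ball_def)
      then show "y \<in> F k ` ?B" using Fb by blast
    qed
    then show "\<exists>r>0. \<forall>\<^sub>F k in sequentially. ball w r \<subseteq> F k ` ?B"
      using r(1) unfolding eventually_sequentially by (intro exI[of _ "r / 2"]) auto
  qed
qed

end
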